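(* Let $\ell>0$ be the bicycle length. The front track of every minimizing bicycle path is a straight line (segment) or an arc of a non-inflectional elastic curve of width at most $2\ell$. Moreover, every possible shape of non-inflectional elastic curve arises in this way: for every non-inflectional elastic curve $E$ there is a non-inflectional elastic curve $E'$ of the same shape as $E$, of width at most $2\ell$, and a minimizing bicycle path whose front track is an arc of $E'$.
   Context: Bicycle configuration space: $Q=\{(\mathbf b,\mathbf f)\in\mathbb R^2\times\mathbb R^2: \|\mathbf f-\mathbf b\|=\ell\}$ ($\mathbf b$ = back wheel, $\mathbf f$ = front wheel). A bicycle path is a curve $\gamma(t)=(\mathbf b(t),\mathbf f(t))$ in $Q$ satisfying the no-skid condition: $\dot{\mathbf b}(t)$ is a multiple of $\mathbf f(t)-\mathbf b(t)$ (curves are absolutely continuous, the condition holding for almost every $t$). Its front track is the plane curve $\mathbf f(t)$, considered up to reparametrization, and its length is defined as the Euclidean length of the front track. A minimizing bicycle path is a (nonconstant) bicycle path defined on a compact interval whose length is minimal among all bicycle paths connecting its two end points in $Q$. Elasticae: an immersed plane curve is an elastica (elastic curve) if its curvature $\kappa(t)$, as a function of arc length $t$, satisfies $\ddot\kappa+\frac12\kappa^3+A\kappa=0$ for some constant $A\in\mathbb R$. Then there is a constant $B\in\mathbb R$ with $\frac12\dot\kappa^2+\frac18\kappa^4+\frac A2\kappa^2=B$. A (non-straight) elastica is non-inflectional if its curvature never vanishes; these are the elasticae with $B<0$ (including circles), together with those with $B=0$, $A<0$, $\kappa\not\equiv0$ (the Euler solitons). An elastic curve here is a complete one, i.e. defined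 for all $t\in\mathbb R$; an arc of it is its restriction to a compact interval of positive length. Two plane curves have the same shape if one can be taken onto the other by a homothety, meaning a composition of an isometry and a dilation. The width of a plane curve is the infimum of the distances between two parallel lines bounding a strip which contains the curve. *)

theory Defs
  imports "HOL-Analysis.Analysis"
begin

text \<open>The Euclidean plane is the type \<^typ>\<open>complex\<close>; a point of the configuration space is a pair
  (back wheel, front wheel).\<close>

definition bicycle_space :: "real \<Rightarrow> (complex \<times> complex) set" where
  "bicycle_space l = {(b, f). norm (f - b) = l}"

text \<open>A finite family of non-overlapping compact subintervals of \<open>{a..b}\<close> is encoded as a
  division of its union; \<^term>\<open>Inf k\<close> and \<^term>\<open>Sup k\<close> are the end points of the interval \<open>k\<close>.\<close>

definition abs_continuous_on_interval :: "real \<Rightarrow> real \<Rightarrow> (real \<Rightarrow> 'a::metric_space) \<Rightarrow> bool" where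
  "abs_continuous_on_interval a b g \<longleftrightarrow>
     (\<forall>\<epsilon>>0. \<exists>\<delta>>0. \<forall>D. D division_of \<Union>D \<and> \<Union>D \<subseteq> {a..b} \<and> (\<Sum>k\<in>D. Sup k - Inf k) < \<delta> \<longrightarrow>
        (\<Sum>k\<in>D. dist (g (Inf k)) (g (Sup k))) < \<epsilon>)"

definition curve_length :: "real \<Rightarrow> real \<Rightarrow> (real \<Rightarrow> 'a::metric_space) \<Rightarrow> ennreal" where
  "curve_length a b g =
     (SUP D\<in>{D. D division_of {a..b}}. \<Sum>k\<in>D. ennreal (dist (g (Inf k)) (g (Sup k))))"

definition bicycle_path :: "real \<Rightarrow> real \<Rightarrow> real \<Rightarrow> (real \<Rightarrow> complex \<times> complex) \<Rightarrow> bool" where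
  "bicycle_path l a b \<gamma> \<longleftrightarrow>
     a \<le> b \<and>
     abs_continuous_on_interval a b \<gamma> \<and>
     (\<forall>t\<in>{a..b}. \<gamma> t \<in> bicycle_space l) \<and>
     (AE t in lebesgue_on {a..b}. \<exists>c::real.
        ((\<lambda>s. fst (\<gamma> s)) has_vector_derivative c *\<^sub>R (snd (\<gamma> t) - fst (\<gamma> t))) (at t within {a..b}))"

definition front_track :: "(real \<Rightarrow> complex \<times> complex) \<Rightarrow> real \<Rightarrow> complex" where
  "front_track \<gamma> = (\<lambda>t. snd (\<gamma> t))"

text \<open>The competitors may be parametrized by any other compact interval.\<close>

definition minimizing_bicycle_path ::
    "real \<Rightarrow> real \<Rightarrow> real \<Rightarrow> (real \<Rightarrow> complex \<times> complex) \<Rightarrow> bool" where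
  "minimizing_bicycle_path l a b \<gamma> \<longleftrightarrow>
     bicycle_path l a b \<gamma> \<and>
     \<not> \<gamma> constant_on {a..b} \<and>
     (\<forall>c d \<eta>. bicycle_path l c d \<eta> \<and> \<eta> c = \<gamma> a \<and> \<eta> d = \<gamma> b \<longrightarrow>
        curve_length a b (front_track \<gamma>) \<le> curve_length c d (front_track \<eta>))"

text \<open>The curve \<open>g\<close> on \<open>{a..b}\<close> is, up to reparametrization, the restriction of \<open>E\<close> to a compact
  interval of positive length. The parameter change need not be injective because an absolutely
  continuous \<open>g\<close> may pause; being monotone and onto an interval, it is continuous.\<close>

definition is_arc_of :: "real \<Rightarrow> real \<Rightarrow> (real \<Rightarrow> complex) \<Rightarrow> (real \<Rightarrow> complex) \<Rightarrow> bool" where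
  "is_arc_of a b g E \<longleftrightarrow>
     (\<exists>c d \<phi>. c < d \<and> mono_on {a..b} \<phi> \<and> \<phi> ` {a..b} = {c..d} \<and> (\<forall>t\<in>{a..b}. g t = E (\<phi> t)))"

definition straight_line :: "(real \<Rightarrow> complex) \<Rightarrow> bool" where
  "straight_line E \<longleftrightarrow> (\<exists>p v. norm v = 1 \<and> E = (\<lambda>t. p + t *\<^sub>R v))"

definition velocity :: "(real \<Rightarrow> complex) \<Rightarrow> real \<Rightarrow> complex" where
  "velocity E t = vector_derivative E (at t)"

definition arc_length_parametrized :: "(real \<Rightarrow> complex) \<Rightarrow> bool" where
  "arc_length_parametrized E \<longleftrightarrow>
     (\<forall>t. E differentiable (at t) \<and> norm (velocity E t) = 1 \<and> velocity E differentiable (at t))"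

text \<open>\<open>Im (cnj u * v)\<close> is the determinant of the plane vectors \<open>u\<close>, \<open>v\<close>, so this is the signed
  curvature of a curve parametrized by arc length.\<close>

definition curvature :: "(real \<Rightarrow> complex) \<Rightarrow> real \<Rightarrow> real" where
  "curvature E t = Im (cnj (velocity E t) * vector_derivative (velocity E) (at t))"

text \<open>Complete elastic curves, always parametrized by arc length; straight lines are included.\<close>

definition elastic_curve :: "(real \<Rightarrow> complex) \<Rightarrow> bool" where
  "elastic_curve E \<longleftrightarrow>
     arc_length_parametrized E \<and>
     (\<forall>t. curvature E differentiable (at t) \<and> deriv (curvature E) differentiable (at t)) \<and>
     (\<exists>A::real. \<forall>t. deriv (deriv (curvature E)) t + 1/2 * curvature E t ^ 3 + A * curvature E t = 0)"

definition non_inflectional_elastic_curve :: "(real \<Rightarrow> complex) \<Rightarrow> bool" where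
  "non_inflectional_elastic_curve E \<longleftrightarrow> elastic_curve E \<and> (\<forall>t. curvature E t \<noteq> 0)"

text \<open>The strip bounded by the lines \<open>n \<bullet> x = c\<close> and \<open>n \<bullet> x = d\<close>, where \<open>n\<close> is a unit normal, has
  width \<open>d - c\<close>. The width of a set contained in no strip is \<open>\<infinity>\<close>.\<close>

definition plane_width :: "complex set \<Rightarrow> ennreal" where
  "plane_width S =
     (INF (n, c, d)\<in>{(n, c, d). norm n = 1 \<and> c \<le> d \<and> (\<forall>x\<in>S. c \<le> n \<bullet> x \<and> n \<bullet> x \<le> d)}.
        ennreal (d - c))"

definition plane_isometry :: "(complex \<Rightarrow> complex) \<Rightarrow> bool" where
  "plane_isometry g \<longleftrightarrow> (\<forall>x y. dist (g x) (g y) = dist x y)"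

definition plane_homothety :: "(complex \<Rightarrow> complex) \<Rightarrow> bool" where
  "plane_homothety h \<longleftrightarrow>
     (\<exists>g p r. plane_isometry g \<and> r > 0 \<and> h = g \<circ> (\<lambda>x. p + r *\<^sub>R (x - p)))"

text \<open>Curves are compared up to reparametrization, not merely as point sets.\<close>

definition same_shape :: "(real \<Rightarrow> complex) \<Rightarrow> (real \<Rightarrow> complex) \<Rightarrow> bool" where
  "same_shape E E' \<longleftrightarrow>
     (\<exists>h \<phi> \<psi>. plane_homothety h \<and> homeomorphism UNIV UNIV \<phi> \<psi> \<and> (\<forall>t. h (E t) = E' (\<phi> t)))"

end

theory Submission
  imports Defs
begin

text \<open>
  Parametrize a bicycle path by the arc length of its front track \<open>f\<close> and put \<open>e = (f - b) / l\<close>,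
  \<open>v = f' \<bullet> e\<close>, \<open>w = f' \<bullet> ie\<close>; then \<open>b' = v e\<close> and \<open>e' = (w / l) ie\<close>. Conversely any frame direction
  and back speed give a bicycle path. Rotating the frame by \<open>\<epsilon> \<eta>\<close>, with a back speed \<open>q \<bullet> e\<close> for which
  the end points stay fixed, minimality forces \<open>v = p \<bullet> e\<close> and \<open>f' = p + l k ie\<close> for a constant vector
  \<open>p\<close>, with \<open>f'' = k i f'\<close> and \<open>k' = - (p \<bullet> i f') / l\<^sup>2\<close> (the variation degenerates only for constant
  \<open>e\<close>, on a straight line). Hence the curvature \<open>k\<close> vanishes identically or nowhere and solves the
  elastica equation, and the coordinate of \<open>f\<close> orthogonal to \<open>p\<close> is an affine function of \<open>k\<close>, which
  bounds the width. Conversely, an elastica with nowhere vanishing curvature has energy \<open>B \<le> 0\<close>, so a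
  rescaled copy solves the same system with \<open>|p| \<le> 1\<close>; its short arcs minimize by a calibration
  \<open>p \<bullet> f + W(\<theta>)\<close>, where \<open>\<theta>\<close> is the angle of the frame.\<close>

section \<open>Absolutely continuous curves and their length\<close>

text \<open>The first half is shaped by regularity: the no-skid condition holds only almost
  everywhere and for an arbitrary parameter, while the variation needs integral identities in front
  arc length. So it is passed on as a quadratic bound for the transversal back increment, which
  survives reparametrization, and the front velocity is replaced by a density. Length is estimated
  by a quadratic energy through \<open>sqrt x \<le> (1 + x) / 2\<close>, with equality at unit
  speed. Back speeds \<open>q \<bullet> e\<close> realize every displacement if the integral of
  \<open>e\<^sup>2\<close> has norm less than the length; equality is the degenerate case. The width
  refers to a complete curve, so geodesic arcs are prolonged to all times: by separation of
  variables unless \<open>|p| = 1\<close>, when \<open>|u - p|\<close> has a zero among the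
  directions \<open>u\<close>. Conversely, \<open>|p| \<le> 1\<close> is arranged because
  \<open>W\<close> involves the root of \<open>1 - (p \<bullet> z)\<^sup>2\<close> for all unit
  vectors \<open>z\<close>. As \<open>W\<close> depends on the angle, the frames of competitors must
  stay in one branch of the logarithm, which is why the arcs are short.\<close>

lemma abs_continuous_on_intervalE:
  assumes "abs_continuous_on_interval a b g" "\<epsilon> > 0"
  obtains \<delta> where "\<delta> > 0"
    "\<forall>D. D division_of \<Union>D \<longrightarrow> \<Union>D \<subseteq> {a..b} \<longrightarrow> (\<Sum>k\<in>D. Sup k - Inf k) < \<delta> \<longrightarrow>
        (\<Sum>k\<in>D. dist (g (Inf k)) (g (Sup k))) < \<epsilon>"
proof -
  have "\<exists>\<delta>>0. \<forall>D. D division_of \<Union>D \<and> \<Union>D \<subseteq> {a..b} \<and> (\<Sum>k\<in>D. Sup k - Inf k) < \<delta> \<longrightarrow>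
        (\<Sum>k\<in>D. dist (g (Inf k)) (g (Sup k))) < \<epsilon>"
    using assms unfolding abs_continuous_on_interval_def by simp
  then show thesis using that by (elim exE conjE) simp
qed

text \<open>Values in a metric space have no differences, so the telescoping is done for the real
  function \<open>dist (g a) (g x)\<close>, whose increments are bounded by the triangle
  inequality.\<close>

lemma dist_le_sum_tagged_division:
  fixes g :: "real \<Rightarrow> 'a::metric_space"
  assumes "a \<le> b" "p tagged_division_of {a..b}"
  shows "dist (g a) (g b) \<le> (\<Sum>(x, k)\<in>p. dist (g (Inf k)) (g (Sup k)))"
proof -
  have "dist (g a) (g b) = (\<Sum>(x, k)\<in>p. dist (g a) (g (Sup k)) - dist (g a) (g (Inf k)))"
    using additive_tagged_division_1[OF assms, of "\<lambda>x. dist (g a) (g x)"] by simp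
  also have "\<dots> \<le> (\<Sum>(x, k)\<in>p. dist (g (Inf k)) (g (Sup k)))"
    by (intro sum_mono) (auto simp: algebra_simps dist_triangle)
  finally show ?thesis .
qed

lemma sum_length_division_le_measure:
  fixes D :: "real set set"
  assumes D: "D division_of \<Union>D" and sub: "\<Union>D \<subseteq> S" and S: "S \<in> lmeasurable"
  shows "(\<Sum>k\<in>D. Sup k - Inf k) \<le> measure lebesgue S"
proof -
  have "(\<Sum>k\<in>D. Sup k - Inf k) = (\<Sum>k\<in>D. measure lebesgue k)"
  proof (rule sum.cong)
    fix k assume "k \<in> D"
    then obtain u v where k: "k = {u..v}" "u \<le> v"
      using division_ofD(3,4)[OF D] by (metis atLeastatMost_empty_iff box_real(2))
    then show "Sup k - Inf k = measure lebesgue k" by simp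
  qed simp
  also have "\<dots> = measure lebesgue (\<Union>D)"
    using content_division[OF D] by simp
  also have "\<dots> \<le> measure lebesgue S"
    by (rule measure_mono_fmeasurable[OF sub _ S]) (metis D lmeasurable_division fmeasurableD)
  finally show ?thesis .
qed

text \<open>A Cousin-type argument: the null set of bad points is covered by an open set of small measure, on
  whose fine intervals absolute continuity takes over.\<close>

lemma abs_continuous_dist_le:
  fixes g :: "real \<Rightarrow> 'a::metric_space" and M :: "real \<Rightarrow> real"
  assumes ab: "a \<le> b"
    and ac: "abs_continuous_on_interval a b g"
    and M: "mono_on {a..b} M"
    and N: "negligible N"
    and loc: "\<And>t \<epsilon>. \<lbrakk>t \<in> {a..b} - N; \<epsilon> > 0\<rbrakk> \<Longrightarrow>
       \<exists>\<delta>>0. \<forall>u v. u \<in> {a..b} \<and> v \<in> {a..b} \<and> u \<le> t \<and> t \<le> v \<and> t - u < \<delta> \<and> v - t < \<delta> \<longrightarrow>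
         dist (g u) (g v) \<le> (1 + \<epsilon>) * (M v - M u) + \<epsilon> * (v - u)"
  shows "dist (g a) (g b) \<le> M b - M a"
proof -
  have Mab: "M b - M a \<ge> 0" using M ab by (auto simp: mono_on_def)
  have main: "dist (g a) (g b) \<le> (1 + \<epsilon>) * (M b - M a) + \<epsilon> * (b - a) + \<epsilon>" if "\<epsilon> > 0" for \<epsilon>
  proof -
    obtain \<delta> where \<delta>: "\<delta> > 0" and ac\<delta>0: "\<forall>D. D division_of \<Union>D \<longrightarrow> \<Union>D \<subseteq> {a..b} \<longrightarrow>
      (\<Sum>k\<in>D. Sup k - Inf k) < \<delta> \<longrightarrow> (\<Sum>k\<in>D. dist (g (Inf k)) (g (Sup k))) < \<epsilon>"
      using abs_continuous_on_intervalE[OF ac \<open>\<epsilon> > 0\<close>] by blast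
    note ac\<delta> = ac\<delta>0[rule_format]
    obtain U where U: "open U" "N \<subseteq> U" "(U - N) \<in> lmeasurable" "emeasure lebesgue (U - N) < ennreal \<delta>"
      using sets_lebesgue_outer_open[OF negligible_imp_sets[OF N] \<delta>] by blast
    have "U = (U - N) \<union> N" using U(2) by auto
    then have Um: "U \<in> lmeasurable"
      using fmeasurable.Un[OF U(3) negligible_imp_measurable[OF N]] by simp
    have "measure lebesgue U = measure lebesgue (U - N)"
      by (rule measure_negligible_symdiff)
         (use U N in \<open>auto intro!: fmeasurableD negligible_subset[OF N]\<close>)
    also have "\<dots> < \<delta>"
      using U(3,4) \<delta> by (simp add: emeasure_eq_measure2 ennreal_less_iff)
    finally have U\<delta>: "measure lebesgue U < \<delta>" .
    \<comment> \<open>\<open>R t r\<close> says that \<open>r\<close> is an admissible gauge radius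
      at \<open>t\<close>: a bad point gets a ball inside \<open>U\<close>, a good point of
      \<open>{a..b}\<close> gets the local estimate, and any other point only a positive
      radius.\<close>
    define R where "R t r \<longleftrightarrow> r > 0 \<and> (t \<in> N \<longrightarrow> ball t r \<subseteq> U) \<and>
      (t \<in> {a..b} - N \<longrightarrow> (\<forall>u v. u \<in> {a..b} \<and> v \<in> {a..b} \<and> u \<le> t \<and> t \<le> v \<and> t - u < r \<and> v - t < r \<longrightarrow>
         dist (g u) (g v) \<le> (1 + \<epsilon>) * (M v - M u) + \<epsilon> * (v - u)))" for t r
    have "\<exists>r. R t r" for t
    proof (cases "t \<in> N")
      case True
      then show ?thesis using U(1,2) unfolding R_def by (meson DiffD2 open_contains_ball subsetD)
    next
      case False
      show ?thesis
      proof (cases "t \<in> {a..b}")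
        case True
        then show ?thesis using loc[of t \<epsilon>] False \<open>\<epsilon> > 0\<close> unfolding R_def by (metis DiffI)
      next
        case False' : False
        then show ?thesis using False by (auto simp: R_def intro: exI[of _ 1])
      qed
    qed
    then obtain r where r: "\<And>t. R t (r t)" by metis
    have "gauge (\<lambda>t. ball t (r t))" using r by (auto simp: gauge_def R_def)
    then obtain p where p: "p tagged_division_of {a..b}" and fine: "(\<lambda>t. ball t (r t)) fine p"
      using fine_division_exists_real by blast
    have finp: "finite p" using p by blast
    \<comment> \<open>The value 0 on the empty set makes \<open>d\<close> vanish on every degenerate
      interval, which allows the sum over tagged intervals to be replaced by the sum over the
      intervals themselves.\<close>
    define d where "d k = (if k = {} then 0 else dist (g (Inf k)) (g (Sup k)))" for k :: "real set"
    define p1 where "p1 = {(x, k) \<in> p. x \<in> N}"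
    define p2 where "p2 = {(x, k) \<in> p. x \<notin> N}"
    have p12: "p = p1 \<union> p2" "p1 \<inter> p2 = {}" by (auto simp: p1_def p2_def)
    have elem: "\<exists>u v. k = {u..v} \<and> u \<le> x \<and> x \<le> v \<and> a \<le> u \<and> v \<le> b \<and> x - u < r x \<and> v - x < r x"
      if xk: "(x, k) \<in> p" for x k
    proof -
      obtain u v where k: "k = {u..v}" using tagged_division_ofD(4)[OF p xk] by auto
      have x: "x \<in> k" "k \<subseteq> {a..b}" using tagged_division_ofD(2,3)[OF p that] by auto
      have "k \<subseteq> ball x (r x)" using fine that by (auto simp: fine_def)
      moreover have "u \<in> k" "v \<in> k" using x k by auto
      ultimately have "u \<in> ball x (r x)" "v \<in> ball x (r x)" by auto
      then show ?thesis using x k by (intro exI[of _ u] exI[of _ v]) (auto simp: dist_real_def)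
    qed
    have "(\<Sum>(x, k)\<in>p1. d k) \<le> \<epsilon>"
    proof -
      have tp: "p1 tagged_partial_division_of {a..b}"
        using tagged_partial_division_subset[of p "{a..b}" p1] p
        by (auto simp: tagged_division_of_def p1_def)
      have "(\<Sum>(x, k)\<in>p1. d k) = sum d (snd ` p1)"
        by (rule sum.over_tagged_division_lemma[OF tagged_partial_division_of_Union_self[OF tp]])
          (auto simp: d_def antisym)
      also have "sum d (snd ` p1) = (\<Sum>k\<in>snd ` p1. dist (g (Inf k)) (g (Sup k)))"
        using elem by (intro sum.cong) (force simp: d_def p1_def)+
      also have "\<dots> < \<epsilon>"
      proof (rule ac\<delta>)
        show dv: "snd ` p1 division_of \<Union> (snd ` p1)"
          by (rule partial_division_of_tagged_division[OF tp])
        show "\<Union> (snd ` p1) \<subseteq> {a..b}" using elem by (force simp: p1_def)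
        have "\<Union> (snd ` p1) \<subseteq> U"
        proof (clarsimp)
          fix x k y assume "(x, k) \<in> p1" "y \<in> k"
          then have "y \<in> ball x (r x)" "x \<in> N" using fine by (fastforce simp: p1_def fine_def)+
          then show "y \<in> U" using r[of x] by (auto simp: R_def)
        qed
        then show "(\<Sum>k\<in>snd ` p1. Sup k - Inf k) < \<delta>"
          using sum_length_division_le_measure[OF dv _ Um] U\<delta> by linarith
      qed
      finally show ?thesis by simp
    qed
    moreover have "(\<Sum>(x, k)\<in>p2. d k) \<le> (1 + \<epsilon>) * (M b - M a) + \<epsilon> * (b - a)"
    proof -
      have nn: "M (Sup k) - M (Inf k) \<ge> 0" "Sup k - Inf k \<ge> 0" if "(x, k) \<in> p" for x k
        using elem[OF that] M by (auto intro: mono_onD[OF M])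
      have "(\<Sum>(x, k)\<in>p2. d k) \<le>
        (\<Sum>(x, k)\<in>p2. (1 + \<epsilon>) * (M (Sup k) - M (Inf k)) + \<epsilon> * (Sup k - Inf k))"
      proof (rule sum_mono, clarify)
        fix x k assume xk: "(x, k) \<in> p2"
        then have "(x, k) \<in> p" "x \<notin> N" by (auto simp: p2_def)
        then obtain u v where k: "k = {u..v}" "u \<le> x" "x \<le> v" "a \<le> u" "v \<le> b" "x - u < r x" "v - x < r x"
          using elem by blast
        then show "d k \<le> (1 + \<epsilon>) * (M (Sup k) - M (Inf k)) + \<epsilon> * (Sup k - Inf k)"
          using r[of x] \<open>x \<notin> N\<close> by (auto simp: R_def d_def)
      qed
      also have "\<dots> \<le> (\<Sum>(x, k)\<in>p. (1 + \<epsilon>) * (M (Sup k) - M (Inf k)) + \<epsilon> * (Sup k - Inf k))"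
        by (rule sum_mono2[OF finp]) (use nn \<open>\<epsilon> > 0\<close> in \<open>auto simp: p2_def intro!: add_nonneg_nonneg mult_nonneg_nonneg\<close>)
      also have "\<dots> = (1 + \<epsilon>) * (\<Sum>(x, k)\<in>p. M (Sup k) - M (Inf k)) + \<epsilon> * (\<Sum>(x, k)\<in>p. Sup k - Inf k)"
        by (simp add: sum.distrib sum_distrib_left case_prod_unfold)
      also have "(\<Sum>(x, k)\<in>p. M (Sup k) - M (Inf k)) = M b - M a"
        by (rule additive_tagged_division_1[OF ab p])
      also have "(\<Sum>(x, k)\<in>p. Sup k - Inf k) = b - a"
        using additive_tagged_division_1[OF ab p, of "\<lambda>x. x"] by simp
      finally show ?thesis .
    qed
    moreover have "dist (g a) (g b) \<le> (\<Sum>(x, k)\<in>p. d k)"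
    proof -
      have "(\<Sum>(x, k)\<in>p. d k) = (\<Sum>(x, k)\<in>p. dist (g (Inf k)) (g (Sup k)))"
        using elem by (intro sum.cong) (force simp: d_def)+
      then show ?thesis using dist_le_sum_tagged_division[OF ab p, of g] by simp
    qed
    moreover have "(\<Sum>(x, k)\<in>p. d k) = (\<Sum>(x, k)\<in>p1. d k) + (\<Sum>(x, k)\<in>p2. d k)"
      unfolding p12(1) by (rule sum.union_disjoint) (use finp p12 in \<open>auto simp: finite_subset\<close>)
    ultimately show ?thesis by linarith
  qed
  show ?thesis
  proof (rule field_le_epsilon)
    fix e :: real assume "e > 0"
    \<comment> \<open>\<open>K\<close> collects the coefficients of \<epsilon> in
      \<open>main\<close>, so that \<epsilon> equal to \<open>e / K\<close> leaves exactly the error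
      \<open>e\<close>.\<close>
    define K where "K = (M b - M a) + (b - a) + 1"
    have K: "K > 0" using Mab ab by (simp add: K_def)
    define d where "d = e / K"
    have d: "d > 0" "d * K = e" using \<open>e > 0\<close> K by (auto simp: d_def)
    have "dist (g a) (g b) \<le> (M b - M a) + d * K"
      using main[OF d(1)] by (simp add: K_def algebra_simps)
    then show "dist (g a) (g b) \<le> M b - M a + e" using d by simp
  qed
qed

lemma abs_continuous_subinterval:
  assumes "abs_continuous_on_interval a b g" "a \<le> c" "d \<le> b"
  shows "abs_continuous_on_interval c d g"
proof -
  have "{c..d} \<subseteq> {a..b}" using assms by auto
  then show ?thesis using assms(1) unfolding abs_continuous_on_interval_def
    by (meson order_trans)
qed

lemma division_nonempty_interval:
  fixes D :: "real set set"
  assumes "D division_of S" "k \<in> D"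
  obtains u v where "k = {u..v}" "u \<le> v" "Inf k = u" "Sup k = v"
  using division_ofD(3,4)[OF assms] by (metis atLeastatMost_empty_iff box_real(2) cInf_atLeastAtMost cSup_atLeastAtMost)

text \<open>Increments are compared instead of functions being composed, so this covers components
  of a path, their inner products, and angles that are Lipschitz only along the path.\<close>

lemma abs_continuous_compose_lipschitz:
  fixes h :: "'a::metric_space \<Rightarrow> 'b::metric_space"
  assumes ac: "abs_continuous_on_interval a b g"
    and h: "\<And>x y. \<lbrakk>x \<in> {a..b}; y \<in> {a..b}\<rbrakk> \<Longrightarrow> dist (h' x) (h' y) \<le> C * dist (g x) (g y)"
  shows "abs_continuous_on_interval a b h'"
  unfolding abs_continuous_on_interval_def
proof (intro allI impI)
  fix \<epsilon> :: real assume "\<epsilon> > 0"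
  define C' where "C' = \<bar>C\<bar> + 1"
  have C': "C' > 0" "C \<le> C'" by (auto simp: C'_def)
  obtain \<delta> where \<delta>: "\<delta> > 0" and ac\<delta>0: "\<forall>D. D division_of \<Union>D \<longrightarrow> \<Union>D \<subseteq> {a..b} \<longrightarrow>
      (\<Sum>k\<in>D. Sup k - Inf k) < \<delta> \<longrightarrow> (\<Sum>k\<in>D. dist (g (Inf k)) (g (Sup k))) < \<epsilon> / C'"
    using abs_continuous_on_intervalE[OF ac divide_pos_pos[OF \<open>\<epsilon> > 0\<close> C'(1)]] by blast
    note ac\<delta> = ac\<delta>0[rule_format]
  show "\<exists>\<delta>>0. \<forall>D. D division_of \<Union>D \<and> \<Union>D \<subseteq> {a..b} \<and> (\<Sum>k\<in>D. Sup k - Inf k) < \<delta> \<longrightarrow>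
          (\<Sum>k\<in>D. dist (h' (Inf k)) (h' (Sup k))) < \<epsilon>"
  proof (intro exI[of _ \<delta>] conjI \<delta> allI impI, elim conjE)
    fix D assume D: "D division_of \<Union>D" "\<Union>D \<subseteq> {a..b}" "(\<Sum>k\<in>D. Sup k - Inf k) < \<delta>"
    have "(\<Sum>k\<in>D. dist (h' (Inf k)) (h' (Sup k))) \<le> (\<Sum>k\<in>D. C' * dist (g (Inf k)) (g (Sup k)))"
    proof (rule sum_mono)
      fix k assume k: "k \<in> D"
      obtain u v where uv: "k = {u..v}" "u \<le> v" "Inf k = u" "Sup k = v"
        using division_nonempty_interval[OF D(1) k] .
      have "{u..v} \<subseteq> {a..b}" using D(2) k uv(1) by blast
      then have "u \<in> {a..b}" "v \<in> {a..b}" using uv(2) by auto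
      then show "dist (h' (Inf k)) (h' (Sup k)) \<le> C' * dist (g (Inf k)) (g (Sup k))"
        unfolding uv(3,4) using h C' by (meson mult_right_mono order_trans zero_le_dist)
    qed
    also have "\<dots> = C' * (\<Sum>k\<in>D. dist (g (Inf k)) (g (Sup k)))" by (simp add: sum_distrib_left)
    also have "\<dots> < \<epsilon>" using ac\<delta>[OF D] C' by (simp add: field_simps)
    finally show "(\<Sum>k\<in>D. dist (h' (Inf k)) (h' (Sup k))) < \<epsilon>" .
  qed
qed

lemma abs_continuous_id: "abs_continuous_on_interval a b (\<lambda>t::real. t)"
  unfolding abs_continuous_on_interval_def
proof (intro allI impI)
  fix \<epsilon> :: real assume "\<epsilon> > 0"
  show "\<exists>\<delta>>0. \<forall>D. D division_of \<Union>D \<and> \<Union>D \<subseteq> {a..b} \<and> (\<Sum>k\<in>D. Sup k - Inf k) < \<delta> \<longrightarrow>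
          (\<Sum>k\<in>D. dist (Inf k) (Sup k)) < \<epsilon>"
  proof (intro exI[of _ \<epsilon>] conjI \<open>\<epsilon> > 0\<close> allI impI, elim conjE)
    fix D :: "real set set"
    assume D: "D division_of \<Union>D" "(\<Sum>k\<in>D. Sup k - Inf k) < \<epsilon>"
    have "(\<Sum>k\<in>D. dist (Inf k) (Sup k)) = (\<Sum>k\<in>D. Sup k - Inf k)"
      by (rule sum.cong, simp, erule division_nonempty_interval[OF D(1)]) (simp add: dist_real_def)
    then show "(\<Sum>k\<in>D. dist (Inf k) (Sup k)) < \<epsilon>" using D(2) by simp
  qed
qed

lemma lipschitz_imp_abs_continuous:
  fixes g :: "real \<Rightarrow> 'a::metric_space"
  assumes "\<And>x y. \<lbrakk>x \<in> {a..b}; y \<in> {a..b}\<rbrakk> \<Longrightarrow> dist (g x) (g y) \<le> C * \<bar>x - y\<bar>"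
  shows "abs_continuous_on_interval a b g"
  by (rule abs_continuous_compose_lipschitz[OF abs_continuous_id, where C = C])
     (use assms in \<open>auto simp: dist_real_def\<close>)

lemma dist_le_curve_length:
  assumes "a \<le> b"
  shows "ennreal (dist (g a) (g b)) \<le> curve_length a b g"
proof -
  have "{{a..b}} division_of {a..b}" using assms by (metis division_of_self atLeastatMost_empty_iff2 box_real(2) not_less)
  then show ?thesis unfolding curve_length_def
    by (intro SUP_upper2[of "{{a..b}}"]) (use assms in auto)
qed

text \<open>Any division of \<open>{a..b}\<close> is prolonged by the interval
  \<open>{b..c}\<close>. Comparison with a single chord suffices to show that arc length dominates
  front increments.\<close>

lemma curve_length_extend:
  fixes g :: "real \<Rightarrow> 'a::metric_space"
  assumes "a \<le> b" "b \<le> c"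
  shows "curve_length a b g + ennreal (dist (g b) (g c)) \<le> curve_length a c g"
proof (cases "b = c")
  case True then show ?thesis by simp
next
  case False
  then have bc: "b < c" using assms by simp
  have ne: "{D. D division_of {a..b}} \<noteq> {}" using elementary_interval[of a b] by auto
  have "curve_length a b g + ennreal (dist (g b) (g c)) =
     (SUP D\<in>{D. D division_of {a..b}}. (\<Sum>k\<in>D. ennreal (dist (g (Inf k)) (g (Sup k)))) + ennreal (dist (g b) (g c)))"
    unfolding curve_length_def using ne by (subst ennreal_SUP_add_left) auto
  also have "\<dots> \<le> curve_length a c g"
  proof (rule SUP_least, clarify)
    fix D assume D: "D division_of {a..b}"
    have "{{b..c}} division_of {b..c}" using bc by (metis division_of_self atLeastatMost_empty_iff2 box_real(2) not_less less_imp_le)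
    from division_disjoint_union[OF D this] have U: "(D \<union> {{b..c}}) division_of {a..c}"
      using assms by (simp add: ivl_disj_un interior_atLeastAtMost_real)
    have "{b..c} \<notin> D"
    proof
      assume "{b..c} \<in> D"
      then have "{b..c} \<subseteq> {a..b}" using D by (auto dest: division_ofD(2))
      then show False using bc by auto
    qed
    then have "(\<Sum>k\<in>D. ennreal (dist (g (Inf k)) (g (Sup k)))) + ennreal (dist (g b) (g c)) =
       (\<Sum>k\<in>D \<union> {{b..c}}. ennreal (dist (g (Inf k)) (g (Sup k))))"
      using division_ofD(1)[OF D] bc by (simp add: add.commute del: sum_ennreal)
    also have "\<dots> \<le> curve_length a c g" unfolding curve_length_def
      by (rule SUP_upper) (use U in simp)
    finally show "(\<Sum>k\<in>D. ennreal (dist (g (Inf k)) (g (Sup k)))) + ennreal (dist (g b) (g c)) \<le> curve_length a c g" .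
  qed
  finally show ?thesis .
qed

text \<open>Two intervals of \<open>D\<close> may have the same trace on \<open>{x..y}\<close>.
  Since their interiors are disjoint, a common trace is a single point and contributes nothing, so
  the sum reindexes to one over a division of \<open>{x..y}\<close>.\<close>

lemma sum_clipped_division_le_curve_length:
  fixes g :: "real \<Rightarrow> 'a::metric_space"
  assumes D: "D division_of {a..c}" and sub: "{x..y} \<subseteq> {a..c}"
  shows "(\<Sum>k\<in>{k\<in>D. {x..y} \<inter> k \<noteq> {}}. ennreal (dist (g (Inf ({x..y} \<inter> k))) (g (Sup ({x..y} \<inter> k)))))
     \<le> curve_length x y g"
proof -
  let ?D = "{k\<in>D. {x..y} \<inter> k \<noteq> {}}"
  let ?h = "\<lambda>k. ennreal (dist (g (Inf k)) (g (Sup k)))"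
  have D': "{{x..y} \<inter> k | k. k \<in> D \<and> {x..y} \<inter> k \<noteq> {}} division_of {x..y}"
    using division_inter_1[of D "{a..c}" x y] D sub by simp
  have eq: "{{x..y} \<inter> k | k. k \<in> D \<and> {x..y} \<inter> k \<noteq> {}} = (\<lambda>k. {x..y} \<inter> k) ` ?D" by auto
  have "(\<Sum>k\<in>?D. ?h ({x..y} \<inter> k)) = sum ?h ((\<lambda>k. {x..y} \<inter> k) ` ?D)"
  proof (rule sum.reindex_nontrivial[symmetric, unfolded o_def])
    show "finite ?D" using division_ofD(1)[OF D] by simp
    fix k k' assume k: "k \<in> ?D" and k': "k' \<in> ?D" "k \<noteq> k'" and same: "{x..y} \<inter> k = {x..y} \<inter> k'"
    obtain u v where uv: "k = {u..v}" using division_nonempty_interval[OF D] k by blast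
    obtain u' v' where uv': "k' = {u'..v'}" using division_nonempty_interval[OF D] k' by blast
    have "interior k \<inter> interior k' = {}" using division_ofD(5)[OF D] k k' by auto
    then have dis: "{u<..<v} \<inter> {u'<..<v'} = {}" using uv uv' by (simp add: interior_atLeastAtMost_real)
    have e: "{x..y} \<inter> k = {max x u..min y v}" by (auto simp: uv)
    have ne: "max x u \<le> min y v" using k e by auto
    have "max x u \<in> {x..y} \<inter> k'" "min y v \<in> {x..y} \<inter> k'" using ne e same by auto
    then have "(max x u + min y v) / 2 \<in> {u<..<v} \<inter> {u'<..<v'}" if "max x u < min y v"
    proof -
      define m where "m = (max x u + min y v) / 2"
      have m: "max x u < m" "m < min y v" using that by (auto simp: m_def)
      have "u' \<le> max x u" "min y v \<le> v'"
        using \<open>max x u \<in> {x..y} \<inter> k'\<close> \<open>min y v \<in> {x..y} \<inter> k'\<close> uv' by auto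
      then have "m \<in> {u<..<v} \<inter> {u'<..<v'}" using m by auto
      then show ?thesis by (simp add: m_def)
    qed
    then have "\<not> max x u < min y v" using dis by blast
    then have "max x u = min y v" using ne by linarith
    then show "?h ({x..y} \<inter> k) = 0" unfolding e by simp
  qed
  also have "\<dots> \<le> curve_length x y g" unfolding curve_length_def eq[symmetric]
    by (rule SUP_upper) (use D' in simp)
  finally show ?thesis .
qed

text \<open>Every interval of a division lies on one side of \<open>b\<close> or is cut at
  \<open>b\<close>, where the triangle inequality applies. This half of additivity gives the
  continuity of arc length.\<close>

lemma curve_length_le_add:
  fixes g :: "real \<Rightarrow> 'a::metric_space"
  assumes "a \<le> b" "b \<le> c"
  shows "curve_length a c g \<le> curve_length a b g + curve_length b c g"
  unfolding curve_length_def[of a c]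
proof (rule SUP_least, clarify)
  fix D assume D: "D division_of {a..c}"
  let ?h = "\<lambda>k. ennreal (dist (g (Inf k)) (g (Sup k)))"
  let ?p = "\<lambda>x y k. if {x..y} \<inter> k \<noteq> {} then ?h ({x..y} \<inter> k) else 0"
  have fin: "finite D" using D by blast
  have "sum ?h D \<le> (\<Sum>k\<in>D. ?p a b k + ?p b c k)"
  proof (rule sum_mono)
    fix k assume k: "k \<in> D"
    obtain u v where uv: "k = {u..v}" "u \<le> v" "Inf k = u" "Sup k = v"
      using division_nonempty_interval[OF D k] .
    have "{u..v} \<subseteq> {a..c}" using division_ofD(2)[OF D k] uv by auto
    then have s: "a \<le> u" "v \<le> c" using uv by auto
    consider "v < b" | "b < u" | "u \<le> b" "b \<le> v" by linarith
    then show "?h k \<le> ?p a b k + ?p b c k"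
    proof cases
      case 1
      then have "{a..b} \<inter> k = k" "k \<noteq> {}" using s uv by auto
      then show ?thesis by simp
    next
      case 2
      then have "{b..c} \<inter> k = k" "k \<noteq> {}" using s uv by auto
      then show ?thesis by simp
    next
      case 3
      then have e: "{a..b} \<inter> k = {u..b}" "{b..c} \<inter> k = {b..v}" using s uv by auto
      then show ?thesis using 3 uv by (simp add: ennreal_plus[symmetric] dist_triangle del: ennreal_plus)
    qed
  qed
  also have "\<dots> = (\<Sum>k\<in>{k\<in>D. {a..b} \<inter> k \<noteq> {}}. ?h ({a..b} \<inter> k)) + (\<Sum>k\<in>{k\<in>D. {b..c} \<inter> k \<noteq> {}}. ?h ({b..c} \<inter> k))"
    using fin by (simp add: sum.distrib sum.If_cases Int_def)
  also have "\<dots> \<le> curve_length a b g + curve_length b c g"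
    using assms by (intro add_mono sum_clipped_division_le_curve_length[OF D]) auto
  finally show "sum ?h D \<le> curve_length a b g + curve_length b c g" .
qed

lemma abs_continuous_curve_length_small:
  fixes g :: "real \<Rightarrow> 'a::metric_space"
  assumes ac: "abs_continuous_on_interval a b g" and "\<epsilon> > 0"
  obtains \<delta> where "\<delta> > 0" "\<And>u v. \<lbrakk>a \<le> u; u \<le> v; v \<le> b; v - u < \<delta>\<rbrakk> \<Longrightarrow> curve_length u v g \<le> ennreal \<epsilon>"
proof -
  obtain \<delta> where \<delta>: "\<delta> > 0" and ac\<delta>0: "\<forall>D. D division_of \<Union>D \<longrightarrow> \<Union>D \<subseteq> {a..b} \<longrightarrow>
      (\<Sum>k\<in>D. Sup k - Inf k) < \<delta> \<longrightarrow> (\<Sum>k\<in>D. dist (g (Inf k)) (g (Sup k))) < \<epsilon>"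
    using abs_continuous_on_intervalE[OF ac \<open>\<epsilon> > 0\<close>] by blast
    note ac\<delta> = ac\<delta>0[rule_format]
  show thesis
  proof (rule that[OF \<delta>])
    fix u v assume uv: "a \<le> u" "u \<le> v" "v \<le> b" "v - u < \<delta>"
    show "curve_length u v g \<le> ennreal \<epsilon>" unfolding curve_length_def
    proof (rule SUP_least, clarify)
      fix D assume D: "D division_of {u..v}"
      then have U: "\<Union>D = {u..v}" by blast
      have "(\<Sum>k\<in>D. dist (g (Inf k)) (g (Sup k))) < \<epsilon>"
      proof (rule ac\<delta>)
        show dv: "D division_of \<Union>D" using D U by simp
        show "\<Union>D \<subseteq> {a..b}" using U uv by auto
        show "(\<Sum>k\<in>D. Sup k - Inf k) < \<delta>"
          using sum_length_division_le_measure[OF dv, of "{u..v}"] uv U by auto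
      qed
      then show "(\<Sum>k\<in>D. ennreal (dist (g (Inf k)) (g (Sup k)))) \<le> ennreal \<epsilon>"
        by (subst sum_ennreal) (auto intro: ennreal_leI)
    qed
  qed
qed

lemma abs_continuous_curve_length_finite:
  fixes g :: "real \<Rightarrow> 'a::metric_space"
  assumes ac: "abs_continuous_on_interval a b g" and ab: "a \<le> b"
  shows "curve_length a b g < \<infinity>"
proof -
  obtain \<delta> where \<delta>: "\<delta> > 0" "\<And>u v. \<lbrakk>a \<le> u; u \<le> v; v \<le> b; v - u < \<delta>\<rbrakk> \<Longrightarrow> curve_length u v g \<le> ennreal 1"
    using abs_continuous_curve_length_small[OF ac, of 1] by auto
  \<comment> \<open>Steps of length \<open>\<delta> / 2\<close> stay below \<delta>, so each adds at
    most 1 to the length; \<open>min b\<close> stops at the end point after finitely many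
    steps.\<close>
  have step: "curve_length a (min b (a + real n * (\<delta> / 2))) g < \<infinity>" for n
  proof (induction n)
    case 0
    have "curve_length a a g \<le> ennreal 1" using \<delta> ab by (intro \<delta>(2)) auto
    then show ?case using ab by (auto simp: min_absorb2 intro: le_less_trans)
  next
    case (Suc n)
    let ?x = "min b (a + real n * (\<delta> / 2))" and ?y = "min b (a + real (Suc n) * (\<delta> / 2))"
    have xy: "a \<le> ?x" "?x \<le> ?y" "?y \<le> b" "?y - ?x < \<delta>"
      using ab \<delta>(1) mult_nonneg_nonneg[of "real n" "\<delta> / 2"] by (auto simp: min_def algebra_simps add_divide_distrib)
    have "curve_length a ?y g \<le> curve_length a ?x g + curve_length ?x ?y g"
      by (rule curve_length_le_add[OF xy(1,2)])
    also have "\<dots> \<le> curve_length a ?x g + ennreal 1"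
      by (intro add_left_mono \<delta>(2) xy)
    also have "\<dots> < \<infinity>" using Suc.IH by (auto simp: ennreal_add_less_top)
    finally show ?case .
  qed
  obtain n where "real n * (\<delta> / 2) \<ge> b - a"
    using reals_Archimedean3[of "\<delta> / 2"] \<delta>(1) less_imp_le by (metis half_gt_zero_iff)
  then have "min b (a + real n * (\<delta> / 2)) = b" by (simp add: min_def)
  then show ?thesis using step[of n] by simp
qed

section \<open>Bicycle paths\<close>

text \<open>The straddle form of differentiability: it speaks of intervals that contain
  \<open>t\<close>, as intervals tagged at \<open>t\<close> do. Splitting the increment at
  \<open>t\<close> adds the two one-sided errors.\<close>

lemma vector_derivative_straddle:
  fixes g :: "real \<Rightarrow> 'a::real_normed_vector"
  assumes "(g has_vector_derivative D) (at t within S)" "\<epsilon> > 0"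
  obtains \<delta> where "\<delta> > 0"
    "\<And>u v. \<lbrakk>u \<in> S; v \<in> S; u \<le> t; t \<le> v; t - u < \<delta>; v - t < \<delta>\<rbrakk> \<Longrightarrow>
       norm (g v - g u - (v - u) *\<^sub>R D) \<le> \<epsilon> * (v - u)"
proof -
  obtain \<delta> where \<delta>: "\<delta> > 0"
    and d: "\<And>y. \<lbrakk>y \<in> S; \<bar>y - t\<bar> < \<delta>\<rbrakk> \<Longrightarrow> norm (g y - g t - (y - t) *\<^sub>R D) \<le> \<epsilon> * \<bar>y - t\<bar>"
    using assms unfolding has_vector_derivative_def has_derivative_within_alt by (auto simp: real_norm_def)
  show thesis
  proof (rule that[OF \<delta>])
    fix u v assume uv: "u \<in> S" "v \<in> S" "u \<le> t" "t \<le> v" "t - u < \<delta>" "v - t < \<delta>"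
    have "g v - g u - (v - u) *\<^sub>R D = (g v - g t - (v - t) *\<^sub>R D) - (g u - g t - (u - t) *\<^sub>R D)"
      by (simp add: algebra_simps)
    then have "norm (g v - g u - (v - u) *\<^sub>R D) \<le> norm (g v - g t - (v - t) *\<^sub>R D) + norm (g u - g t - (u - t) *\<^sub>R D)"
      using norm_triangle_ineq4 by metis
    also have "\<dots> \<le> \<epsilon> * \<bar>v - t\<bar> + \<epsilon> * \<bar>u - t\<bar>" using uv by (intro add_mono d) auto
    also have "\<dots> = \<epsilon> * (v - u)" using uv by (simp add: algebra_simps)
    finally show "norm (g v - g u - (v - u) *\<^sub>R D) \<le> \<epsilon> * (v - u)" .
  qed
qed

text \<open>\<open>M\<close> stands for the front arc length. All estimates on the back wheel and
  the frame are expressed by increments of \<open>M\<close>, so they carry over directly to the arc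
  length parameter.\<close>

locale bicycle_track =
  fixes l a b :: real and \<gamma> :: "real \<Rightarrow> complex \<times> complex" and M :: "real \<Rightarrow> real"
  assumes l_pos: "l > 0" and path: "bicycle_path l a b \<gamma>"
    and M_mono: "mono_on {a..b} M"
    and front_le: "\<And>u v. \<lbrakk>a \<le> u; u \<le> v; v \<le> b\<rbrakk> \<Longrightarrow> norm (snd (\<gamma> v) - snd (\<gamma> u)) \<le> M v - M u"
begin

abbreviation "back t \<equiv> fst (\<gamma> t)"
abbreviation "front t \<equiv> snd (\<gamma> t)"
definition frame where "frame t = front t - back t"

lemma a_le_b: "a \<le> b" using path by (simp add: bicycle_path_def)

lemma norm_frame: "t \<in> {a..b} \<Longrightarrow> norm (frame t) = l"
  using path by (force simp: bicycle_path_def bicycle_space_def frame_def split: prod.splits)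

lemma abs_continuous_path: "abs_continuous_on_interval a b \<gamma>"
  using path by (simp add: bicycle_path_def)

lemma abs_continuous_imp_continuous_on:
  fixes g :: "real \<Rightarrow> 'a::metric_space"
  assumes "abs_continuous_on_interval a b g"
  shows "continuous_on {a..b} g"
proof (rule uniformly_continuous_imp_continuous, unfold uniformly_continuous_on_def, intro allI impI)
  fix e :: real assume "e > 0"
  obtain \<delta> where \<delta>: "\<delta> > 0" "\<And>u v. \<lbrakk>a \<le> u; u \<le> v; v \<le> b; v - u < \<delta>\<rbrakk> \<Longrightarrow> curve_length u v g \<le> ennreal (e/2)"
    using abs_continuous_curve_length_small[OF assms, of "e/2"] \<open>e > 0\<close> by auto
  have *: "dist (g u) (g v) < e" if "a \<le> u" "u \<le> v" "v \<le> b" "v - u < \<delta>" for u v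
    using order_trans[OF dist_le_curve_length \<delta>(2)] that \<open>e > 0\<close> by fastforce
  show "\<exists>d>0. \<forall>x\<in>{a..b}. \<forall>x'\<in>{a..b}. dist x' x < d \<longrightarrow> dist (g x') (g x) < e"
  proof (intro exI[of _ \<delta>] conjI \<delta> ballI impI)
    fix x x' assume "x \<in> {a..b}" "x' \<in> {a..b}" "dist x' x < \<delta>"
    then show "dist (g x') (g x) < e"
      using *[of x x'] *[of x' x] by (cases "x \<le> x'") (auto simp: dist_real_def dist_commute)
  qed
qed

lemma continuous_on_frame: "continuous_on {a..b} frame"
  unfolding frame_def
  by (intro continuous_intros abs_continuous_imp_continuous_on abs_continuous_path)

lemma noskid_ae:
  obtains N where "negligible N"
    "\<And>t. t \<in> {a..b} - N \<Longrightarrow> \<exists>c::real. (back has_vector_derivative c *\<^sub>R frame t) (at t within {a..b})"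
proof -
  have "AE t in lebesgue_on {a..b}. \<exists>c::real. (back has_vector_derivative c *\<^sub>R frame t) (at t within {a..b})"
    using path by (simp add: bicycle_path_def frame_def)
  then obtain N where "N \<in> null_sets (lebesgue_on {a..b})"
     "\<And>t. t \<in> {a..b} - N \<Longrightarrow> \<exists>c::real. (back has_vector_derivative c *\<^sub>R frame t) (at t within {a..b})"
    by (elim AE_E3) (auto simp: space_restrict_space)
  moreover from this(1) have "negligible N"
    by (simp add: negligible_iff_null_sets null_sets_restrict_space)
  ultimately show thesis using that by blast
qed

text \<open>The frame has constant length, so its increments are almost orthogonal to it; hence the part of a
  front increment along the frame is almost the back increment.\<close>

lemma back_increment_le:
  assumes t: "t \<in> {a..b}" and D: "(back has_vector_derivative c *\<^sub>R frame t) (at t within {a..b})" and "\<epsilon> > 0"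
  shows "\<exists>\<delta>>0. \<forall>u v. u \<in> {a..b} \<and> v \<in> {a..b} \<and> u \<le> t \<and> t \<le> v \<and> t - u < \<delta> \<and> v - t < \<delta> \<longrightarrow>
         norm (back v - back u) \<le> (1 + \<epsilon>) * norm (front v - front u) + \<epsilon> * (v - u)"
proof -
  \<comment> \<open>With this value \<open>(1 + s) / (1 - s) = 1 + \<epsilon>\<close> and
    \<open>2 * s / (1 - s) = \<epsilon>\<close>, which turns the inequality solved for
    \<open>X\<close> below into the stated one.\<close>
  define s where "s = \<epsilon> / (2 + \<epsilon>)"
  have s: "s > 0" "s < 1" using \<open>\<epsilon> > 0\<close> by (auto simp: s_def field_simps)
  obtain \<delta>1 where \<delta>1: "\<delta>1 > 0" "\<And>u v. \<lbrakk>u \<in> {a..b}; v \<in> {a..b}; u \<le> t; t \<le> v; t - u < \<delta>1; v - t < \<delta>1\<rbrakk> \<Longrightarrow>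
       norm (back v - back u - (v - u) *\<^sub>R (c *\<^sub>R frame t)) \<le> s * (v - u)"
    using vector_derivative_straddle[OF D \<open>s > 0\<close>] by blast
  obtain \<delta>2 where \<delta>2: "\<delta>2 > 0" "\<And>y. \<lbrakk>y \<in> {a..b}; \<bar>y - t\<bar> < \<delta>2\<rbrakk> \<Longrightarrow> norm (frame y - frame t) < s * l"
      using continuous_on_frame[unfolded continuous_on_iff dist_norm real_norm_def, rule_format, OF t mult_pos_pos[OF s(1) l_pos]] by blast
  show ?thesis
  proof (intro exI[of _ "min \<delta>1 \<delta>2"] conjI allI impI)
    show "min \<delta>1 \<delta>2 > 0" using \<delta>1 \<delta>2 by simp
    fix u v assume A: "u \<in> {a..b} \<and> v \<in> {a..b} \<and> u \<le> t \<and> t \<le> v \<and> t - u < min \<delta>1 \<delta>2 \<and> v - t < min \<delta>1 \<delta>2"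
    define X where "X = norm (back v - back u)"
    define Y where "Y = norm (front v - front u)"
    define R where "R = back v - back u - (v - u) *\<^sub>R (c *\<^sub>R frame t)"
    have R: "norm R \<le> s * (v - u)" unfolding R_def using A by (intro \<delta>1) auto
    have nt: "norm (frame t) = l" using norm_frame t by simp
    \<comment> \<open>Vectors of equal length have a difference orthogonal to their sum. Replacing
      the midpoint of the two frames by \<open>frame t\<close> costs only the factor
      \<open>s * l\<close>.\<close>
    have orth: "(frame v - frame u) \<bullet> (frame v + frame u) = 0"
      using norm_frame[of u] norm_frame[of v] A
      by (simp add: inner_diff_left inner_add_right inner_commute[of "frame u" "frame v"] dot_square_norm)
    have mid: "norm (frame t - (1/2) *\<^sub>R (frame v + frame u)) \<le> s * l"
    proof -
      have "frame t - (1/2) *\<^sub>R (frame v + frame u) = (1/2) *\<^sub>R (frame t - frame v) + (1/2) *\<^sub>R (frame t - frame u)"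
        by (simp add: scaleR_conv_of_real field_simps)
      also have "norm \<dots> \<le> (1/2) * norm (frame v - frame t) + (1/2) * norm (frame u - frame t)"
        by (rule norm_triangle_le) (simp add: norm_minus_commute)
      also have "\<dots> \<le> s * l" using \<delta>2(2)[of u] \<delta>2(2)[of v] A by auto
      finally show ?thesis .
    qed
    have "\<bar>(frame v - frame u) \<bullet> frame t\<bar> = \<bar>(frame v - frame u) \<bullet> (frame t - (1/2) *\<^sub>R (frame v + frame u))\<bar>"
      using orth by (simp add: inner_diff_right)
    also have "\<dots> \<le> norm (frame v - frame u) * (s * l)"
      using Cauchy_Schwarz_ineq2 mid by (meson mult_left_mono norm_ge_zero order_trans)
    also have "\<dots> \<le> (X + Y) * (s * l)"
    proof (rule mult_right_mono)
      have "frame v - frame u = (front v - front u) - (back v - back u)" by (simp add: frame_def)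
      then show "norm (frame v - frame u) \<le> X + Y" unfolding X_def Y_def
        using norm_triangle_ineq4[of "front v - front u" "back v - back u"] by simp
    qed (use s l_pos in simp)
    finally have 1: "\<bar>(frame v - frame u) \<bullet> frame t\<bar> \<le> (X + Y) * (s * l)" .
    have 2: "\<bar>(front v - front u) \<bullet> frame t\<bar> \<le> Y * l"
      using Cauchy_Schwarz_ineq2[of "front v - front u" "frame t"] nt by (simp add: Y_def)
    have "(back v - back u) \<bullet> frame t = (front v - front u) \<bullet> frame t - (frame v - frame u) \<bullet> frame t"
      by (simp add: frame_def inner_diff_left)
    with 1 2 have 3: "\<bar>(back v - back u) \<bullet> frame t\<bar> \<le> Y * l + (X + Y) * (s * l)" by linarith
    have bR: "back v - back u = ((v - u) * c) *\<^sub>R frame t + R" by (simp add: R_def)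
    have "l * X \<le> l * (\<bar>(v - u) * c\<bar> * l + norm R)"
      unfolding X_def bR using l_pos nt by (intro mult_left_mono norm_triangle_le) auto
    also have "\<dots> = \<bar>((v - u) * c) * (frame t \<bullet> frame t)\<bar> + l * norm R"
      using l_pos nt by (simp add: abs_mult dot_square_norm power2_eq_square distrib_left mult.assoc mult.left_commute)
    also have "((v - u) * c) * (frame t \<bullet> frame t) = (back v - back u) \<bullet> frame t - R \<bullet> frame t"
      using arg_cong[OF bR, of "\<lambda>x. x \<bullet> frame t"] by (simp only: inner_add_left inner_scaleR_left)
    also have "\<bar>\<dots>\<bar> + l * norm R \<le> (Y * l + (X + Y) * (s * l)) + norm R * l + l * norm R"
      by (intro add_mono order_trans[OF abs_triangle_ineq4] 3 Cauchy_Schwarz_ineq2[of R "frame t", unfolded nt] order_refl)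
    finally have "l * X \<le> l * (Y + (X + Y) * s + 2 * norm R)" by (simp add: algebra_simps)
    then have "X \<le> Y + (X + Y) * s + 2 * norm R" using l_pos by simp
    then have "X * (1 - s) \<le> Y * (1 + s) + 2 * (s * (v - u))" using R by (simp add: algebra_simps)
    moreover define k where "k = 2 / (2 + \<epsilon>)"
    have k: "k > 0" "1 - s = k" "1 + s = k * (1 + \<epsilon>)" "2 * s = k * \<epsilon>"
      using \<open>\<epsilon> > 0\<close> by (auto simp: k_def s_def field_simps)
    have "2 * (s * (v - u)) = k * (\<epsilon> * (v - u))" using k(4) by (metis mult.assoc)
    ultimately have "k * X \<le> k * (Y * (1 + \<epsilon>) + \<epsilon> * (v - u))"
      unfolding k(2,3) by (simp add: distrib_left mult.commute mult.left_commute)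
    then have "X \<le> Y * (1 + \<epsilon>) + \<epsilon> * (v - u)" using k(1) by (rule mult_left_le_imp_le)
    then show "norm (back v - back u) \<le> (1 + \<epsilon>) * norm (front v - front u) + \<epsilon> * (v - u)"
      by (simp add: X_def Y_def mult.commute)
  qed
qed

text \<open>The back speed is the component of the front velocity along the frame, hence at most the
  front speed. The local estimate is globalized by means of \<open>M\<close>, without
  differentiating \<open>front\<close>.\<close>

lemma back_le:
  assumes "a \<le> u" "u \<le> v" "v \<le> b"
  shows "norm (back v - back u) \<le> M v - M u"
proof -
  obtain N where N: "negligible N"
    "\<And>t. t \<in> {a..b} - N \<Longrightarrow> \<exists>c::real. (back has_vector_derivative c *\<^sub>R frame t) (at t within {a..b})"
    using noskid_ae by blast
  have sub: "{u..v} \<subseteq> {a..b}" using assms by auto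
  have "dist (back u) (back v) \<le> M v - M u"
  proof (rule abs_continuous_dist_le[OF \<open>u \<le> v\<close> _ _ N(1)])
    show "abs_continuous_on_interval u v back"
      by (rule abs_continuous_compose_lipschitz[OF abs_continuous_subinterval[OF abs_continuous_path], where C = 1])
        (use assms in \<open>auto simp: dist_fst_le\<close>)
    show "mono_on {u..v} M" using M_mono sub by (rule mono_on_subset)
    fix t \<epsilon> :: real assume t: "t \<in> {u..v} - N" and \<epsilon>: "\<epsilon> > 0"
    then have "t \<in> {a..b} - N" using sub by auto
    then obtain c where "(back has_vector_derivative c *\<^sub>R frame t) (at t within {a..b})" using N(2) by blast
    with t sub \<epsilon> obtain \<delta> where \<delta>: "\<delta> > 0" "\<And>x y. x \<in> {a..b} \<and> y \<in> {a..b} \<and> x \<le> t \<and> t \<le> y \<and> t - x < \<delta> \<and> y - t < \<delta> \<Longrightarrow>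
         norm (back y - back x) \<le> (1 + \<epsilon>) * norm (front y - front x) + \<epsilon> * (y - x)"
      using back_increment_le[of t c \<epsilon>] by blast
    show "\<exists>\<delta>>0. \<forall>x y. x \<in> {u..v} \<and> y \<in> {u..v} \<and> x \<le> t \<and> t \<le> y \<and> t - x < \<delta> \<and> y - t < \<delta> \<longrightarrow>
         dist (back x) (back y) \<le> (1 + \<epsilon>) * (M y - M x) + \<epsilon> * (y - x)"
    proof (intro exI[of _ \<delta>] conjI \<delta> allI impI)
      fix x y assume A: "x \<in> {u..v} \<and> y \<in> {u..v} \<and> x \<le> t \<and> t \<le> y \<and> t - x < \<delta> \<and> y - t < \<delta>"
      then have "x \<in> {a..b}" "y \<in> {a..b}" using sub by auto
      then have "norm (back y - back x) \<le> (1 + \<epsilon>) * norm (front y - front x) + \<epsilon> * (y - x)" using \<delta>(2) A by blast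
      also have "norm (front y - front x) \<le> M y - M x" using A assms by (intro front_le) auto
      finally show "dist (back x) (back y) \<le> (1 + \<epsilon>) * (M y - M x) + \<epsilon> * (y - x)"
        using \<epsilon> by (simp add: dist_norm norm_minus_commute)
    qed
  qed
  then show ?thesis by (simp add: dist_norm norm_minus_commute)
qed

lemma frame_le:
  assumes "a \<le> u" "u \<le> v" "v \<le> b"
  shows "norm (frame v - frame u) \<le> 2 * (M v - M u)"
proof -
  have "frame v - frame u = (front v - front u) - (back v - back u)" by (simp add: frame_def)
  then have "norm (frame v - frame u) \<le> norm (front v - front u) + norm (back v - back u)"
    using norm_triangle_ineq4[of "front v - front u" "back v - back u"] by simp
  then show ?thesis using back_le[OF assms] front_le[OF assms] by simp
qed

text \<open>The back velocity points along the frame, and between \<open>u\<close> and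
  \<open>v\<close> the frame departs from \<open>frame u\<close> by at most \<open>2 * m\<close>;
  summing over length \<open>m\<close> gives the square. This is the no-skid condition in a form
  that passes to another parameter without derivatives.\<close>

lemma back_transversal_le:
  assumes "a \<le> u" "u \<le> v" "v \<le> b"
  shows "\<bar>(back v - back u) \<bullet> (\<i> * frame u)\<bar> \<le> 2 * (M v - M u)\<^sup>2"
proof -
  obtain N where N: "negligible N"
    "\<And>t. t \<in> {a..b} - N \<Longrightarrow> \<exists>c::real. (back has_vector_derivative c *\<^sub>R frame t) (at t within {a..b})"
    using noskid_ae by blast
  have sub: "{u..v} \<subseteq> {a..b}" using assms by auto
  define m where "m = M v - M u"
  have m: "m \<ge> 0" using mono_onD[OF M_mono, of u v] assms by (simp add: m_def)
  have nu: "norm (\<i> * frame u) = l" using norm_frame[of u] assms by (simp add: norm_mult)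
  define h where "h t = back t \<bullet> (\<i> * frame u)" for t
  have "dist (h u) (h v) \<le> 2 * m * M v - 2 * m * M u"
  proof (rule abs_continuous_dist_le[OF \<open>u \<le> v\<close> _ _ N(1)])
    show "abs_continuous_on_interval u v h"
    proof (rule abs_continuous_compose_lipschitz[OF abs_continuous_subinterval[OF abs_continuous_path], where C = l])
      fix x y
      have "dist (h x) (h y) = \<bar>(back x - back y) \<bullet> (\<i> * frame u)\<bar>"
        by (simp add: h_def dist_real_def inner_diff_left)
      also have "\<dots> \<le> dist (back x) (back y) * l"
        using Cauchy_Schwarz_ineq2[of "back x - back y" "\<i> * frame u"] nu by (simp add: dist_norm)
      also have "\<dots> \<le> l * dist (\<gamma> x) (\<gamma> y)"
        using dist_fst_le[of "\<gamma> x" "\<gamma> y"] l_pos by (simp add: mult.commute)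
      finally show "dist (h x) (h y) \<le> l * dist (\<gamma> x) (\<gamma> y)" .
    qed (use assms in auto)
    show "mono_on {u..v} (\<lambda>t. 2 * m * M t)"
      using mono_on_subset[OF M_mono sub] m by (auto simp: mono_on_def intro: mult_left_mono)
    fix t \<epsilon> :: real assume t: "t \<in> {u..v} - N" and \<epsilon>: "\<epsilon> > 0"
    then have tab: "t \<in> {a..b} - N" using sub by auto
    then obtain c where c: "(back has_vector_derivative c *\<^sub>R frame t) (at t within {a..b})" using N(2) by blast
    \<comment> \<open>The two error terms \<open>2 * m * \<epsilon>'\<close> and
      \<open>l * \<epsilon>'\<close> have to add up to \<epsilon>.\<close>
    define \<epsilon>' where "\<epsilon>' = \<epsilon> / (2 * m + l)"
    have \<epsilon>': "\<epsilon>' > 0" "\<epsilon>' * (2 * m + l) = \<epsilon>" using \<epsilon> m l_pos by (auto simp: \<epsilon>'_def)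
    obtain \<delta> where \<delta>: "\<delta> > 0" "\<And>x y. \<lbrakk>x \<in> {a..b}; y \<in> {a..b}; x \<le> t; t \<le> y; t - x < \<delta>; y - t < \<delta>\<rbrakk> \<Longrightarrow>
       norm (back y - back x - (y - x) *\<^sub>R (c *\<^sub>R frame t)) \<le> \<epsilon>' * (y - x)"
      using vector_derivative_straddle[OF c \<epsilon>'(1)] by blast
    show "\<exists>\<delta>>0. \<forall>x y. x \<in> {u..v} \<and> y \<in> {u..v} \<and> x \<le> t \<and> t \<le> y \<and> t - x < \<delta> \<and> y - t < \<delta> \<longrightarrow>
         dist (h x) (h y) \<le> (1 + \<epsilon>) * (2 * m * M y - 2 * m * M x) + \<epsilon> * (y - x)"
    proof (intro exI[of _ \<delta>] conjI \<delta> allI impI)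
      fix x y assume A: "x \<in> {u..v} \<and> y \<in> {u..v} \<and> x \<le> t \<and> t \<le> y \<and> t - x < \<delta> \<and> y - t < \<delta>"
      then have xy: "x \<in> {a..b}" "y \<in> {a..b}" "x \<le> y" using sub by auto
      define R where "R = back y - back x - (y - x) *\<^sub>R (c *\<^sub>R frame t)"
      have R: "norm R \<le> \<epsilon>' * (y - x)" unfolding R_def using A xy by (intro \<delta>) auto
      have nt: "norm (frame t) = l" using norm_frame tab by simp
      have bR: "back y - back x = ((y - x) * c) *\<^sub>R frame t + R" by (simp add: R_def)
      have Mxy: "M y - M x \<ge> 0" using mono_onD[OF M_mono, of x y] xy by simp
      have "\<bar>frame t \<bullet> (\<i> * frame u)\<bar> = \<bar>(frame t - frame u) \<bullet> (\<i> * frame u)\<bar>"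
        by (simp add: inner_diff_left inner_complex_def algebra_simps)
      also have "\<dots> \<le> norm (frame t - frame u) * l" using Cauchy_Schwarz_ineq2 nu by metis
      also have "\<dots> \<le> 2 * m * l"
      proof (rule mult_right_mono)
        have "M t \<le> M v" using mono_onD[OF M_mono, of t v] t assms by auto
        then show "norm (frame t - frame u) \<le> 2 * m"
          using frame_le[of u t] t assms by (auto simp: m_def)
      qed (use l_pos in simp)
      finally have 1: "\<bar>frame t \<bullet> (\<i> * frame u)\<bar> \<le> 2 * m * l" .
      have "\<bar>(y - x) * c\<bar> * l = norm (back y - back x - R)" using nt by (simp add: bR)
      also have "\<dots> \<le> norm (back y - back x) + norm R" by (rule norm_triangle_ineq4)
      also have "\<dots> \<le> (M y - M x) + \<epsilon>' * (y - x)"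
        using R back_le[of x y] xy by auto
      finally have 2: "\<bar>(y - x) * c\<bar> * l \<le> (M y - M x) + \<epsilon>' * (y - x)" .
      have "dist (h x) (h y) = \<bar>(back y - back x) \<bullet> (\<i> * frame u)\<bar>"
        by (simp add: h_def dist_real_def inner_diff_left abs_minus_commute)
      also have "\<dots> = \<bar>((y - x) * c) * (frame t \<bullet> (\<i> * frame u)) + R \<bullet> (\<i> * frame u)\<bar>"
        unfolding bR by (simp add: inner_add_left)
      also have "\<dots> \<le> \<bar>(y - x) * c\<bar> * \<bar>frame t \<bullet> (\<i> * frame u)\<bar> + norm R * l"
        by (intro order_trans[OF abs_triangle_ineq] add_mono Cauchy_Schwarz_ineq2[of R "\<i> * frame u", unfolded nu])
          (simp add: abs_mult)
      also have "\<dots> \<le> \<bar>(y - x) * c\<bar> * (2 * m * l) + (\<epsilon>' * (y - x)) * l"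
        using 1 R l_pos by (intro add_mono mult_left_mono mult_right_mono) auto
      also have "\<dots> \<le> 2 * m * ((M y - M x) + \<epsilon>' * (y - x)) + (\<epsilon>' * (y - x)) * l"
        using mult_left_mono[OF 2, of "2 * m"] m by (simp add: algebra_simps)
      also have "\<dots> = 2 * m * (M y - M x) + (\<epsilon>' * (2 * m + l)) * (y - x)" by (simp add: algebra_simps)
      also have "\<dots> \<le> (1 + \<epsilon>) * (2 * m * M y - 2 * m * M x) + \<epsilon> * (y - x)"
      proof -
        have "0 \<le> \<epsilon> * (2 * m * (M y - M x))" using \<epsilon> m Mxy by simp
        then show ?thesis unfolding \<epsilon>'(2) by (simp add: algebra_simps)
      qed
      finally show "dist (h x) (h y) \<le> (1 + \<epsilon>) * (2 * m * M y - 2 * m * M x) + \<epsilon> * (y - x)" .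
    qed
  qed
  then show ?thesis
    by (simp add: h_def dist_real_def inner_diff_left abs_minus_commute m_def power2_eq_square algebra_simps)
qed

end

text \<open>A pause of the front is a pause of the back wheel as well, so the whole configuration is
  a function of the front arc length.\<close>

lemma (in bicycle_track) eq_if_no_progress:
  assumes "u \<in> {a..b}" "v \<in> {a..b}" "M u = M v"
  shows "\<gamma> u = \<gamma> v"
proof -
  have *: "\<gamma> x = \<gamma> y" if "a \<le> x" "x \<le> y" "y \<le> b" "M x = M y" for x y
  proof -
    have "norm (front y - front x) = 0" "norm (back y - back x) = 0"
      using front_le[OF that(1-3)] back_le[OF that(1-3)] that(4) by simp_all
    then show ?thesis by (simp add: prod_eq_iff)
  qed
  show ?thesis
  proof (cases "u \<le> v")
    case True
    then show ?thesis using assms by (intro *) simp_all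
  next
    case False
    then show ?thesis using assms by (intro *[symmetric]) simp_all
  qed
qed

lemma front_track_abs_continuous:
  "bicycle_path l a b \<gamma> \<Longrightarrow> abs_continuous_on_interval a b (front_track \<gamma>)"
  unfolding front_track_def
  by (rule abs_continuous_compose_lipschitz[where C = 1 and g = \<gamma>]) (auto simp: bicycle_path_def dist_snd_le)

lemma bicycle_track_curve_length:
  assumes "l > 0" and path: "bicycle_path l a b \<gamma>"
  shows "bicycle_track l a b \<gamma> (\<lambda>t. enn2real (curve_length a t (front_track \<gamma>)))" (is "bicycle_track l a b \<gamma> ?M")
proof
  define f where "f = front_track \<gamma>"
  have fin: "curve_length a t f = ennreal (?M t)" if "a \<le> t" "t \<le> b" for t
    using abs_continuous_curve_length_finite[OF abs_continuous_subinterval[OF front_track_abs_continuous[OF path]], of a t] that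
    by (simp add: f_def)
  have front: "dist (f u) (f v) \<le> ?M v - ?M u" if "a \<le> u" "u \<le> v" "v \<le> b" for u v
  proof -
    have "ennreal (?M u + dist (f u) (f v)) \<le> ennreal (?M v)"
      using curve_length_extend[of a u v f] that fin[of u] fin[of v] by (simp add: ennreal_plus f_def)
    then have "?M u + dist (f u) (f v) \<le> ?M v" by (subst (asm) ennreal_le_iff) auto
    then show ?thesis by simp
  qed
  show "mono_on {a..b} ?M"
  proof (rule mono_onI)
    fix u v assume "u \<in> {a..b}" "v \<in> {a..b}" "u \<le> v"
    then show "?M u \<le> ?M v" using order_trans[OF zero_le_dist front[of u v]] by auto
  qed
  show "norm (snd (\<gamma> v) - snd (\<gamma> u)) \<le> ?M v - ?M u" if "a \<le> u" "u \<le> v" "v \<le> b" for u v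
    using front[OF that] by (simp add: f_def front_track_def dist_norm norm_minus_commute)
qed (use assms in auto)

text \<open>\<open>\<beta>\<close> is the path as a function of its front arc length. It is not
  shown to be a bicycle path; what the variation needs from the no-skid condition is carried by the
  last estimate.\<close>

lemma arc_length_reparametrization:
  assumes l: "l > 0" and path: "bicycle_path l a b \<gamma>" and nc: "\<not> \<gamma> constant_on {a..b}"
  obtains T \<phi> \<beta> where "T > 0" "curve_length a b (front_track \<gamma>) = ennreal T"
    "mono_on {a..b} \<phi>" "\<phi> ` {a..b} = {0..T}" "\<And>t. t \<in> {a..b} \<Longrightarrow> \<gamma> t = \<beta> (\<phi> t)"
    "\<And>s. s \<in> {0..T} \<Longrightarrow> norm (snd (\<beta> s) - fst (\<beta> s)) = l"
    "\<And>s s'. \<lbrakk>0 \<le> s; s \<le> s'; s' \<le> T\<rbrakk> \<Longrightarrow> norm (snd (\<beta> s') - snd (\<beta> s)) \<le> s' - s"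
    "\<And>s s'. \<lbrakk>0 \<le> s; s \<le> s'; s' \<le> T\<rbrakk> \<Longrightarrow> norm (fst (\<beta> s') - fst (\<beta> s)) \<le> s' - s"
    "\<And>s s'. \<lbrakk>0 \<le> s; s \<le> s'; s' \<le> T\<rbrakk> \<Longrightarrow>
        \<bar>(fst (\<beta> s') - fst (\<beta> s)) \<bullet> (\<i> * (snd (\<beta> s) - fst (\<beta> s)))\<bar> \<le> 2 * (s' - s)\<^sup>2"
proof -
  define f where "f = front_track \<gamma>"
  have ab: "a \<le> b" using path by (simp add: bicycle_path_def)
  have ac: "abs_continuous_on_interval a b f" unfolding f_def by (rule front_track_abs_continuous[OF path])
  define M where "M t = enn2real (curve_length a t f)" for t
  have fin: "curve_length a t f < \<infinity>" if "a \<le> t" "t \<le> b" for t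
    using abs_continuous_curve_length_finite[OF abs_continuous_subinterval[OF ac]] that by auto
  have lenM: "curve_length a t f = ennreal (M t)" if "a \<le> t" "t \<le> b" for t
    using fin[OF that] by (simp add: M_def)
  have M_nonneg: "M t \<ge> 0" for t by (simp add: M_def)
  interpret bicycle_track l a b \<gamma> M
    unfolding M_def[abs_def] f_def by (rule bicycle_track_curve_length[OF l path])
  have small: "\<exists>\<delta>>0. \<forall>u v. a \<le> u \<and> u \<le> v \<and> v \<le> b \<and> v - u < \<delta> \<longrightarrow> M v - M u \<le> \<epsilon>" if "\<epsilon> > 0" for \<epsilon>
  proof -
    obtain \<delta> where \<delta>: "\<delta> > 0" "\<And>u v. \<lbrakk>a \<le> u; u \<le> v; v \<le> b; v - u < \<delta>\<rbrakk> \<Longrightarrow> curve_length u v f \<le> ennreal \<epsilon>"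
      using abs_continuous_curve_length_small[OF ac \<open>\<epsilon> > 0\<close>] by blast
    show ?thesis
    proof (intro exI[of _ \<delta>] conjI \<delta> allI impI)
      fix u v assume A: "a \<le> u \<and> u \<le> v \<and> v \<le> b \<and> v - u < \<delta>"
      have "curve_length a v f \<le> curve_length a u f + curve_length u v f"
        using A by (intro curve_length_le_add) auto
      also have "\<dots> \<le> curve_length a u f + ennreal \<epsilon>" using A by (intro add_left_mono \<delta>) auto
      finally have "ennreal (M v) \<le> ennreal (M u + \<epsilon>)"
        using lenM[of u] lenM[of v] A M_nonneg \<open>\<epsilon> > 0\<close> by (simp add: ennreal_plus)
      then show "M v - M u \<le> \<epsilon>" using M_nonneg[of u] \<open>\<epsilon> > 0\<close> by (subst (asm) ennreal_le_iff) auto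
    qed
  qed
  have Ma: "M a = 0"
  proof (rule antisym[OF field_le_epsilon M_nonneg])
    fix \<epsilon> :: real assume "\<epsilon> > 0"
    obtain \<delta> where "\<delta> > 0" "\<And>u v. \<lbrakk>a \<le> u; u \<le> v; v \<le> b; v - u < \<delta>\<rbrakk> \<Longrightarrow> curve_length u v f \<le> ennreal \<epsilon>"
      using abs_continuous_curve_length_small[OF ac \<open>\<epsilon> > 0\<close>] by blast
    then have "ennreal (M a) \<le> ennreal \<epsilon>" using ab lenM[of a] by (metis order_refl diff_self)
    then show "M a \<le> 0 + \<epsilon>" using \<open>\<epsilon> > 0\<close> by (subst (asm) ennreal_le_iff) auto
  qed
  have contM: "continuous_on {a..b} M"
    unfolding continuous_on_iff
  proof (intro ballI allI impI)
    fix x \<epsilon> :: real assume x: "x \<in> {a..b}" and "\<epsilon> > 0"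
    then obtain \<delta> where \<delta>: "\<delta> > 0" "\<forall>u v. a \<le> u \<and> u \<le> v \<and> v \<le> b \<and> v - u < \<delta> \<longrightarrow> M v - M u \<le> \<epsilon> / 2"
      using small[of "\<epsilon> / 2"] by auto
    show "\<exists>d>0. \<forall>x'\<in>{a..b}. dist x' x < d \<longrightarrow> dist (M x') (M x) < \<epsilon>"
    proof (intro exI[of _ \<delta>] conjI \<delta>(1) ballI impI)
      fix y assume y: "y \<in> {a..b}" "dist y x < \<delta>"
      show "dist (M y) (M x) < \<epsilon>"
      proof (cases "x \<le> y")
        case True
        then show ?thesis using \<delta>(2)[rule_format, of x y] mono_onD[OF M_mono x y(1)] x y \<open>\<epsilon> > 0\<close>
          by (auto simp: dist_real_def)
      next
        case False
        then show ?thesis using \<delta>(2)[rule_format, of y x] mono_onD[OF M_mono y(1) x] x y \<open>\<epsilon> > 0\<close>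
          by (auto simp: dist_real_def)
      qed
    qed
  qed
  define T where "T = M b"
  have image: "M ` {a..b} = {0..T}"
  proof
    show "M ` {a..b} \<subseteq> {0..T}" using M_nonneg mono_onD[OF M_mono] by (auto simp: T_def)
    show "{0..T} \<subseteq> M ` {a..b}"
    proof
      fix y assume "y \<in> {0..T}"
      then obtain x where "a \<le> x" "x \<le> b" "M x = y"
        using IVT'[of M a y b] ab contM Ma by (auto simp: T_def)
      then show "y \<in> M ` {a..b}" by auto
    qed
  qed
  have "T > 0"
  proof (rule ccontr)
    assume "\<not> T > 0"
    have Mt: "M t = 0" if "t \<in> {a..b}" for t
    proof -
      have "M t \<in> {0..T}" using image that by blast
      then have "0 \<le> M t" "M t \<le> T" by auto
      then show ?thesis using \<open>\<not> T > 0\<close> by linarith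
    qed
    have "\<gamma> t = \<gamma> a" if "t \<in> {a..b}" for t
      by (rule eq_if_no_progress) (use that ab Ma Mt[OF that] in auto)
    then show False using nc unfolding constant_on_def by blast
  qed
  \<comment> \<open>Any time with \<open>M t = s\<close> serves: \<open>eq_if_no_progress\<close>
    makes the value independent of the choice.\<close>
  define \<beta> where "\<beta> s = \<gamma> (SOME t. t \<in> {a..b} \<and> M t = s)" for s
  have \<beta>: "\<beta> (M t) = \<gamma> t" if "t \<in> {a..b}" for t
  proof -
    have "(SOME u. u \<in> {a..b} \<and> M u = M t) \<in> {a..b} \<and> M (SOME u. u \<in> {a..b} \<and> M u = M t) = M t"
      by (rule someI[of _ t]) (use that in simp)
    then show ?thesis unfolding \<beta>_def using that by (intro eq_if_no_progress) auto
  qed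
  have pre: "\<exists>u. u \<in> {a..b} \<and> s = M u" if "s \<in> {0..T}" for s using that[folded image] by blast
  \<comment> \<open>The preimages must come in increasing order. If they are reversed, monotonicity
    of \<open>M\<close> forces \<open>s = s'\<close>, and one preimage is used for both.\<close>
  have pre2: "\<exists>u v. a \<le> u \<and> u \<le> v \<and> v \<le> b \<and> s = M u \<and> s' = M v" if "0 \<le> s" "s \<le> s'" "s' \<le> T" for s s'
  proof -
    obtain u v where uv: "u \<in> {a..b}" "v \<in> {a..b}" "s = M u" "s' = M v"
    proof -
      have "s \<in> {0..T}" "s' \<in> {0..T}" using \<open>0 \<le> s\<close> \<open>s \<le> s'\<close> \<open>s' \<le> T\<close> by auto
      then show thesis using pre that by blast
    qed
    show ?thesis
    proof (cases "u \<le> v")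
      case True
      then show ?thesis using uv by (intro exI[of _ u] exI[of _ v]) simp
    next
      case False
      then have "s' \<le> s" using mono_onD[OF M_mono uv(2,1)] uv by simp
      then have "M v = s" using uv(4) \<open>s \<le> s'\<close> by linarith
      then show ?thesis using uv by (intro exI[of _ v]) simp
    qed
  qed
  show thesis
  proof (rule that[of T M \<beta>])
    show "T > 0" by fact
    show "curve_length a b (front_track \<gamma>) = ennreal T" using lenM[of b] ab by (simp add: T_def f_def)
    show "mono_on {a..b} M" "M ` {a..b} = {0..T}" by (rule M_mono, rule image)
    show "\<And>t. t \<in> {a..b} \<Longrightarrow> \<gamma> t = \<beta> (M t)" using \<beta> by simp
    show "norm (snd (\<beta> s) - fst (\<beta> s)) = l" if s: "s \<in> {0..T}" for s
    proof -
      obtain u where "u \<in> {a..b}" "s = M u" using pre[OF s] by blast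
      then show ?thesis using norm_frame[of u] \<beta>[of u] by (simp add: frame_def)
    qed
    fix s s' assume "0 \<le> s" "s \<le> s'" "s' \<le> T"
    then obtain u v where uv: "a \<le> u" "u \<le> v" "v \<le> b" "s = M u" "s' = M v"
      using pre2 by blast
    then have \<beta>uv: "\<beta> s = \<gamma> u" "\<beta> s' = \<gamma> v" using \<beta>[of u] \<beta>[of v] by simp_all
    show "norm (snd (\<beta> s') - snd (\<beta> s)) \<le> s' - s" using front_le[OF uv(1-3)] uv \<beta>uv by simp
    show "norm (fst (\<beta> s') - fst (\<beta> s)) \<le> s' - s" using back_le[OF uv(1-3)] uv \<beta>uv by simp
    show "\<bar>(fst (\<beta> s') - fst (\<beta> s)) \<bullet> (\<i> * (snd (\<beta> s) - fst (\<beta> s)))\<bar> \<le> 2 * (s' - s)\<^sup>2"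
      using back_transversal_le[OF uv(1-3)] uv \<beta>uv by (simp add: frame_def)
  qed
qed

section \<open>Densities of Lipschitz curves\<close>

text \<open>The image measure of Lebesgue measure under the inverse of a bi-Lipschitz function is
  absolutely continuous, and its Radon-Nikodym derivative is the density sought.\<close>

lemma bilipschitz_density:
  fixes F :: "real \<Rightarrow> real"
  assumes c: "c > 0" and lower: "\<And>x y. x \<le> y \<Longrightarrow> c * (y - x) \<le> F y - F x"
    and upper: "\<And>x y. x \<le> y \<Longrightarrow> F y - F x \<le> C * (y - x)"
  obtains g :: "real \<Rightarrow> real" where "g \<in> borel_measurable borel" "\<And>x. g x \<ge> 0"
    "\<And>x y. x \<le> y \<Longrightarrow> (g has_integral F y - F x) {x..y}"
proof -
  have smono: "strict_mono F"
  proof (rule strict_monoI)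
    fix x y :: real assume "x < y"
    then have "0 < c * (y - x)" using c by simp
    then show "F x < F y" using lower[of x y] \<open>x < y\<close> by simp
  qed
  have lip: "\<bar>F x - F y\<bar> \<le> \<bar>C\<bar> * \<bar>x - y\<bar>" for x y
  proof -
    have "F v - F u \<le> \<bar>C\<bar> * (v - u)" if "u \<le> v" for u v
      using that by (intro order_trans[OF upper[OF that] mult_right_mono[OF abs_ge_self]]) simp
    moreover have "F u \<le> F v" if "u \<le> v" for u v using smono that by (simp add: strict_mono_less_eq)
    ultimately have *: "\<bar>F u - F v\<bar> \<le> \<bar>C\<bar> * \<bar>u - v\<bar>" if "u \<le> v" for u v
      using that by (simp add: abs_minus_commute)
    show ?thesis
    proof (cases "x \<le> y")
      case False
      then show ?thesis using *[of y x] by (simp add: abs_minus_commute)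
    qed (rule *)
  qed
  have contF: "isCont F x" for x
  proof -
    have "continuous_on UNIV F"
      by (rule lipschitz_on_continuous_on[of "\<bar>C\<bar>"]) (auto intro!: lipschitz_onI simp: dist_real_def lip)
    then show ?thesis by (simp add: continuous_on_eq_continuous_at)
  qed
  have surj: "\<exists>x. F x = y" for y
  proof -
    define r where "r = \<bar>y - F 0\<bar> / c"
    have r: "r \<ge> 0" "c * r = \<bar>y - F 0\<bar>" using c by (auto simp: r_def)
    have "F (-r) \<le> y" "y \<le> F r" using lower[of "-r" 0] lower[of 0 r] r by auto
    then show ?thesis using IVT[of F "-r" y r] contF r by auto
  qed
  define G where "G = inv F"
  have inj: "inj F" using smono by (rule strict_mono_imp_inj_on)
  have FG: "F (G y) = y" for y using surj unfolding G_def by (metis f_inv_into_f rangeI)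
  have GF: "G (F x) = x" for x using inj by (simp add: G_def)
  have vimage: "G -` A = F ` A" for A using FG GF by (auto simp: image_iff) metis
  have "mono G"
  proof (rule monoI)
    fix x y :: real assume "x \<le> y"
    then show "G x \<le> G y" using FG smono by (metis strict_mono_less_eq)
  qed
  then have G_meas[measurable]: "G \<in> borel_measurable borel" by (rule borel_measurable_mono)
  define N where "N = distr lborel borel G"
  \<comment> \<open>Preimages under \<open>G\<close> are images under \<open>F\<close>, and a
    Lipschitz map sends null sets to null sets.\<close>
  have "absolutely_continuous lborel N"
    unfolding absolutely_continuous_def
  proof
    fix A :: "real set" assume A: "A \<in> null_sets lborel"
    then have Am: "A \<in> sets borel" by auto
    have "negligible A" using A by (simp add: negligible_iff_null_sets null_sets_completionI)
    then have "negligible (F ` A)"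
    proof (rule negligible_locally_Lipschitz_image[OF order_refl])
      fix x show "\<exists>T B. open T \<and> x \<in> T \<and> (\<forall>y\<in>A \<inter> T. norm (F y - F x) \<le> B * norm (y - x))"
        by (intro exI[of _ UNIV] exI[of _ "\<bar>C\<bar>"]) (auto simp: lip)
    qed
    then have "F ` A \<in> null_sets lebesgue" by (simp add: negligible_iff_null_sets)
    moreover have "F ` A \<in> sets borel" using measurable_sets[OF G_meas Am] vimage by simp
    ultimately have "F ` A \<in> null_sets lborel" by (simp add: null_sets_completion_iff)
    then show "A \<in> null_sets N" using Am by (auto simp: N_def null_sets_def emeasure_distr vimage)
  qed
  then obtain h where h[measurable]: "h \<in> borel_measurable lborel" and dens: "density lborel h = N"
    using sigma_finite_measure.Radon_Nikodym[OF sigma_finite_lborel, of N] by (auto simp: N_def)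
  have hint: "(\<integral>\<^sup>+ t. h t * indicator {x..y} t \<partial>lborel) = ennreal (F y - F x)" if "x \<le> y" for x y
  proof -
    have "(\<integral>\<^sup>+ t. h t * indicator {x..y} t \<partial>lborel) = emeasure N {x..y}"
      by (subst dens[symmetric], subst emeasure_density) auto
    also have "\<dots> = emeasure lborel (F ` {x..y})" by (simp add: N_def emeasure_distr vimage)
    also have "F ` {x..y} = {F x..F y}"
    proof (intro subset_antisym subsetI)
      fix z assume "z \<in> {F x..F y}"
      then have "G z \<in> {x..y}" using smono FG by (metis atLeastAtMost_iff strict_mono_less_eq)
      then show "z \<in> F ` {x..y}" using FG by (metis imageI)
    qed (use smono in \<open>auto simp: strict_mono_less_eq\<close>)
    also have "emeasure lborel {F x..F y} = ennreal (F y - F x)"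
      using that smono by (simp add: strict_mono_less_eq)
    finally show ?thesis .
  qed
  have fin: "AE t in lborel. t \<in> {x..y} \<longrightarrow> h t \<noteq> \<infinity>" if "x \<le> y" for x y
  proof -
    have "AE t in lborel. h t * indicator {x..y} t \<noteq> \<infinity>"
      by (rule nn_integral_noteq_infinite) (auto simp: hint[OF that])
    then show ?thesis by eventually_elim (auto simp: indicator_def split: if_splits)
  qed
  define g where "g t = enn2real (h t)" for t
  show thesis
  proof (rule that[of g])
    show gm: "g \<in> borel_measurable borel" unfolding g_def using h by measurable
    show "g x \<ge> 0" for x by (simp add: g_def)
    fix x y :: real assume xy: "x \<le> y"
    have "(\<integral>\<^sup>+ t. ennreal (indicator {x..y} t * g t) \<partial>lborel) = (\<integral>\<^sup>+ t. h t * indicator {x..y} t \<partial>lborel)"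
      by (rule nn_integral_cong_AE, use fin[OF xy] in eventually_elim)
         (auto simp: g_def indicator_def less_top)
    also have "\<dots> = ennreal (F y - F x)" by (rule hint[OF xy])
    finally have "((\<lambda>t. indicator {x..y} t * g t) has_integral F y - F x) UNIV"
      using gm xy smono by (intro nn_integral_has_integral) (auto simp: g_def strict_mono_less_eq)
    moreover have "(\<lambda>t. indicator {x..y} t * g t) = (\<lambda>t. if t \<in> {x..y} then g t else 0)" by (auto simp: indicator_def)
    ultimately show "(g has_integral F y - F x) {x..y}" by (simp only: has_integral_restrict_UNIV)
  qed
qed

text \<open>On a fine tagged division the value at the tag times the length is close to the integral
  over the interval, with total error controlled by Henstock's lemma. The norms of the integrals are
  bounded by increments of \<open>R\<close>, which telescope.\<close>

lemma integral_norm_le_if_increments_le: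
  fixes f :: "real \<Rightarrow> 'a::euclidean_space"
  assumes ab: "a \<le> b" and f: "f integrable_on {a..b}" and nf: "(\<lambda>x. norm (f x)) integrable_on {a..b}"
    and R: "\<And>x y. \<lbrakk>a \<le> x; x \<le> y; y \<le> b\<rbrakk> \<Longrightarrow> norm (integral {x..y} f) \<le> R y - R x"
  shows "integral {a..b} (\<lambda>x. norm (f x)) \<le> R b - R a"
proof (rule field_le_epsilon)
  fix e :: real assume "e > 0"
  \<comment> \<open>The factor \<open>2 * DIM('a)\<close> is the loss in Henstock's lemma when norms
    of errors are summed; the other half of \<open>e\<close> is spent on the integral of the
    norm.\<close>
  define e1 where "e1 = e / (2 * (2 * real DIM('a)))"
  have e1: "e1 > 0" "2 * real DIM('a) * e1 = e / 2" using \<open>e > 0\<close> by (auto simp: e1_def)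
  obtain d1 where d1: "gauge d1" and d1': "\<forall>p. p tagged_division_of {a..b} \<and> d1 fine p \<longrightarrow>
     norm ((\<Sum>(x,K)\<in>p. measure lborel K *\<^sub>R f x) - integral {a..b} f) < e1"
    using integrable_integral[OF f, unfolded has_integral_real, rule_format, OF e1(1)]
    by (elim exE conjE) (rule that)
  obtain d2 where d2: "gauge d2" and d2': "\<forall>p. p tagged_division_of {a..b} \<and> d2 fine p \<longrightarrow>
     norm ((\<Sum>(x,K)\<in>p. measure lborel K *\<^sub>R norm (f x)) - integral {a..b} (\<lambda>x. norm (f x))) < e / 2"
    using integrable_integral[OF nf, unfolded has_integral_real, rule_format, OF half_gt_zero[OF \<open>e > 0\<close>]]
    by (elim exE conjE) (rule that)
  obtain p where p: "p tagged_division_of {a..b}" "(\<lambda>x. d1 x \<inter> d2 x) fine p"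
    using fine_division_exists_real[OF gauge_Int[OF d1 d2]] by blast
  then have fine: "d1 fine p" "d2 fine p" by (auto simp: fine_Int)
  have "integral {a..b} (\<lambda>x. norm (f x)) \<le> (\<Sum>(x,K)\<in>p. measure lborel K *\<^sub>R norm (f x)) + e / 2"
    using d2'[rule_format, OF conjI[OF p(1) fine(2)]] unfolding real_norm_def by linarith
  also have "(\<Sum>(x,K)\<in>p. measure lborel K *\<^sub>R norm (f x)) \<le>
     (\<Sum>(x,K)\<in>p. norm (measure lborel K *\<^sub>R f x - integral K f) + (R (Sup K) - R (Inf K)))"
  proof (rule sum_mono, clarify)
    fix x K assume xK: "(x, K) \<in> p"
    obtain u v where K: "K = {u..v}" using tagged_division_ofD(4)[OF p(1) xK] by auto
    have "x \<in> {u..v}" "{u..v} \<subseteq> {a..b}" using tagged_division_ofD(2,3)[OF p(1) xK] K by auto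
    then have uv: "u \<le> v" "a \<le> u" "v \<le> b" by auto
    have "measure lborel K *\<^sub>R norm (f x) = norm (measure lborel K *\<^sub>R f x)" by simp
    also have "\<dots> \<le> norm (measure lborel K *\<^sub>R f x - integral K f) + norm (integral K f)"
      by (metis diff_add_cancel norm_triangle_ineq)
    also have "norm (integral K f) \<le> R (Sup K) - R (Inf K)" using R[of u v] K uv by simp
    finally show "measure lborel K *\<^sub>R norm (f x) \<le> norm (measure lborel K *\<^sub>R f x - integral K f) + (R (Sup K) - R (Inf K))" by simp
  qed
  also have "\<dots> = (\<Sum>(x,K)\<in>p. norm (measure lborel K *\<^sub>R f x - integral K f)) + (R b - R a)"
    using additive_tagged_division_1[OF ab p(1), of R] by (simp add: sum.distrib case_prod_unfold)
  also have "(\<Sum>(x,K)\<in>p. norm (measure lborel K *\<^sub>R f x - integral K f)) \<le> 2 * real DIM('a) * e1"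
    using p(1) d1 d1' e1(1) f fine
    by (intro Henstock_lemma_part2[where a = a and b = b and d = d1]) (auto simp: tagged_division_of_def)
  finally show "integral {a..b} (\<lambda>x. norm (f x)) \<le> R b - R a + e" using e1 by simp
qed

lemma AE_eq_0_if_integral_0:
  fixes f :: "real \<Rightarrow> real"
  assumes f: "f \<in> borel_measurable borel" "\<And>x. f x \<ge> 0" and i: "(f has_integral 0) {a..b}"
  shows "AE x in lborel. x \<in> {a..b} \<longrightarrow> f x = 0"
proof -
  have "(\<integral>\<^sup>+ x. ennreal (f x) * indicator {a..b} x \<partial>lborel) = 0"
    using nn_integral_has_integral_lebesgue'[OF _ i] f(2) by (simp add: nn_integral_completion)
  then have "AE x in lborel. ennreal (f x) * indicator {a..b} x = 0"
    using f(1) by (subst (asm) nn_integral_0_iff_AE) auto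
  then show ?thesis
  proof eventually_elim
    case (elim x)
    then show ?case using f(2)[of x] by (auto simp: ennreal_eq_0_iff)
  qed
qed

lemma bounded_borel_absolutely_integrable:
  fixes f :: "real \<Rightarrow> 'a::euclidean_space"
  assumes "f \<in> borel_measurable borel" and "\<And>x. norm (f x) \<le> B"
  shows "f absolutely_integrable_on {a..b}"
proof (rule measurable_bounded_by_integrable_imp_absolutely_integrable)
  show "f \<in> borel_measurable (lebesgue_on {a..b})"
    using assms(1) by (simp add: borel_measurable_if_lebesgue_on measurable_completion measurable_restrict_space1)
  show "(\<lambda>x. B) integrable_on {a..b}" by (intro integrable_continuous_real continuous_intros)
qed (use assms in auto)

text \<open>Adding \<open>2 * x\<close> to a coordinate makes it bi-Lipschitz with constants 1 and
  3, so both coordinates have densities. Their combination is then shown to have norm at most one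
  almost everywhere, and is redefined as 0 on the exceptional set to make the bound hold
  everywhere.\<close>

lemma lipschitz_density:
  fixes f :: "real \<Rightarrow> complex"
  assumes T: "T \<ge> 0" and f: "\<And>s s'. \<lbrakk>0 \<le> s; s \<le> s'; s' \<le> T\<rbrakk> \<Longrightarrow> norm (f s' - f s) \<le> s' - s"
  obtains \<zeta> :: "real \<Rightarrow> complex" where "\<zeta> \<in> borel_measurable borel" "\<And>s. norm (\<zeta> s) \<le> 1"
    "\<And>s s'. \<lbrakk>0 \<le> s; s \<le> s'; s' \<le> T\<rbrakk> \<Longrightarrow> (\<zeta> has_integral f s' - f s) {s..s'}"
proof -
  \<comment> \<open>Clamping to \<open>{0..T}\<close> continues the curve constantly, since
    \<open>bilipschitz_density\<close> speaks of functions on the whole line.\<close>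
  define cl where "cl s = max 0 (min T s)" for s
  have cl: "0 \<le> cl s" "cl s \<le> cl s'" "cl s' \<le> T" "cl s' - cl s \<le> s' - s" if "s \<le> s'" for s s'
    using that T by (auto simp: cl_def)
  have cl_id: "cl s = s" if "0 \<le> s" "s \<le> T" for s using that by (auto simp: cl_def)
  have fc: "norm (f (cl s') - f (cl s)) \<le> s' - s" if "s \<le> s'" for s s'
    using f[OF cl(1-3)[OF that]] cl(4)[OF that] by linarith
  have re: "\<bar>Re (f (cl s')) - Re (f (cl s))\<bar> \<le> s' - s" "\<bar>Im (f (cl s')) - Im (f (cl s))\<bar> \<le> s' - s" if "s \<le> s'" for s s'
    using fc[OF that] abs_Re_le_cmod[of "f (cl s') - f (cl s)"] abs_Im_le_cmod[of "f (cl s') - f (cl s)"] by auto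
  obtain g1 :: "real \<Rightarrow> real" where g1: "g1 \<in> borel_measurable borel" "\<And>x. g1 x \<ge> 0"
    "\<And>x y. x \<le> y \<Longrightarrow> (g1 has_integral (Re (f (cl y)) + 2 * y) - (Re (f (cl x)) + 2 * x)) {x..y}"
  proof (rule bilipschitz_density[of 1 "\<lambda>x. Re (f (cl x)) + 2 * x" 3])
    fix x y :: real assume xy: "x \<le> y"
    show "1 * (y - x) \<le> (Re (f (cl y)) + 2 * y) - (Re (f (cl x)) + 2 * x)"
      using re(1)[OF xy] by (simp add: abs_le_iff)
    show "(Re (f (cl y)) + 2 * y) - (Re (f (cl x)) + 2 * x) \<le> 3 * (y - x)"
      using re(1)[OF xy] by (simp add: abs_le_iff)
  qed auto
  obtain g2 :: "real \<Rightarrow> real" where g2: "g2 \<in> borel_measurable borel" "\<And>x. g2 x \<ge> 0"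
    "\<And>x y. x \<le> y \<Longrightarrow> (g2 has_integral (Im (f (cl y)) + 2 * y) - (Im (f (cl x)) + 2 * x)) {x..y}"
  proof (rule bilipschitz_density[of 1 "\<lambda>x. Im (f (cl x)) + 2 * x" 3])
    fix x y :: real assume xy: "x \<le> y"
    show "1 * (y - x) \<le> (Im (f (cl y)) + 2 * y) - (Im (f (cl x)) + 2 * x)"
      using re(2)[OF xy] by (simp add: abs_le_iff)
    show "(Im (f (cl y)) + 2 * y) - (Im (f (cl x)) + 2 * x) \<le> 3 * (y - x)"
      using re(2)[OF xy] by (simp add: abs_le_iff)
  qed auto
  define \<zeta>0 where "\<zeta>0 s = (g1 s - 2) *\<^sub>R (1::complex) + (g2 s - 2) *\<^sub>R \<i>" for s
  have meas[measurable]: "\<zeta>0 \<in> borel_measurable borel" unfolding \<zeta>0_def using g1(1) g2(1) by measurable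
  have abs: "\<zeta>0 absolutely_integrable_on {x..y}" for x y
  proof (cases "x \<le> y")
    case True
    have "g1 absolutely_integrable_on {x..y}" "g2 absolutely_integrable_on {x..y}"
      using g1(3)[OF True] g2(3)[OF True] g1(2) g2(2)
      by (auto intro!: nonnegative_absolutely_integrable_1 simp: has_integral_integrable_integral)
    then show ?thesis unfolding \<zeta>0_def
      by (intro set_integral_add absolutely_integrable_scaleR_right set_integral_diff absolutely_integrable_scaleR_left) auto
  qed simp
  have \<zeta>0: "(\<zeta>0 has_integral f s' - f s) {s..s'}" if s: "0 \<le> s" "s \<le> s'" "s' \<le> T" for s s'
  proof -
    have c: "((\<lambda>_. 2::real) has_integral 2 * (s' - s)) {s..s'}"
      using has_integral_const_real[of "2::real" s s'] s by (simp add: mult.commute)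
    have "(\<zeta>0 has_integral
       ((Re (f (cl s')) + 2 * s') - (Re (f (cl s)) + 2 * s) - 2 * (s' - s)) *\<^sub>R (1::complex) +
       ((Im (f (cl s')) + 2 * s') - (Im (f (cl s)) + 2 * s) - 2 * (s' - s)) *\<^sub>R \<i>) {s..s'}"
      unfolding \<zeta>0_def
      by (intro has_integral_add has_integral_scaleR_left has_integral_diff g1(3) g2(3) s(2) c)
    moreover have "cl s = s" "cl s' = s'" using cl_id s by auto
    moreover have "((Re (f s') + 2 * s') - (Re (f s) + 2 * s) - 2 * (s' - s)) *\<^sub>R (1::complex) +
       ((Im (f s') + 2 * s') - (Im (f s) + 2 * s) - 2 * (s' - s)) *\<^sub>R \<i> = f s' - f s"
      by (simp add: complex_eq_iff)
    ultimately show ?thesis by simp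
  qed
  have norm_int: "(\<lambda>x. norm (\<zeta>0 x)) integrable_on {x..y}" for x y
    using abs unfolding absolutely_integrable_on_def by blast
  have le: "integral {x..y} (\<lambda>s. norm (\<zeta>0 s)) \<le> y - x" if "0 \<le> x" "x \<le> y" "y \<le> T" for x y
  proof (rule integral_norm_le_if_increments_le[OF that(2) _ norm_int])
    show "\<zeta>0 integrable_on {x..y}" using \<zeta>0[OF that] by blast
    fix u v assume "x \<le> u" "u \<le> v" "v \<le> y"
    then have "0 \<le> u" "u \<le> v" "v \<le> T" using that by auto
    from integral_unique[OF \<zeta>0[OF this]] f[OF this] show "norm (integral {u..v} \<zeta>0) \<le> v - u" by simp
  qed
  \<comment> \<open>All integrals of \<open>h\<close> over subintervals are nonnegative. Applied to
    \<open>h\<close>, the lemma \<open>integral_norm_le_if_increments_le\<close> bounds the integral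
    of \<open>|h|\<close> by that of \<open>h\<close>, so \<open>h\<close> is nonnegative almost
    everywhere.\<close>
  define h where "h s = 1 - norm (\<zeta>0 s)" for s
  have h_int: "h integrable_on {x..y}" for x y unfolding h_def by (intro integrable_diff norm_int) auto
  have h_nonneg: "integral {x..y} h \<ge> 0" if "0 \<le> x" "x \<le> y" "y \<le> T" for x y
  proof -
    have "integral {x..y} h = (y - x) - integral {x..y} (\<lambda>s. norm (\<zeta>0 s))"
      unfolding h_def using norm_int that by (subst integral_diff) auto
    then show ?thesis using le[OF that] by simp
  qed
  have abs_h: "(\<lambda>s. norm (h s)) integrable_on {0..T}"
  proof -
    have "h absolutely_integrable_on {0..T}"
      unfolding h_def by (intro set_integral_diff absolutely_integrable_norm[unfolded o_def] abs) auto
    then show ?thesis unfolding absolutely_integrable_on_def by blast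
  qed
  have "integral {0..T} (\<lambda>s. norm (h s)) \<le> integral {0..T} h - integral {0..0} h"
  proof (rule integral_norm_le_if_increments_le[OF T h_int abs_h])
    fix u v assume uv: "0 \<le> u" "u \<le> v" "v \<le> T"
    have "integral {0..u} h + integral {u..v} h = integral {0..v} h"
      using uv by (intro Henstock_Kurzweil_Integration.integral_combine h_int) auto
    then show "norm (integral {u..v} h) \<le> integral {0..v} h - integral {0..u} h"
      using h_nonneg[OF uv] by simp
  qed
  moreover have "integral {0..T} (\<lambda>s. norm (h s) - h s) = integral {0..T} (\<lambda>s. norm (h s)) - integral {0..T} h"
    by (intro integral_diff abs_h h_int)
  moreover have "integral {0..T} (\<lambda>s. norm (h s) - h s) \<ge> 0"
    by (intro integral_nonneg integrable_diff abs_h h_int) auto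
  ultimately have "integral {0..T} (\<lambda>s. norm (h s) - h s) = 0" by simp
  moreover have "(\<lambda>s. norm (h s) - h s) integrable_on {0..T}" by (intro integrable_diff abs_h h_int)
  ultimately have "((\<lambda>s. norm (h s) - h s) has_integral 0) {0..T}"
    by (simp add: has_integral_iff)
  then have "AE s in lborel. s \<in> {0..T} \<longrightarrow> norm (h s) - h s = 0"
    by (intro AE_eq_0_if_integral_0) (auto simp: h_def)
  then have ae: "AE s in lborel. s \<in> {0..T} \<longrightarrow> norm (\<zeta>0 s) \<le> 1"
    by eventually_elim (auto simp: h_def)
  define \<zeta> where "\<zeta> s = (if norm (\<zeta>0 s) \<le> 1 then \<zeta>0 s else 0)" for s
  show thesis
  proof (rule that[of \<zeta>])
    show "\<zeta> \<in> borel_measurable borel" unfolding \<zeta>_def by measurable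
    show "norm (\<zeta> s) \<le> 1" for s by (simp add: \<zeta>_def)
    fix s s' assume s: "0 \<le> s" "s \<le> s'" "s' \<le> T"
    have "AE x in lborel. x \<in> {s..s'} \<longrightarrow> \<zeta>0 x = \<zeta> x"
      using ae by eventually_elim (use s in \<open>auto simp: \<zeta>_def\<close>)
    from has_integral_AE[OF this] \<zeta>0[OF s] show "(\<zeta> has_integral f s' - f s) {s..s'}" by blast
  qed
qed

text \<open>The bound makes the derivative zero at every point, with no exceptional null set. This
  is what replaces almost-everywhere differentiation in the equations of the frame.\<close>

lemma constant_if_quadratic_increments:
  fixes F :: "real \<Rightarrow> 'a::real_normed_vector"
  assumes F: "\<And>s s'. \<lbrakk>0 \<le> s; s \<le> s'; s' \<le> T\<rbrakk> \<Longrightarrow> norm (F s' - F s) \<le> C * (s' - s)\<^sup>2"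
    and s: "0 \<le> s" "s \<le> T"
  shows "F s = F 0"
proof -
  have C: "norm (F y - F x) \<le> \<bar>C\<bar> * \<bar>y - x\<bar>\<^sup>2" if "x \<in> {0..T}" "y \<in> {0..T}" for x y
  proof -
    have *: "norm (F v - F u) \<le> \<bar>C\<bar> * \<bar>v - u\<bar>\<^sup>2" if "0 \<le> u" "u \<le> v" "v \<le> T" for u v
      by (rule order_trans[OF F[OF that]]) (simp add: mult_right_mono)
    show ?thesis
    proof (cases "x \<le> y")
      case True then show ?thesis using that by (intro *) auto
    next
      case False
      then have "norm (F x - F y) \<le> \<bar>C\<bar> * \<bar>x - y\<bar>\<^sup>2" using that by (intro *) auto
      then show ?thesis by (simp add: norm_minus_commute power2_commute)
    qed
  qed
  have "(F has_derivative (\<lambda>_. 0)) (at x within {0..T})" if x: "x \<in> {0..T}" for x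
    unfolding has_derivative_within_alt
  proof (intro conjI bounded_linear_zero allI impI)
    fix e :: real assume "e > 0"
    show "\<exists>d>0. \<forall>y\<in>{0..T}. norm (y - x) < d \<longrightarrow> norm (F y - F x - 0) \<le> e * norm (y - x)"
    proof (intro exI[of _ "e / (\<bar>C\<bar> + 1)"] conjI ballI impI)
      show "e / (\<bar>C\<bar> + 1) > 0" using \<open>e > 0\<close> by simp
      fix y assume y: "y \<in> {0..T}" "norm (y - x) < e / (\<bar>C\<bar> + 1)"
      have "\<bar>C\<bar> * \<bar>y - x\<bar> \<le> (\<bar>C\<bar> + 1) * \<bar>y - x\<bar>" by (intro mult_right_mono) auto
      also have "\<dots> \<le> e" using y(2) by (simp add: field_simps)
      finally have "\<bar>C\<bar> * \<bar>y - x\<bar> * \<bar>y - x\<bar> \<le> e * \<bar>y - x\<bar>" by (rule mult_right_mono) simp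
      moreover have "\<bar>C\<bar> * \<bar>y - x\<bar>\<^sup>2 = \<bar>C\<bar> * \<bar>y - x\<bar> * \<bar>y - x\<bar>" by (simp only: power2_eq_square mult.assoc)
      ultimately have "norm (F y - F x) \<le> e * \<bar>y - x\<bar>" using C[OF x y(1)] by linarith
      then show "norm (F y - F x - 0) \<le> e * norm (y - x)" by simp
    qed
  qed
  then have "\<exists>c. \<forall>x\<in>{0..T}. F x = c"
    by (intro has_derivative_zero_constant) auto
  then obtain c where c: "\<forall>x\<in>{0..T}. F x = c" ..
  have "s \<in> {0..T}" "0 \<in> {0..T}" using s by auto
  then show ?thesis using c by simp
qed

lemma orthonormal_expansion:
  fixes z e :: complex
  assumes "norm e = 1"
  shows "z = (z \<bullet> e) *\<^sub>R e + (z \<bullet> (\<i> * e)) *\<^sub>R (\<i> * e)"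
proof -
  have e: "Re e * Re e + Im e * Im e = 1"
    using assms by (simp add: cmod_def real_sqrt_eq_1_iff power2_eq_square)
  have "Re z * (Re e * Re e + Im e * Im e) = Re z" "Im z * (Re e * Re e + Im e * Im e) = Im z" by (simp_all add: e)
  then show ?thesis by (simp add: complex_eq_iff inner_complex_def algebra_simps)
qed

lemma projection_diff_le:
  fixes z e e' :: complex
  assumes "norm e = 1" "norm e' = 1" "norm z \<le> 1"
  shows "norm ((z \<bullet> e') *\<^sub>R e' - (z \<bullet> e) *\<^sub>R e) \<le> 2 * norm (e' - e)"
proof -
  have "(z \<bullet> e') *\<^sub>R e' - (z \<bullet> e) *\<^sub>R e = (z \<bullet> e') *\<^sub>R (e' - e) + (z \<bullet> (e' - e)) *\<^sub>R e"
    by (simp add: algebra_simps inner_diff_right)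
  then have "norm ((z \<bullet> e') *\<^sub>R e' - (z \<bullet> e) *\<^sub>R e) \<le> \<bar>z \<bullet> e'\<bar> * norm (e' - e) + \<bar>z \<bullet> (e' - e)\<bar> * norm e"
    using norm_triangle_ineq[of "(z \<bullet> e') *\<^sub>R (e' - e)" "(z \<bullet> (e' - e)) *\<^sub>R e"] by simp
  also have "\<dots> \<le> 1 * norm (e' - e) + norm (e' - e) * 1"
  proof (intro add_mono mult_mono)
    show "\<bar>z \<bullet> e'\<bar> \<le> 1" using Cauchy_Schwarz_ineq2[of z e'] assms by simp
    show "\<bar>z \<bullet> (e' - e)\<bar> \<le> norm (e' - e)"
      using order_trans[OF Cauchy_Schwarz_ineq2 mult_right_mono[OF assms(3) norm_ge_zero[of "e' - e"]]] by simp
  qed (use assms in auto)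
  finally show ?thesis by simp
qed

lemma norm_diff_diff_le:
  fixes x y z :: "'a::real_normed_vector"
  shows "norm (x - y - z) \<le> norm x + norm y + norm z"
  by (rule order_trans[OF norm_triangle_ineq4 add_right_mono[OF norm_triangle_ineq4]])

section \<open>Frame and velocity along the front arc length\<close>

text \<open>In the basis \<open>e\<close>, \<open>\<i> * e\<close> the front velocity is
  \<open>(V, l * \<omega>)\<close>. The length is bounded by a quadratic integral instead of the
  integral of a square root: it can be expanded exactly under a variation, and nothing is lost at
  unit speed. Continuity of \<open>V\<close> makes the no-skid condition hold at every time.\<close>

lemma competitor_bicycle_path:
  fixes e :: "real \<Rightarrow> complex" and \<omega> V :: "real \<Rightarrow> real"
  assumes T: "T \<ge> 0" and l: "l > 0"
    and e: "\<And>s. norm (e s) = 1" "continuous_on {0..T} e"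
    and V: "continuous_on {0..T} V"
    and \<omega>: "\<omega> \<in> borel_measurable borel" "\<And>s. \<bar>\<omega> s\<bar> \<le> B"
    and inc: "\<And>s s'. \<lbrakk>0 \<le> s; s \<le> s'; s' \<le> T\<rbrakk> \<Longrightarrow> ((\<lambda>r. \<omega> r *\<^sub>R (\<i> * e r)) has_integral e s' - e s) {s..s'}"
    and b: "\<And>s. b s = b0 + integral {0..s} (\<lambda>r. V r *\<^sub>R e r)"
  shows "bicycle_path l 0 T (\<lambda>s. (b s, b s + l *\<^sub>R e s))"
    and "curve_length 0 T (front_track (\<lambda>s. (b s, b s + l *\<^sub>R e s))) \<le>
       ennreal (integral {0..T} (\<lambda>s. (1 + (V s)\<^sup>2 + (l * \<omega> s)\<^sup>2) / 2))"
proof -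
  have Ve: "continuous_on {0..T} (\<lambda>r. V r *\<^sub>R e r)" by (intro continuous_intros e V)
  have binc: "((\<lambda>r. V r *\<^sub>R e r) has_integral b s' - b s) {s..s'}" if "0 \<le> s" "s \<le> s'" "s' \<le> T" for s s'
  proof -
    have int: "(\<lambda>r. V r *\<^sub>R e r) integrable_on {x..y}" if "0 \<le> x" "y \<le> T" for x y
      by (rule integrable_continuous_real[OF continuous_on_subset[OF Ve]]) (use that in auto)
    have i: "integral {0..s} (\<lambda>r. V r *\<^sub>R e r) + integral {s..s'} (\<lambda>r. V r *\<^sub>R e r) = integral {0..s'} (\<lambda>r. V r *\<^sub>R e r)"
      using that by (intro Henstock_Kurzweil_Integration.integral_combine int) auto
    then have "b s' - b s = integral {s..s'} (\<lambda>r. V r *\<^sub>R e r)" by (simp add: b i[symmetric])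
    then show ?thesis using int that by (simp add: has_integral_integral)
  qed
  define f where "f s = b s + l *\<^sub>R e s" for s
  have finc: "((\<lambda>r. V r *\<^sub>R e r + (l * \<omega> r) *\<^sub>R (\<i> * e r)) has_integral f s' - f s) {s..s'}"
    if "0 \<le> s" "s \<le> s'" "s' \<le> T" for s s'
    using has_integral_add[OF binc[OF that] has_integral_cmul[OF inc[OF that], of l]]
    by (simp add: f_def algebra_simps)
  define \<rho> where "\<rho> s = (1 + (V s)\<^sup>2 + (l * \<omega> s)\<^sup>2) / 2" for s
  have norm_le: "norm (V r *\<^sub>R e r + (l * \<omega> r) *\<^sub>R (\<i> * e r)) \<le> \<rho> r" for r
  proof -
    have "V r *\<^sub>R e r + (l * \<omega> r) *\<^sub>R (\<i> * e r) = Complex (V r) (l * \<omega> r) * e r"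
      by (simp add: complex_eq_iff algebra_simps)
    then have n: "norm (V r *\<^sub>R e r + (l * \<omega> r) *\<^sub>R (\<i> * e r)) = sqrt ((V r)\<^sup>2 + (l * \<omega> r)\<^sup>2)"
      unfolding \<open>V r *\<^sub>R e r + (l * \<omega> r) *\<^sub>R (\<i> * e r) = Complex (V r) (l * \<omega> r) * e r\<close> norm_mult e
      by (simp add: cmod_def)
    \<comment> \<open>The inequality of arithmetic and geometric mean for 1 and \<open>x\<close>,
      with equality at \<open>x = 1\<close>.\<close>
    have "sqrt x \<le> (1 + x) / 2" if "x \<ge> 0" for x
      using arith_geo_mean_sqrt[of 1 x] that by simp
    from this[of "(V r)\<^sup>2 + (l * \<omega> r)\<^sup>2"] show ?thesis unfolding n \<rho>_def by (simp add: add.assoc)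
  qed
  have \<rho>_int: "\<rho> integrable_on {0..T}"
  proof -
    have "(\<lambda>s. (l * \<omega> s)\<^sup>2) absolutely_integrable_on {0..T}"
    proof (rule bounded_borel_absolutely_integrable)
      show "(\<lambda>s. (l * \<omega> s)\<^sup>2) \<in> borel_measurable borel" using \<omega>(1) by measurable
      show "norm ((l * \<omega> s)\<^sup>2) \<le> (l * B)\<^sup>2" for s
        using \<omega>(2)[of s] l by (simp add: power_mult_distrib mult_left_mono power2_le_iff_abs_le abs_le_iff)
    qed
    then have A: "(\<lambda>s. (l * \<omega> s)\<^sup>2) integrable_on {0..T}" unfolding absolutely_integrable_on_def by blast
    have B: "(\<lambda>s. 1 + (V s)\<^sup>2) integrable_on {0..T}"
      by (intro integrable_continuous_real continuous_intros V)
    show ?thesis using integrable_cmul[OF integrable_add[OF B A], of "1 / 2"] by (simp add: \<rho>_def[abs_def])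
  qed
  have \<rho>_int': "\<rho> integrable_on {s..s'}" if "0 \<le> s" "s' \<le> T" for s s'
    by (rule integrable_on_subinterval[OF \<rho>_int]) (use that in auto)
  have fle: "dist (f s) (f s') \<le> integral {s..s'} \<rho>" if "0 \<le> s" "s \<le> s'" "s' \<le> T" for s s'
  proof -
    have "norm (integral {s..s'} (\<lambda>r. V r *\<^sub>R e r + (l * \<omega> r) *\<^sub>R (\<i> * e r))) \<le> integral {s..s'} \<rho>"
      by (rule integral_norm_bound_integral[OF has_integral_integrable[OF finc[OF that]] \<rho>_int'[OF that(1,3)] norm_le])
    then have "norm (f s' - f s) \<le> integral {s..s'} \<rho>" by (simp only: integral_unique[OF finc[OF that]])
    then show ?thesis by (simp add: dist_norm norm_minus_commute)
  qed
  obtain BV where BV: "\<forall>s\<in>{0..T}. norm (V s) \<le> BV"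
    using compact_imp_bounded[OF compact_continuous_image[OF V compact_Icc]] by (auto simp: bounded_iff)
  have BV0: "BV \<ge> 0" using order_trans[OF norm_ge_zero bspec[OF BV, of 0]] T by simp
  have B0: "B \<ge> 0" using \<omega>(2)[of 0] by simp
  define C where "C = 2 * BV + l * B"
  have lip: "dist (b s, f s) (b s', f s') \<le> C * \<bar>s - s'\<bar>" if "s \<in> {0..T}" "s' \<in> {0..T}" "s \<le> s'" for s s'
  proof -
    have s: "0 \<le> s" "s \<le> s'" "s' \<le> T" using that by auto
    have 1: "norm (b s' - b s) \<le> BV * (s' - s)"
      using has_integral_bound[where a = s and b = s', unfolded box_real, OF BV0 binc[OF s]] s BV by (auto simp: e)
    have 2: "norm (e s' - e s) \<le> B * (s' - s)"
      using has_integral_bound[where a = s and b = s', unfolded box_real, OF B0 inc[OF s]] s \<omega>(2) by (auto simp: e norm_mult)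
    have "dist (b s, f s) (b s', f s') \<le> dist (b s) (b s') + dist (f s) (f s')"
      by (simp add: dist_Pair_Pair sqrt_sum_squares_le_sum)
    also have "\<dots> = norm (b s' - b s) + norm ((b s' - b s) + l *\<^sub>R (e s' - e s))"
      by (simp add: dist_norm norm_minus_commute f_def algebra_simps)
    also have "\<dots> \<le> norm (b s' - b s) + (norm (b s' - b s) + l * norm (e s' - e s))"
      using norm_triangle_ineq[of "b s' - b s" "l *\<^sub>R (e s' - e s)"] l by simp
    also have "\<dots> \<le> C * (s' - s)"
      using 1 mult_left_mono[OF 2, of l] l by (simp add: C_def algebra_simps)
    finally show ?thesis using s by simp
  qed
  show "bicycle_path l 0 T (\<lambda>s. (b s, b s + l *\<^sub>R e s))"
    unfolding bicycle_path_def f_def[symmetric]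
  proof (intro conjI T ballI)
    show "abs_continuous_on_interval 0 T (\<lambda>s. (b s, f s))"
    proof (rule lipschitz_imp_abs_continuous)
      fix x y assume xy: "x \<in> {0..T}" "y \<in> {0..T}"
      show "dist (b x, f x) (b y, f y) \<le> C * \<bar>x - y\<bar>"
      proof (cases "x \<le> y")
        case True then show ?thesis using lip xy by blast
      next
        case False then show ?thesis using lip[of y x] xy by (simp add: dist_commute abs_minus_commute)
      qed
    qed
    show "(b t, f t) \<in> bicycle_space l" for t using l e by (simp add: bicycle_space_def f_def)
    have "\<exists>c. (b has_vector_derivative c *\<^sub>R (f t - b t)) (at t within {0..T})" if t: "t \<in> {0..T}" for t
    proof -
      have "((\<lambda>s. b0 + integral {0..s} (\<lambda>r. V r *\<^sub>R e r)) has_vector_derivative 0 + V t *\<^sub>R e t) (at t within {0..T})"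
        by (intro has_vector_derivative_add has_vector_derivative_const integral_has_vector_derivative[OF Ve t])
      then have "(b has_vector_derivative V t *\<^sub>R e t) (at t within {0..T})"
        unfolding b[abs_def, symmetric] by simp
      moreover have "V t *\<^sub>R e t = (V t / l) *\<^sub>R (f t - b t)" using l by (simp add: f_def)
      ultimately show ?thesis by (intro exI[of _ "V t / l"]) simp
    qed
    then show "AE t in lebesgue_on {0..T}. \<exists>c. ((\<lambda>s. fst (b s, f s)) has_vector_derivative c *\<^sub>R (snd (b t, f t) - fst (b t, f t))) (at t within {0..T})"
      by (auto intro!: AE_I2)
  qed
  show "curve_length 0 T (front_track (\<lambda>s. (b s, b s + l *\<^sub>R e s))) \<le>
       ennreal (integral {0..T} (\<lambda>s. (1 + (V s)\<^sup>2 + (l * \<omega> s)\<^sup>2) / 2))"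
    unfolding \<rho>_def[symmetric] f_def[symmetric] front_track_def snd_conv curve_length_def
  proof (rule SUP_least, clarify)
    fix D assume D: "D division_of {0..T}"
    have "(\<Sum>k\<in>D. ennreal (dist (f (Inf k)) (f (Sup k)))) \<le> (\<Sum>k\<in>D. ennreal (integral k \<rho>))"
    proof (rule sum_mono)
      fix k assume k: "k \<in> D"
      obtain u v where uv: "k = {u..v}" "u \<le> v" "Inf k = u" "Sup k = v"
        using division_nonempty_interval[OF D k] .
      have "{u..v} \<subseteq> {0..T}" using division_ofD(2)[OF D k] uv by simp
      then show "ennreal (dist (f (Inf k)) (f (Sup k))) \<le> ennreal (integral k \<rho>)"
        unfolding uv(3,4) unfolding uv(1) using uv(2) by (intro ennreal_leI fle) auto
    qed
    also have "\<dots> = ennreal (\<Sum>k\<in>D. integral k \<rho>)"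
    proof (rule sum_ennreal)
      fix k assume k: "k \<in> D"
      obtain u v where uv: "k = {u..v}" "u \<le> v" "Inf k = u" "Sup k = v"
        using division_nonempty_interval[OF D k] .
      have "{u..v} \<subseteq> {0..T}" using division_ofD(2)[OF D k] uv by simp
      then have "\<rho> integrable_on {u..v}" using uv(2) by (intro \<rho>_int') auto
      then show "0 \<le> integral k \<rho>" unfolding uv(1) by (rule integral_nonneg) (simp add: \<rho>_def)
    qed
    also have "(\<Sum>k\<in>D. integral k \<rho>) = integral {0..T} \<rho>"
      by (rule integral_combine_division_topdown[OF \<rho>_int D, symmetric])
    finally show "(\<Sum>k\<in>D. ennreal (dist (f (Inf k)) (f (Sup k)))) \<le> ennreal (integral {0..T} \<rho>)" .
  qed
qed

text \<open>\<open>\<zeta>\<close> is a density of the front and plays the part of its velocity;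
  \<open>transversal_le\<close> is the no-skid condition.\<close>

locale unit_speed_bicycle =
  fixes l T :: real and b f \<zeta> :: "real \<Rightarrow> complex"
  assumes l_pos: "l > 0" and T_pos: "T > 0"
    and norm_frame: "\<And>s. s \<in> {0..T} \<Longrightarrow> norm (f s - b s) = l"
    and front_le: "\<And>s s'. \<lbrakk>0 \<le> s; s \<le> s'; s' \<le> T\<rbrakk> \<Longrightarrow> norm (f s' - f s) \<le> s' - s"
    and back_le: "\<And>s s'. \<lbrakk>0 \<le> s; s \<le> s'; s' \<le> T\<rbrakk> \<Longrightarrow> norm (b s' - b s) \<le> s' - s"
    and transversal_le: "\<And>s s'. \<lbrakk>0 \<le> s; s \<le> s'; s' \<le> T\<rbrakk> \<Longrightarrow>
        \<bar>(b s' - b s) \<bullet> (\<i> * (f s - b s))\<bar> \<le> 2 * (s' - s)\<^sup>2"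
    and \<zeta>_meas[measurable]: "\<zeta> \<in> borel_measurable borel" and \<zeta>_le: "\<And>s. norm (\<zeta> s) \<le> 1"
    and \<zeta>_int: "\<And>s s'. \<lbrakk>0 \<le> s; s \<le> s'; s' \<le> T\<rbrakk> \<Longrightarrow> (\<zeta> has_integral f s' - f s) {s..s'}"
begin

text \<open>The direction of the frame is continued constantly outside \<open>{0..T}\<close>, to get a continuous and hence
  Borel measurable function on the whole line.\<close>

definition e where "e s = (let t = max 0 (min T s) in (1 / l) *\<^sub>R (f t - b t))"
definition v where "v s = \<zeta> s \<bullet> e s"
definition w where "w s = \<zeta> s \<bullet> (\<i> * e s)"

lemma e_eq: "s \<in> {0..T} \<Longrightarrow> e s = (1 / l) *\<^sub>R (f s - b s)"
  by (auto simp: e_def Let_def)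

lemma f_eq: "s \<in> {0..T} \<Longrightarrow> f s = b s + l *\<^sub>R e s"
  using l_pos by (simp add: e_eq)

lemma norm_e [simp]: "norm (e s) = 1"
proof -
  have "max 0 (min T s) \<in> {0..T}" using T_pos by auto
  then show ?thesis unfolding e_def Let_def using norm_frame l_pos by simp
qed

lemma norm_ie [simp]: "norm (\<i> * e s) = 1" by (simp add: norm_mult)

lemma e_le: "\<lbrakk>0 \<le> s; s \<le> s'; s' \<le> T\<rbrakk> \<Longrightarrow> norm (e s' - e s) \<le> 2 / l * (s' - s)"
proof -
  assume s: "0 \<le> s" "s \<le> s'" "s' \<le> T"
  have "e s' - e s = (1 / l) *\<^sub>R ((f s' - f s) - (b s' - b s))"
    using s by (simp add: e_eq algebra_simps)
  then have "norm (e s' - e s) = (1 / l) * norm ((f s' - f s) - (b s' - b s))" using l_pos by simp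
  also have "\<dots> \<le> (1 / l) * (2 * (s' - s))"
    using norm_triangle_ineq4[of "f s' - f s" "b s' - b s"] front_le[OF s] back_le[OF s] l_pos
    by (intro mult_left_mono) auto
  finally show ?thesis by simp
qed

lemma continuous_e: "continuous_on UNIV e"
proof (rule lipschitz_on_continuous_on[of "2 / l"], rule lipschitz_onI)
  have *: "dist (e x) (e y) \<le> 2 / l * dist x y" if "x \<le> y" for x y
  proof -
    let ?c = "\<lambda>x. max 0 (min T x)"
    have "?c (?c z) = ?c z" for z using T_pos by auto
    then have "e x = e (?c x)" "e y = e (?c y)" by (simp_all only: e_def Let_def)
    moreover have "norm (e (?c y) - e (?c x)) \<le> 2 / l * (?c y - ?c x)"
      using that T_pos by (intro e_le) auto
    moreover have "\<dots> \<le> 2 / l * (y - x)" using that l_pos by (intro mult_left_mono) auto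
    ultimately show ?thesis using that by (simp add: dist_norm norm_minus_commute dist_real_def)
  qed
  fix x y show "dist (e x) (e y) \<le> 2 / l * dist x y"
    using *[of x y] *[of y x] by (cases "x \<le> y") (simp_all add: dist_commute)
qed (use l_pos in simp)

lemma continuous_on_e [continuous_intros]: "continuous_on S e"
  using continuous_e by (rule continuous_on_subset) simp

lemma e_meas [measurable]: "e \<in> borel_measurable borel"
  using continuous_e by (rule borel_measurable_continuous_onI)

lemma v_meas [measurable]: "v \<in> borel_measurable borel" unfolding v_def by measurable

lemma w_meas [measurable]: "w \<in> borel_measurable borel" unfolding w_def by measurable

lemma abs_v: "\<bar>v s\<bar> \<le> 1"
  using Cauchy_Schwarz_ineq2[of "\<zeta> s" "e s"] \<zeta>_le[of s] by (simp add: v_def)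

lemma abs_w: "\<bar>w s\<bar> \<le> 1"
  using Cauchy_Schwarz_ineq2[of "\<zeta> s" "\<i> * e s"] \<zeta>_le[of s] by (simp add: w_def)

lemma v2_w2: "(v s)\<^sup>2 + (w s)\<^sup>2 \<le> 1"
proof -
  have "(norm (\<zeta> s))\<^sup>2 = (v s)\<^sup>2 + (w s)\<^sup>2"
  proof -
    have "Re (e s) * Re (e s) + Im (e s) * Im (e s) = 1"
      using norm_e[of s] by (simp add: cmod_def real_sqrt_eq_1_iff power2_eq_square)
    then have "((Re (\<zeta> s))\<^sup>2 + (Im (\<zeta> s))\<^sup>2) * (Re (e s) * Re (e s) + Im (e s) * Im (e s)) = (Re (\<zeta> s))\<^sup>2 + (Im (\<zeta> s))\<^sup>2" by simp
    then show ?thesis unfolding cmod_power2 v_def w_def by (simp add: inner_complex_def power2_eq_square algebra_simps)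
  qed
  moreover have "(norm (\<zeta> s))\<^sup>2 \<le> 1" using \<zeta>_le[of s] by (simp add: power_le_one)
  ultimately show ?thesis by simp
qed

lemma bounded_integrable:
  fixes g :: "real \<Rightarrow> 'a::euclidean_space"
  assumes "g \<in> borel_measurable borel" "\<And>s. norm (g s) \<le> B"
  shows "g integrable_on {x..y}"
  using bounded_borel_absolutely_integrable[OF assms] unfolding absolutely_integrable_on_def by blast

text \<open>For unit vectors \<open>(e s' - e s) \<bullet> e s\<close> is minus half the squared
  distance. So up to second order the frame direction moves across itself, and the back wheel moves
  along the frame.\<close>

lemma increments_near_s:
  assumes s: "0 \<le> s" "s \<le> s'" "s' \<le> T"
  shows "\<bar>(e s' - e s) \<bullet> e s\<bar> \<le> 2 / l\<^sup>2 * (s' - s)\<^sup>2"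
    and "\<bar>(b s' - b s) \<bullet> (\<i> * e s)\<bar> \<le> 2 / l * (s' - s)\<^sup>2"
proof -
  have ee: "e r \<bullet> e r = 1" for r by (simp add: dot_square_norm)
  have "(norm (e s' - e s))\<^sup>2 = 2 - 2 * (e s' \<bullet> e s)"
    unfolding power2_norm_eq_inner by (simp add: inner_diff_left inner_diff_right inner_commute[of "e s" "e s'"] ee)
  then have "(e s' - e s) \<bullet> e s = - (norm (e s' - e s))\<^sup>2 / 2"
    by (simp add: inner_diff_left ee)
  moreover have "(norm (e s' - e s))\<^sup>2 \<le> (2 / l * (s' - s))\<^sup>2" using e_le[OF s] by (intro power_mono) auto
  moreover have "(2 / l * (s' - s))\<^sup>2 = 2 * (2 / l\<^sup>2 * (s' - s)\<^sup>2)"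
    by (simp only: power_mult_distrib power_divide) simp
  moreover have "0 \<le> (norm (e s' - e s))\<^sup>2" by simp
  ultimately show "\<bar>(e s' - e s) \<bullet> e s\<bar> \<le> 2 / l\<^sup>2 * (s' - s)\<^sup>2"
    by linarith
  have "(b s' - b s) \<bullet> (\<i> * e s) = (1 / l) * ((b s' - b s) \<bullet> (\<i> * (f s - b s)))"
    using s by (simp add: e_eq)
  then have "\<bar>(b s' - b s) \<bullet> (\<i> * e s)\<bar> = (1 / l) * \<bar>(b s' - b s) \<bullet> (\<i> * (f s - b s))\<bar>"
    using l_pos by (simp add: abs_mult)
  also have "\<dots> \<le> (1 / l) * (2 * (s' - s)\<^sup>2)" using transversal_le[OF s] l_pos by (intro mult_left_mono) auto
  finally show "\<bar>(b s' - b s) \<bullet> (\<i> * e s)\<bar> \<le> 2 / l * (s' - s)\<^sup>2" by simp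
qed

text \<open>Freezing the direction at \<open>s\<close> turns the integral into a projection of the
  front increment, and meanwhile the frame turns only by the order of \<open>s' - s\<close>. The
  factor \<open>c\<close> is 1 for the back speed and \<open>\<i>\<close> for the turning
  rate.\<close>

lemma projection_integral_near_s:
  assumes s: "0 \<le> s" "s \<le> s'" "s' \<le> T" and c: "norm c = 1"
  shows "norm (integral {s..s'} (\<lambda>r. (\<zeta> r \<bullet> (c * e r)) *\<^sub>R (c * e r)) - ((f s' - f s) \<bullet> (c * e s)) *\<^sub>R (c * e s))
     \<le> 4 / l * (s' - s)\<^sup>2"
proof -
  have nc: "norm (c * e r) = 1" for r using c by (simp add: norm_mult)
  have le1: "\<bar>\<zeta> r \<bullet> (c * e r')\<bar> \<le> 1" for r r'
    using Cauchy_Schwarz_ineq2[of "\<zeta> r" "c * e r'"] \<zeta>_le[of r] nc by simp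
  have i1: "(\<lambda>r. (\<zeta> r \<bullet> (c * e r)) *\<^sub>R (c * e r)) integrable_on {s..s'}"
    by (rule bounded_integrable[where B = 1]) (use le1 nc in auto)
  have i2: "((\<lambda>r. (\<zeta> r \<bullet> (c * e s)) *\<^sub>R (c * e s)) has_integral ((f s' - f s) \<bullet> (c * e s)) *\<^sub>R (c * e s)) {s..s'}"
    by (intro has_integral_scaleR_left has_integral_linear[OF \<zeta>_int bounded_linear_inner_left, unfolded o_def] s)
  have d: "((\<lambda>r. (\<zeta> r \<bullet> (c * e r)) *\<^sub>R (c * e r) - (\<zeta> r \<bullet> (c * e s)) *\<^sub>R (c * e s)) has_integral
    integral {s..s'} (\<lambda>r. (\<zeta> r \<bullet> (c * e r)) *\<^sub>R (c * e r)) - ((f s' - f s) \<bullet> (c * e s)) *\<^sub>R (c * e s)) {s..s'}"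
    by (intro has_integral_diff i2 integrable_integral i1)
  have "norm (integral {s..s'} (\<lambda>r. (\<zeta> r \<bullet> (c * e r)) *\<^sub>R (c * e r)) - ((f s' - f s) \<bullet> (c * e s)) *\<^sub>R (c * e s))
     \<le> (4 / l * (s' - s)) * measure lborel {s..s'}"
  proof (rule has_integral_bound[where a = s and b = s', unfolded box_real, OF _ d])
    show "0 \<le> 4 / l * (s' - s)" using l_pos s by simp
    fix r assume r: "r \<in> {s..s'}"
    have "norm ((\<zeta> r \<bullet> (c * e r)) *\<^sub>R (c * e r) - (\<zeta> r \<bullet> (c * e s)) *\<^sub>R (c * e s)) \<le> 2 * norm (c * e r - c * e s)"
      by (rule projection_diff_le[OF nc nc \<zeta>_le])
    also have "norm (c * e r - c * e s) = norm (e r - e s)"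
      using c by (simp add: norm_mult flip: right_diff_distrib)
    also have "\<dots> \<le> 2 / l * (r - s)" using r s by (intro e_le) auto
    also have "\<dots> \<le> 2 / l * (s' - s)" using r l_pos by (intro mult_left_mono) auto
    finally show "norm ((\<zeta> r \<bullet> (c * e r)) *\<^sub>R (c * e r) - (\<zeta> r \<bullet> (c * e s)) *\<^sub>R (c * e s)) \<le> 4 / l * (s' - s)" by simp
  qed
  moreover have "4 / l * (s' - s) * measure lborel {s..s'} = 4 / l * (s' - s)\<^sup>2"
    using s by (simp add: power2_eq_square)
  ultimately show ?thesis by (simp only:)
qed

text \<open>\<open>H\<close> minus the indefinite integral of \<open>G\<close> has quadratic
  increments, hence is constant. So an integral identity has to be checked only up to second order
  on short intervals.\<close>

lemma has_integral_if_quadratic_error: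
  fixes G H :: "real \<Rightarrow> 'a::banach"
  assumes G: "\<And>x y. G integrable_on {x..y}"
    and err: "\<And>s s'. \<lbrakk>0 \<le> s; s \<le> s'; s' \<le> T\<rbrakk> \<Longrightarrow> norm (H s' - H s - integral {s..s'} G) \<le> C * (s' - s)\<^sup>2"
    and s: "0 \<le> s" "s \<le> s'" "s' \<le> T"
  shows "(G has_integral H s' - H s) {s..s'}"
proof -
  define F where "F s = H s - integral {0..s} G" for s
  have split: "integral {0..y} G = integral {0..x} G + integral {x..y} G" if "0 \<le> x" "x \<le> y" for x y
    using Henstock_Kurzweil_Integration.integral_combine[OF that G] by simp
  have "F x = F 0" if "0 \<le> x" "x \<le> T" for x
  proof (rule constant_if_quadratic_increments[OF _ that])
    fix x y assume xy: "0 \<le> x" "x \<le> y" "y \<le> T"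
    then show "norm (F y - F x) \<le> C * (y - x)\<^sup>2"
      using err[OF xy] split[OF xy(1,2)] by (simp add: F_def algebra_simps)
  qed
  from this[of s] this[of s'] s have "H s' - H s = integral {s..s'} G"
    using split[OF s(1,2)] by (simp add: F_def diff_eq_eq)
  then show ?thesis using G by (simp add: has_integral_integral[symmetric] integrable_integral)
qed

text \<open>This is \<open>e' = (w / l) \<i> e\<close> in integrated form. In the basis at
  \<open>s\<close> the component of the increment along \<open>e s\<close> is quadratic. The other
  component is that of the front increment divided by \<open>l\<close>, because the back increment
  contributes only a quadratic term.\<close>

lemma e_has_integral:
  assumes "0 \<le> s" "s \<le> s'" "s' \<le> T"
  shows "((\<lambda>r. (w r / l) *\<^sub>R (\<i> * e r)) has_integral e s' - e s) {s..s'}"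
proof (rule has_integral_if_quadratic_error[OF _ _ assms, where C = "8 / l\<^sup>2"])
  show "(\<lambda>r. (w r / l) *\<^sub>R (\<i> * e r)) integrable_on {x..y}" for x y
  proof (rule bounded_integrable[where B = "1 / l"])
    show "norm ((w s / l) *\<^sub>R (\<i> * e s)) \<le> 1 / l" for s using abs_w[of s] l_pos by (simp add: divide_right_mono)
  qed measurable
  fix s s' assume s: "0 \<le> s" "s \<le> s'" "s' \<le> T"
  define I where "I = integral {s..s'} (\<lambda>r. (\<zeta> r \<bullet> (\<i> * e r)) *\<^sub>R (\<i> * e r))"
  have regroup: "x *\<^sub>R y + ((1 / l) * p - (1 / l) * q) *\<^sub>R z - (1 / l) *\<^sub>R I =
     x *\<^sub>R y - ((1 / l) * q) *\<^sub>R z - (1 / l) *\<^sub>R (I - p *\<^sub>R z)" for x p q and y z :: complex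
    by (simp add: algebra_simps)
  have I: "integral {s..s'} (\<lambda>r. (w r / l) *\<^sub>R (\<i> * e r)) = (1 / l) *\<^sub>R I"
    unfolding I_def integral_cmul[symmetric] by (simp add: w_def)
  have \<Delta>e: "e s' - e s = (1 / l) *\<^sub>R ((f s' - f s) - (b s' - b s))"
    using s by (simp add: e_eq algebra_simps)
  have "e s' - e s = ((e s' - e s) \<bullet> e s) *\<^sub>R e s + ((e s' - e s) \<bullet> (\<i> * e s)) *\<^sub>R (\<i> * e s)"
    by (rule orthonormal_expansion) simp
  also have "(e s' - e s) \<bullet> (\<i> * e s) = (1 / l) * ((f s' - f s) \<bullet> (\<i> * e s)) - (1 / l) * ((b s' - b s) \<bullet> (\<i> * e s))"
    unfolding \<Delta>e inner_scaleR_left inner_diff_left[of "f s' - f s"] by (rule right_diff_distrib)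
  finally have eq: "e s' - e s = ((e s' - e s) \<bullet> e s) *\<^sub>R e s + ((1 / l) * ((f s' - f s) \<bullet> (\<i> * e s))
     - (1 / l) * ((b s' - b s) \<bullet> (\<i> * e s))) *\<^sub>R (\<i> * e s)" .
  have eq2: "e s' - e s - (1 / l) *\<^sub>R I = ((e s' - e s) \<bullet> e s) *\<^sub>R e s
     - ((1 / l) * ((b s' - b s) \<bullet> (\<i> * e s))) *\<^sub>R (\<i> * e s)
     - (1 / l) *\<^sub>R (I - ((f s' - f s) \<bullet> (\<i> * e s)) *\<^sub>R (\<i> * e s))"
    by (rule trans[OF arg_cong[OF eq, where f = "\<lambda>x. x - (1 / l) *\<^sub>R I"] regroup])
  have "norm (e s' - e s - (1 / l) *\<^sub>R I) \<le> \<bar>(e s' - e s) \<bullet> e s\<bar> + (1 / l) * \<bar>(b s' - b s) \<bullet> (\<i> * e s)\<bar>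
     + (1 / l) * norm (I - ((f s' - f s) \<bullet> (\<i> * e s)) *\<^sub>R (\<i> * e s))"
    by (rule ord_eq_le_trans[OF arg_cong[OF eq2, where f = norm] order_trans[OF norm_diff_diff_le]])
      (use l_pos in \<open>simp add: abs_mult\<close>)
  also have "\<dots> \<le> 2 / l\<^sup>2 * (s' - s)\<^sup>2 + (1 / l) * (2 / l * (s' - s)\<^sup>2) + (1 / l) * (4 / l * (s' - s)\<^sup>2)"
    unfolding I_def
    by (rule add_mono[OF add_mono[OF increments_near_s(1)[OF s] mult_left_mono[OF increments_near_s(2)[OF s]]]
          mult_left_mono[OF projection_integral_near_s[OF s norm_ii]]])
      (use l_pos in auto)
  also have "\<dots> = 8 / l\<^sup>2 * (s' - s)\<^sup>2" by (simp add: power2_eq_square field_simps)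
  finally show "norm (e s' - e s - integral {s..s'} (\<lambda>r. (w r / l) *\<^sub>R (\<i> * e r))) \<le> 8 / l\<^sup>2 * (s' - s)\<^sup>2"
    unfolding I .
qed

text \<open>This is \<open>b' = v e\<close> in integrated form. The component across the frame is
  quadratic by the no-skid bound; along the frame, back and front increments differ by
  \<open>l\<close> times a quadratic component of the frame increment.\<close>

lemma b_has_integral:
  assumes "0 \<le> s" "s \<le> s'" "s' \<le> T"
  shows "((\<lambda>r. v r *\<^sub>R e r) has_integral b s' - b s) {s..s'}"
proof (rule has_integral_if_quadratic_error[OF _ _ assms, where C = "8 / l"])
  show "(\<lambda>r. v r *\<^sub>R e r) integrable_on {x..y}" for x y
  proof (rule bounded_integrable[where B = 1])
    show "norm (v s *\<^sub>R e s) \<le> 1" for s using abs_v[of s] by simp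
  qed measurable
  fix s s' assume s: "0 \<le> s" "s \<le> s'" "s' \<le> T"
  define I where "I = integral {s..s'} (\<lambda>r. (\<zeta> r \<bullet> e r) *\<^sub>R e r)"
  have regroup: "(p - q) *\<^sub>R y + x *\<^sub>R z - I = x *\<^sub>R z - q *\<^sub>R y - (I - p *\<^sub>R y)" for x p q and y z :: complex
    by (simp add: algebra_simps)
  have \<Delta>b: "b s' - b s = (f s' - f s) - l *\<^sub>R (e s' - e s)"
    using s by (simp add: f_eq algebra_simps)
  have "b s' - b s = ((b s' - b s) \<bullet> e s) *\<^sub>R e s + ((b s' - b s) \<bullet> (\<i> * e s)) *\<^sub>R (\<i> * e s)"
    by (rule orthonormal_expansion) simp
  also have "(b s' - b s) \<bullet> e s = (f s' - f s) \<bullet> e s - l * ((e s' - e s) \<bullet> e s)"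
    unfolding \<Delta>b inner_diff_left[of "f s' - f s"] inner_scaleR_left ..
  finally have eq: "b s' - b s = ((f s' - f s) \<bullet> e s - l * ((e s' - e s) \<bullet> e s)) *\<^sub>R e s
     + ((b s' - b s) \<bullet> (\<i> * e s)) *\<^sub>R (\<i> * e s)" .
  have eq2: "b s' - b s - I = ((b s' - b s) \<bullet> (\<i> * e s)) *\<^sub>R (\<i> * e s)
     - (l * ((e s' - e s) \<bullet> e s)) *\<^sub>R e s - (I - ((f s' - f s) \<bullet> e s) *\<^sub>R e s)"
    by (rule trans[OF arg_cong[OF eq, where f = "\<lambda>x. x - I"] regroup])
  have "norm (b s' - b s - I) \<le> \<bar>(b s' - b s) \<bullet> (\<i> * e s)\<bar> + l * \<bar>(e s' - e s) \<bullet> e s\<bar>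
     + norm (I - ((f s' - f s) \<bullet> e s) *\<^sub>R e s)"
    by (rule ord_eq_le_trans[OF arg_cong[OF eq2, where f = norm] order_trans[OF norm_diff_diff_le]])
      (use l_pos in \<open>simp add: abs_mult\<close>)
  also have "\<dots> \<le> 2 / l * (s' - s)\<^sup>2 + l * (2 / l\<^sup>2 * (s' - s)\<^sup>2) + 4 / l * (s' - s)\<^sup>2"
    unfolding I_def
    by (rule add_mono[OF add_mono[OF increments_near_s(2)[OF s] mult_left_mono[OF increments_near_s(1)[OF s]]]
          projection_integral_near_s[OF s norm_one, unfolded mult_1]])
      (use l_pos in auto)
  also have "\<dots> = 8 / l * (s' - s)\<^sup>2" using l_pos by (simp add: power2_eq_square field_simps)
  finally show "norm (b s' - b s - integral {s..s'} (\<lambda>r. v r *\<^sub>R e r)) \<le> 8 / l * (s' - s)\<^sup>2"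
    unfolding I_def v_def .
qed

end

text \<open>A class closed under the operations that occur in the variation, with members integrable
  on every compact interval, so that integrability side conditions are settled by closure
  rules.\<close>

definition bounded_borel :: "(real \<Rightarrow> 'a::euclidean_space) \<Rightarrow> bool" where
  "bounded_borel g \<longleftrightarrow> g \<in> borel_measurable borel \<and> (\<exists>B. \<forall>x. norm (g x) \<le> B)"

lemma bounded_borelI: "g \<in> borel_measurable borel \<Longrightarrow> (\<And>x. norm (g x) \<le> B) \<Longrightarrow> bounded_borel g"
  by (auto simp: bounded_borel_def)

lemma bounded_borelE:
  assumes "bounded_borel g"
  obtains B where "B \<ge> 0" "\<forall>x. norm (g x) \<le> B"
proof -
  from assms obtain B where B: "\<forall>x. norm (g x) \<le> B" unfolding bounded_borel_def by blast
  then have "B \<ge> 0" using order_trans[OF norm_ge_zero, of "g 0" B] by simp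
  then show thesis using B by (rule that)
qed

lemma bounded_borel_measurable: "bounded_borel g \<Longrightarrow> g \<in> borel_measurable borel"
  by (simp add: bounded_borel_def)

lemma bounded_borel_integrable: "bounded_borel g \<Longrightarrow> g integrable_on {x..y}"
  using bounded_borel_absolutely_integrable unfolding bounded_borel_def absolutely_integrable_on_def by blast

lemma bounded_borel_const: "bounded_borel (\<lambda>x. c)"
  by (rule bounded_borelI[of _ "norm c"]) auto

lemma bounded_borel_add:
  assumes "bounded_borel f" "bounded_borel g" shows "bounded_borel (\<lambda>x. f x + g x)"
proof -
  obtain B where B: "\<forall>x. norm (f x) \<le> B" using assms(1) by (rule bounded_borelE)
  obtain C where C: "\<forall>x. norm (g x) \<le> C" using assms(2) by (rule bounded_borelE)
  show ?thesis
    by (rule bounded_borelI[of _ "B + C"])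
      (use assms B C in \<open>auto simp: bounded_borel_def intro!: norm_triangle_le add_mono\<close>)
qed

lemma bounded_borel_scaleR:
  assumes "bounded_borel f" "bounded_borel g" shows "bounded_borel (\<lambda>x. f x *\<^sub>R g x)"
proof -
  obtain B where B: "B \<ge> 0" "\<forall>x. norm (f x) \<le> B" using assms(1) by (rule bounded_borelE)
  obtain C where C: "\<forall>x. norm (g x) \<le> C" using assms(2) by (rule bounded_borelE)
  have "norm (f x *\<^sub>R g x) \<le> B * C" for x using mult_mono[of "norm (f x)" B "norm (g x)" C] B C by simp
  then show ?thesis using assms by (intro bounded_borelI[of _ "B * C"]) (auto simp: bounded_borel_def)
qed

lemma bounded_borel_uminus:
  assumes "bounded_borel f" shows "bounded_borel (\<lambda>x. - f x)"
  using bounded_borel_scaleR[OF bounded_borel_const[of "-1"] assms] by simp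

lemma bounded_borel_diff:
  assumes "bounded_borel f" "bounded_borel g" shows "bounded_borel (\<lambda>x. f x - g x)"
  using bounded_borel_add[OF assms(1) bounded_borel_uminus[OF assms(2)]] by simp

lemma bounded_borel_mult:
  fixes f g :: "real \<Rightarrow> 'a::{euclidean_space, real_normed_algebra}"
  assumes "bounded_borel f" "bounded_borel g" shows "bounded_borel (\<lambda>x. f x * g x)"
proof -
  obtain B where B: "B \<ge> 0" "\<forall>x. norm (f x) \<le> B" using assms(1) by (rule bounded_borelE)
  obtain C where C: "\<forall>x. norm (g x) \<le> C" using assms(2) by (rule bounded_borelE)
  have "norm (f x * g x) \<le> B * C" for x
    using order_trans[OF norm_mult_ineq mult_mono[of "norm (f x)" B "norm (g x)" C]] B C by simp
  then show ?thesis using assms by (intro bounded_borelI[of _ "B * C"]) (auto simp: bounded_borel_def)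
qed

lemma bounded_borel_inner:
  assumes "bounded_borel f" "bounded_borel g" shows "bounded_borel (\<lambda>x. f x \<bullet> g x)"
proof -
  obtain B where B: "B \<ge> 0" "\<forall>x. norm (f x) \<le> B" using assms(1) by (rule bounded_borelE)
  obtain C where C: "\<forall>x. norm (g x) \<le> C" using assms(2) by (rule bounded_borelE)
  have "norm (f x \<bullet> g x) \<le> B * C" for x
    using order_trans[OF Cauchy_Schwarz_ineq2 mult_mono[of "norm (f x)" B "norm (g x)" C]] B C by simp
  then show ?thesis using assms by (intro bounded_borelI[of _ "B * C"]) (auto simp: bounded_borel_def)
qed

lemma bounded_borel_power2:
  fixes f :: "real \<Rightarrow> real"
  assumes "bounded_borel f" shows "bounded_borel (\<lambda>x. (f x)\<^sup>2)"
  using bounded_borel_mult[OF assms assms] by (simp add: power2_eq_square)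

lemma bounded_borel_cis:
  fixes f :: "real \<Rightarrow> real"
  assumes "bounded_borel f" shows "bounded_borel (\<lambda>x. cis (f x))"
proof (rule bounded_borelI[of _ 1])
  have "(\<lambda>x. exp (\<i> * complex_of_real (f x))) \<in> borel_measurable borel"
    using bounded_borel_measurable[OF assms] by measurable
  then show "(\<lambda>x. cis (f x)) \<in> borel_measurable borel" by (simp add: cis_conv_exp)
qed simp

lemmas bounded_borel_intros = bounded_borel_const bounded_borel_add bounded_borel_diff bounded_borel_uminus
  bounded_borel_scaleR bounded_borel_mult bounded_borel_inner bounded_borel_power2 bounded_borel_cis

lemma bounded_borel_continuous_bounded:
  "continuous_on UNIV f \<Longrightarrow> (\<And>x. norm (f x) \<le> B) \<Longrightarrow> bounded_borel f"
  by (rule bounded_borelI[OF borel_measurable_continuous_onI])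

lemma bounded_borel_integral_small:
  assumes "bounded_borel g"
  obtains B where "B \<ge> 0" "\<forall>x y. x \<le> y \<longrightarrow> norm (integral {x..y} g) \<le> B * (y - x)"
proof -
  obtain B where B: "B \<ge> 0" "\<forall>x. norm (g x) \<le> B" using assms by (rule bounded_borelE)
  show thesis
  proof (rule that[OF B(1)], intro allI impI)
    fix x y :: real assume "x \<le> y"
    then show "norm (integral {x..y} g) \<le> B * (y - x)"
      using has_integral_bound[where a = x and b = y, unfolded box_real, OF B(1) integrable_integral[OF bounded_borel_integrable[OF assms]]] B(2)
      by simp
  qed
qed

text \<open>Clamping the upper limit gives a primitive on \<open>{0..T}\<close> that is continuous
  and bounded on the whole line, and so stays in the class \<open>bounded_borel\<close>.\<close>

lemma clamped_integral:
  assumes T: "T \<ge> 0" and g: "bounded_borel g"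
  defines "F \<equiv> \<lambda>s. integral {0..max 0 (min T s)} g"
  shows "continuous_on UNIV F" and "bounded_borel F"
    and "\<And>s s'. \<lbrakk>0 \<le> s; s \<le> s'; s' \<le> T\<rbrakk> \<Longrightarrow> (g has_integral F s' - F s) {s..s'}"
proof -
  have "continuous_on {0..T} (\<lambda>s. integral {0..s} g)"
    by (rule indefinite_integral_continuous_1[OF bounded_borel_integrable[OF g]])
  then show cont: "continuous_on UNIV F" unfolding F_def
    by (rule continuous_on_compose2) (use T in \<open>auto intro!: continuous_intros\<close>)
  obtain B where B: "B \<ge> 0" "\<forall>x y. x \<le> y \<longrightarrow> norm (integral {x..y} g) \<le> B * (y - x)"
    using bounded_borel_integral_small[OF g] .
  show "bounded_borel F"
  proof (rule bounded_borel_continuous_bounded[OF cont])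
    fix s
    have "norm (F s) \<le> B * (max 0 (min T s) - 0)" unfolding F_def by (rule B(2)[rule_format]) simp
    also have "\<dots> \<le> B * T" using B(1) T by (intro mult_left_mono) auto
    finally show "norm (F s) \<le> B * T" .
  qed
  fix s s' assume s: "0 \<le> s" "s \<le> s'" "s' \<le> T"
  have "integral {0..s} g + integral {s..s'} g = integral {0..s'} g"
    using s by (intro Henstock_Kurzweil_Integration.integral_combine bounded_borel_integrable g)
  then have "F s' - F s = integral {s..s'} g" using s by (simp add: F_def diff_eq_eq add.commute)
  then show "(g has_integral F s' - F s) {s..s'}" using integrable_integral[OF bounded_borel_integrable[OF g]] by simp
qed

lemma cis_linear_approx: "norm (cis a - 1 - \<i> * complex_of_real a) \<le> a\<^sup>2"
proof -
  have "norm (exp (\<i> * complex_of_real a) - (\<Sum>k\<le>1. (\<i> * complex_of_real a) ^ k / fact k))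
     \<le> exp \<bar>Re (\<i> * complex_of_real a)\<bar> * (norm (\<i> * complex_of_real a) ^ Suc 1) / fact 1"
    by (rule Taylor_exp)
  then show ?thesis by (simp add: cis_conv_exp norm_mult power2_eq_square diff_diff_eq)
qed

lemma cis_diff_le: "norm (cis a - 1) \<le> \<bar>a\<bar>"
  using dist_exp_i_1[of a] abs_sin_x_le_abs_x[of "a / 2"] by (simp add: cis_conv_exp)

context unit_speed_bicycle
begin

lemma bounded_borel_base: "bounded_borel e" "bounded_borel v" "bounded_borel w"
  by (rule bounded_borelI[of _ 1], simp_all add: abs_v abs_w)+

text \<open>The product rule for functions known only through densities. With \<open>y\<close>
  frozen at \<open>s'\<close> and \<open>x\<close> frozen at \<open>s\<close> the formula is exact,
  and unfreezing them costs a quadratic error.\<close>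

lemma has_integral_product:
  fixes x y X Y :: "real \<Rightarrow> 'a::{euclidean_space, real_normed_algebra}"
  assumes bb: "bounded_borel x" "bounded_borel y" "bounded_borel X" "bounded_borel Y"
    and x: "\<And>s s'. \<lbrakk>0 \<le> s; s \<le> s'; s' \<le> T\<rbrakk> \<Longrightarrow> (X has_integral x s' - x s) {s..s'}"
    and y: "\<And>s s'. \<lbrakk>0 \<le> s; s \<le> s'; s' \<le> T\<rbrakk> \<Longrightarrow> (Y has_integral y s' - y s) {s..s'}"
    and s: "0 \<le> s" "s \<le> s'" "s' \<le> T"
  shows "((\<lambda>r. X r * y r + x r * Y r) has_integral x s' * y s' - x s * y s) {s..s'}"
proof -
  obtain A where A: "A \<ge> 0" "\<forall>r. norm (X r) \<le> A" using bb(3) by (rule bounded_borelE)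
  obtain B where B: "B \<ge> 0" "\<forall>r. norm (Y r) \<le> B" using bb(4) by (rule bounded_borelE)
  have lx: "norm (x s' - x s) \<le> A * (s' - s)" if "0 \<le> s" "s \<le> s'" "s' \<le> T" for s s'
    using has_integral_bound[where a = s and b = s', unfolded box_real, OF A(1) x[OF that]] A(2) that by simp
  have ly: "norm (y s' - y s) \<le> B * (s' - s)" if "0 \<le> s" "s \<le> s'" "s' \<le> T" for s s'
    using has_integral_bound[where a = s and b = s', unfolded box_real, OF B(1) y[OF that]] B(2) that by simp
  show ?thesis
  proof (rule has_integral_if_quadratic_error[OF _ _ s, where C = "2 * A * B" and H = "\<lambda>r. x r * y r"])
    show int: "(\<lambda>r. X r * y r + x r * Y r) integrable_on {a..b}" for a b
      by (intro bounded_borel_integrable bounded_borel_intros bb)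
    fix s s' assume s: "0 \<le> s" "s \<le> s'" "s' \<le> T"
    have "((\<lambda>r. (X r * y s' + x s * Y r) - (X r * y r + x r * Y r)) has_integral
       (x s' - x s) * y s' + x s * (y s' - y s) - integral {s..s'} (\<lambda>r. X r * y r + x r * Y r)) {s..s'}"
      by (intro has_integral_diff has_integral_add has_integral_mult_left has_integral_mult_right x y s
          integrable_integral int)
    then have i: "((\<lambda>r. X r * (y s' - y r) - (x r - x s) * Y r) has_integral
       x s' * y s' - x s * y s - integral {s..s'} (\<lambda>r. X r * y r + x r * Y r)) {s..s'}"
      by (simp add: algebra_simps)
    have "norm (x s' * y s' - x s * y s - integral {s..s'} (\<lambda>r. X r * y r + x r * Y r))
      \<le> (2 * A * B * (s' - s)) * measure lborel {s..s'}"
    proof (rule has_integral_bound[where a = s and b = s', unfolded box_real, OF _ i])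
      show "0 \<le> 2 * A * B * (s' - s)" using A B s by simp
      fix r assume r: "r \<in> {s..s'}"
      have "norm (X r * (y s' - y r) - (x r - x s) * Y r) \<le> norm (X r) * norm (y s' - y r) + norm (x r - x s) * norm (Y r)"
        by (rule order_trans[OF norm_triangle_ineq4 add_mono[OF norm_mult_ineq norm_mult_ineq]])
      also have "\<dots> \<le> A * (B * (s' - s)) + (A * (s' - s)) * B"
      proof (rule add_mono; rule mult_mono)
        show "norm (y s' - y r) \<le> B * (s' - s)"
          using order_trans[OF ly[of r s'] mult_left_mono[of "s' - r" "s' - s" B]] r s B by simp
        show "norm (x r - x s) \<le> A * (s' - s)"
          using order_trans[OF lx[of s r] mult_left_mono[of "r - s" "s' - s" A]] r s A by simp
      qed (use A B s in auto)
      finally show "norm (X r * (y s' - y r) - (x r - x s) * Y r) \<le> 2 * A * B * (s' - s)" by (simp add: algebra_simps)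
    qed
    moreover have "2 * A * B * (s' - s) * measure lborel {s..s'} = 2 * A * B * (s' - s)\<^sup>2"
      using s by (simp add: power2_eq_square)
    ultimately show "norm (x s' * y s' - x s * y s - integral {s..s'} (\<lambda>r. X r * y r + x r * Y r)) \<le> 2 * A * B * (s' - s)\<^sup>2"
      by (simp only:)
  qed
qed

text \<open>The chain rule for \<open>cis\<close>: one quadratic error comes from freezing
  \<open>cis (x r)\<close> at \<open>s\<close>, the other from
  \<open>cis_linear_approx\<close>.\<close>

lemma has_integral_cis:
  fixes x X :: "real \<Rightarrow> real"
  assumes bb: "bounded_borel x" "bounded_borel X"
    and x: "\<And>s s'. \<lbrakk>0 \<le> s; s \<le> s'; s' \<le> T\<rbrakk> \<Longrightarrow> (X has_integral x s' - x s) {s..s'}"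
    and s: "0 \<le> s" "s \<le> s'" "s' \<le> T"
  shows "((\<lambda>r. X r *\<^sub>R (\<i> * cis (x r))) has_integral cis (x s') - cis (x s)) {s..s'}"
proof -
  obtain A where A: "A \<ge> 0" "\<forall>r. norm (X r) \<le> A" using bb(2) by (rule bounded_borelE)
  have lx: "\<bar>x s' - x s\<bar> \<le> A * (s' - s)" if "0 \<le> s" "s \<le> s'" "s' \<le> T" for s s'
    using has_integral_bound[where a = s and b = s', unfolded box_real, OF A(1) x[OF that]] A(2) that by simp
  have factor: "cis y - cis z = cis z * (cis (y - z) - 1)" for y z
    by (simp add: right_diff_distrib cis_mult)
  show ?thesis
  proof (rule has_integral_if_quadratic_error[OF _ _ s, where C = "2 * A\<^sup>2" and H = "\<lambda>r. cis (x r)"])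
    show int: "(\<lambda>r. X r *\<^sub>R (\<i> * cis (x r))) integrable_on {a..b}" for a b
      by (intro bounded_borel_integrable bounded_borel_intros bb)
    fix s s' assume s: "0 \<le> s" "s \<le> s'" "s' \<le> T"
    have i: "((\<lambda>r. X r *\<^sub>R (\<i> * cis (x r)) - X r *\<^sub>R (\<i> * cis (x s))) has_integral
       integral {s..s'} (\<lambda>r. X r *\<^sub>R (\<i> * cis (x r))) - (x s' - x s) *\<^sub>R (\<i> * cis (x s))) {s..s'}"
      by (intro has_integral_diff has_integral_scaleR_left x s integrable_integral int)
    have "norm (integral {s..s'} (\<lambda>r. X r *\<^sub>R (\<i> * cis (x r))) - (x s' - x s) *\<^sub>R (\<i> * cis (x s)))
      \<le> (A * (A * (s' - s))) * measure lborel {s..s'}"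
    proof (rule has_integral_bound[where a = s and b = s', unfolded box_real, OF _ i])
      show "0 \<le> A * (A * (s' - s))" using A s by simp
      fix r assume r: "r \<in> {s..s'}"
      have "norm (cis (x r) - cis (x s)) \<le> \<bar>x r - x s\<bar>"
        unfolding factor using cis_diff_le by (simp add: norm_mult)
      also have "\<dots> \<le> A * (s' - s)"
        using order_trans[OF lx[of s r] mult_left_mono[of "r - s" "s' - s" A]] r s A by simp
      finally have "norm (X r) * norm (cis (x r) - cis (x s)) \<le> A * (A * (s' - s))"
        by (rule mult_mono[OF A(2)[rule_format] _ A(1) norm_ge_zero])
      moreover have "X r *\<^sub>R (\<i> * cis (x r)) - X r *\<^sub>R (\<i> * cis (x s)) = X r *\<^sub>R (\<i> * (cis (x r) - cis (x s)))"
        by (simp add: algebra_simps)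
      ultimately show "norm (X r *\<^sub>R (\<i> * cis (x r)) - X r *\<^sub>R (\<i> * cis (x s))) \<le> A * (A * (s' - s))"
        by (simp add: norm_mult)
    qed
    then have 1: "norm (integral {s..s'} (\<lambda>r. X r *\<^sub>R (\<i> * cis (x r))) - (x s' - x s) *\<^sub>R (\<i> * cis (x s))) \<le> A\<^sup>2 * (s' - s)\<^sup>2"
      using s by (simp add: power2_eq_square mult_ac)
    define a where "a = x s' - x s"
    have "cis (x s') - cis (x s) - a *\<^sub>R (\<i> * cis (x s)) = cis (x s) * (cis a - 1 - \<i> * complex_of_real a)"
      unfolding factor a_def by (simp add: algebra_simps scaleR_conv_of_real)
    then have "norm (cis (x s') - cis (x s) - a *\<^sub>R (\<i> * cis (x s))) \<le> a\<^sup>2"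
      using cis_linear_approx[of a] by (simp add: norm_mult)
    also have "a\<^sup>2 \<le> (A * (s' - s))\<^sup>2" using lx[OF s] A s by (simp add: a_def abs_le_square_iff[symmetric] abs_mult)
    finally have 2: "norm (cis (x s') - cis (x s) - a *\<^sub>R (\<i> * cis (x s))) \<le> A\<^sup>2 * (s' - s)\<^sup>2"
      by (simp add: power_mult_distrib)
    have "cis (x s') - cis (x s) - integral {s..s'} (\<lambda>r. X r *\<^sub>R (\<i> * cis (x r))) =
       (cis (x s') - cis (x s) - a *\<^sub>R (\<i> * cis (x s))) - (integral {s..s'} (\<lambda>r. X r *\<^sub>R (\<i> * cis (x r))) - (x s' - x s) *\<^sub>R (\<i> * cis (x s)))"
      by (simp add: a_def)
    then have "norm (cis (x s') - cis (x s) - integral {s..s'} (\<lambda>r. X r *\<^sub>R (\<i> * cis (x r)))) \<le>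
       norm (cis (x s') - cis (x s) - a *\<^sub>R (\<i> * cis (x s))) + norm (integral {s..s'} (\<lambda>r. X r *\<^sub>R (\<i> * cis (x r))) - (x s' - x s) *\<^sub>R (\<i> * cis (x s)))"
      by (simp only: norm_triangle_ineq4)
    then show "norm (cis (x s') - cis (x s) - integral {s..s'} (\<lambda>r. X r *\<^sub>R (\<i> * cis (x r)))) \<le> 2 * A\<^sup>2 * (s' - s)\<^sup>2"
      using 1 2 by linarith
  qed
qed

end

section \<open>The first variation\<close>

lemma cis_times_inner:
  fixes p z :: complex
  shows "p \<bullet> (z * cis a) = (p \<bullet> z) * cos a + (p \<bullet> (\<i> * z)) * sin a"
  by (simp add: inner_complex_def algebra_simps)

text \<open>A Taylor bound uniform in \<open>z\<close>. Of the constant 5, four comes from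
  \<open>|sin (2 * a) - 2 * a| \<le> 4 * a\<^sup>2\<close> and one from the term
  \<open>A\<^sup>2 * (sin a)\<^sup>2\<close>; the nonnegative term with \<open>B\<^sup>2\<close> is
  dropped.\<close>

lemma inner_square_rotation_ge:
  fixes p z :: complex
  assumes z: "norm z = 1"
  shows "(p \<bullet> (z * cis a))\<^sup>2 - (p \<bullet> z)\<^sup>2 \<ge> 2 * a * ((p \<bullet> z) * (p \<bullet> (\<i> * z))) - 5 * (norm p)\<^sup>2 * a\<^sup>2"
proof -
  define A where "A = p \<bullet> z"
  define B where "B = p \<bullet> (\<i> * z)"
  have AB: "\<bar>A\<bar> \<le> norm p" "\<bar>B\<bar> \<le> norm p"
    unfolding A_def B_def using Cauchy_Schwarz_ineq2[of p z] Cauchy_Schwarz_ineq2[of p "\<i> * z"] z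
    by (simp_all add: norm_mult)
  have sq: "A\<^sup>2 \<le> (norm p)\<^sup>2" using AB(1) by (simp add: abs_le_square_iff[symmetric])
  have "\<bar>A * B\<bar> \<le> norm p * norm p" unfolding abs_mult using AB by (intro mult_mono) auto
  then have prod: "\<bar>A * B\<bar> \<le> (norm p)\<^sup>2" by (simp add: power2_eq_square)
  have sin2: "(sin a)\<^sup>2 \<le> a\<^sup>2" using abs_sin_x_le_abs_x[of a] by (simp add: abs_le_square_iff[symmetric])
  have "\<bar>sin (2 * a) - 2 * a\<bar> \<le> norm (cis (2 * a) - 1 - \<i> * complex_of_real (2 * a))"
    using abs_Im_le_cmod[of "cis (2 * a) - 1 - \<i> * complex_of_real (2 * a)"] by simp
  also have "\<dots> \<le> (2 * a)\<^sup>2" by (rule cis_linear_approx)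
  finally have s2a: "\<bar>sin (2 * a) - 2 * a\<bar> \<le> 4 * a\<^sup>2" by (simp add: power_mult_distrib)
  have "\<bar>A * B * (sin (2 * a) - 2 * a)\<bar> \<le> (norm p)\<^sup>2 * (4 * a\<^sup>2)"
    unfolding abs_mult[of "A * B"] by (rule mult_mono[OF prod s2a]) auto
  then have 1: "A * B * sin (2 * a) \<ge> 2 * a * (A * B) - 4 * (norm p)\<^sup>2 * a\<^sup>2"
    by (simp add: abs_le_iff algebra_simps)
  have 2: "A\<^sup>2 * (sin a)\<^sup>2 \<le> (norm p)\<^sup>2 * a\<^sup>2" by (rule mult_mono[OF sq sin2]) auto
  have "(p \<bullet> (z * cis a))\<^sup>2 = (A * cos a + B * sin a)\<^sup>2" by (simp add: cis_times_inner A_def B_def)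
  also have "\<dots> = A\<^sup>2 * (cos a)\<^sup>2 + B\<^sup>2 * (sin a)\<^sup>2 + A * B * sin (2 * a)"
    unfolding sin_double by (simp add: power2_eq_square algebra_simps)
  also have "(cos a)\<^sup>2 = 1 - (sin a)\<^sup>2" by (simp add: cos_squared_eq)
  finally have 3: "(p \<bullet> (z * cis a))\<^sup>2 = A\<^sup>2 - A\<^sup>2 * (sin a)\<^sup>2 + B\<^sup>2 * (sin a)\<^sup>2 + A * B * sin (2 * a)"
    by (simp add: algebra_simps)
  have "B\<^sup>2 * (sin a)\<^sup>2 \<ge> 0" by simp
  then show ?thesis using 1 2 3 unfolding A_def[symmetric] B_def[symmetric] by linarith
qed

text \<open>In this form the integral of the projections onto a moving line depends on the line only
  through the integral of \<open>z\<^sup>2\<close>. This is the origin of \<open>K\<close> and of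
  its comparison with \<open>T\<close>.\<close>

lemma unit_projection:
  fixes q z :: complex
  assumes "norm z = 1"
  shows "(q \<bullet> z) *\<^sub>R z = (1 / 2) *\<^sub>R (q + z\<^sup>2 * cnj q)"
proof -
  have n: "Re z * Re z + Im z * Im z = 1"
    using assms by (simp add: cmod_def real_sqrt_eq_1_iff power2_eq_square)
  have "Re q * (Re z * Re z + Im z * Im z) = Re q" "Im q * (Re z * Re z + Im z * Im z) = Im q" by (simp_all add: n)
  then show ?thesis by (simp add: complex_eq_iff inner_complex_def power2_eq_square algebra_simps)
qed

locale minimizing_arc = unit_speed_bicycle +
  assumes minimal: "\<And>\<eta>. \<lbrakk>bicycle_path l 0 T \<eta>; \<eta> 0 = (b 0, f 0); \<eta> T = (b T, f T)\<rbrakk> \<Longrightarrow>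
     ennreal T \<le> curve_length 0 T (front_track \<eta>)"
begin

abbreviation I where "I g \<equiv> integral {0..T} g"

lemma I_add: "bounded_borel g \<Longrightarrow> bounded_borel h \<Longrightarrow> I (\<lambda>r. g r + h r) = I g + I h"
  by (intro integral_add bounded_borel_integrable)

lemma I_diff: "bounded_borel g \<Longrightarrow> bounded_borel h \<Longrightarrow> I (\<lambda>r. g r - h r) = I g - I h"
  by (intro integral_diff bounded_borel_integrable)

lemma I_mono: "bounded_borel g \<Longrightarrow> bounded_borel h \<Longrightarrow> (\<And>r. g r \<le> h r) \<Longrightarrow> I g \<le> (I h :: real)"
  by (intro integral_le bounded_borel_integrable)

lemma I_inner: "bounded_borel g \<Longrightarrow> I (\<lambda>r. p \<bullet> g r) = p \<bullet> I g"
  using integral_linear[OF bounded_borel_integrable bounded_linear_inner_right, of g 0 T p] by (simp add: o_def)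

lemma I_const: "I (\<lambda>r. c) = T *\<^sub>R c"
  using T_pos by simp

text \<open>Minimality gives \<open>T \<le> (T + energy) / 2\<close>, hence
  \<open>T \<le> energy\<close>. Since the path itself has
  \<open>v\<^sup>2 + w\<^sup>2 \<le> 1\<close>, it minimizes the energy as well. Assumption
  \<open>D\<close> brings the back wheel to its end point, and \<open>e' T = e T\<close> then does
  so for the front wheel.\<close>

lemma T_le_energy:
  fixes V \<omega> :: "real \<Rightarrow> real" and e' :: "real \<Rightarrow> complex"
  assumes e': "\<And>s. norm (e' s) = 1" "continuous_on {0..T} e'" "e' 0 = e 0" "e' T = e T"
    and V: "continuous_on {0..T} V" "bounded_borel V" and \<omega>: "bounded_borel \<omega>"
    and inc: "\<And>s s'. \<lbrakk>0 \<le> s; s \<le> s'; s' \<le> T\<rbrakk> \<Longrightarrow> ((\<lambda>r. (\<omega> r / l) *\<^sub>R (\<i> * e' r)) has_integral e' s' - e' s) {s..s'}"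
    and D: "I (\<lambda>r. V r *\<^sub>R e' r) = b T - b 0"
  shows "T \<le> I (\<lambda>r. (V r)\<^sup>2) + I (\<lambda>r. (\<omega> r)\<^sup>2)"
proof -
  obtain B where B: "B \<ge> 0" "\<forall>s. norm (\<omega> s) \<le> B" using \<omega> by (rule bounded_borelE)
  define b' where "b' s = b 0 + integral {0..s} (\<lambda>r. V r *\<^sub>R e' r)" for s
  have T0: "T \<ge> 0" using T_pos by simp
  have \<omega>l: "(\<lambda>s. \<omega> s / l) \<in> borel_measurable borel" "\<And>s. \<bar>\<omega> s / l\<bar> \<le> B / l"
    using \<omega> B l_pos by (auto simp: bounded_borel_def divide_right_mono)
  note comp = competitor_bicycle_path[OF T0 l_pos e'(1,2) V(1) \<omega>l inc b'_def]
  have 0: "0 \<in> {0..T}" "T \<in> {0..T}" using T0 by auto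
  have "ennreal T \<le> curve_length 0 T (front_track (\<lambda>s. (b' s, b' s + l *\<^sub>R e' s)))"
    using f_eq[OF 0(1)] f_eq[OF 0(2)] by (intro minimal comp(1)) (simp_all add: b'_def e' D)
  also note comp(2)
  also have "(\<lambda>s. (1 + (V s)\<^sup>2 + (l * (\<omega> s / l))\<^sup>2) / 2) = (\<lambda>s. (1 / 2) *\<^sub>R (1 + ((V s)\<^sup>2 + (\<omega> s)\<^sup>2)))"
    using l_pos by (simp add: fun_eq_iff add_divide_distrib)
  also have "I \<dots> = (1 / 2) *\<^sub>R (T + (I (\<lambda>r. (V r)\<^sup>2) + I (\<lambda>r. (\<omega> r)\<^sup>2)))"
  proof -
    have "I (\<lambda>s. (1::real) + ((V s)\<^sup>2 + (\<omega> s)\<^sup>2)) = T + (I (\<lambda>r. (V r)\<^sup>2) + I (\<lambda>r. (\<omega> r)\<^sup>2))"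
      using T_pos by (subst I_add; (subst I_add)?; (intro bounded_borel_intros V \<omega>)?) simp
    then show ?thesis by (simp only: integral_cmul)
  qed
  finally have *: "ennreal T \<le> ennreal ((1 / 2) *\<^sub>R (T + (I (\<lambda>r. (V r)\<^sup>2) + I (\<lambda>r. (\<omega> r)\<^sup>2))))" .
  have "0 \<le> I (\<lambda>r. (V r)\<^sup>2)" "0 \<le> I (\<lambda>r. (\<omega> r)\<^sup>2)"
    by (intro integral_nonneg bounded_borel_integrable bounded_borel_intros V \<omega>; simp)+
  then have "T \<le> (1 / 2) *\<^sub>R (T + (I (\<lambda>r. (V r)\<^sup>2) + I (\<lambda>r. (\<omega> r)\<^sup>2)))"
    using * T0 by (subst (asm) ennreal_le_iff) simp_all
  then show ?thesis by simp
qed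

lemma projection_integral:
  assumes "\<And>s. norm (e' s) = 1" "bounded_borel e'"
  shows "I (\<lambda>r. (q \<bullet> e' r) *\<^sub>R e' r) = (1 / 2) *\<^sub>R (T *\<^sub>R q + I (\<lambda>r. (e' r)\<^sup>2) * cnj q)"
proof -
  have sq: "bounded_borel (\<lambda>r. (e' r)\<^sup>2)" unfolding power2_eq_square by (intro bounded_borel_intros assms)
  have "I (\<lambda>r. (q \<bullet> e' r) *\<^sub>R e' r) = (1 / 2) *\<^sub>R I (\<lambda>r. q + (e' r)\<^sup>2 * cnj q)"
    by (simp only: unit_projection[OF assms(1)] integral_cmul)
  also have "I (\<lambda>r. q + (e' r)\<^sup>2 * cnj q) = T *\<^sub>R q + I (\<lambda>r. (e' r)\<^sup>2 * cnj q)"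
    by (subst I_add) (intro bounded_borel_intros sq | simp only: I_const)+
  also have "I (\<lambda>r. (e' r)\<^sup>2 * cnj q) = I (\<lambda>r. (e' r)\<^sup>2) * cnj q"
    by (intro integral_mult_left bounded_borel_integrable sq) 
  finally show ?thesis .
qed

text \<open>The real-linear map in question has determinant proportional to
  \<open>T\<^sup>2 - (norm K)\<^sup>2\<close>; the solution comes from eliminating
  \<open>cnj q\<close> between the equation and its conjugate.\<close>

lemma solve_projection:
  fixes K D :: complex
  assumes "norm K < T"
  obtains q where "(1 / 2) *\<^sub>R (T *\<^sub>R q + K * cnj q) = D"
proof -
  define N where "N = complex_of_real (T\<^sup>2 - (norm K)\<^sup>2)"
  have "(norm K)\<^sup>2 < T\<^sup>2" using assms by (intro power_strict_mono) auto
  then have N: "N \<noteq> 0" unfolding N_def of_real_eq_0_iff by simp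
  have cN: "cnj N = N" by (simp add: N_def)
  have KK: "K * cnj K = of_real ((norm K)\<^sup>2)" by (rule complex_norm_square[symmetric, unfolded of_real_power[symmetric]])
  define q where "q = 2 * (of_real T * D - K * cnj D) / N"
  have cq: "cnj q = 2 * (of_real T * cnj D - cnj K * D) / N" by (simp add: q_def cN)
  have "of_real T * q + K * cnj q = 2 * ((of_real T * of_real T) * D - (K * cnj K) * D) / N"
    unfolding cq unfolding q_def by (simp add: add_divide_distrib[symmetric] algebra_simps)
  also have "\<dots> = 2 * (N * D) / N" unfolding KK N_def by (simp add: power2_eq_square algebra_simps)
  also have "\<dots> = 2 * D" using N by simp
  finally show thesis by (intro that[of q]) (simp add: scaleR_conv_of_real)
qed

definition K where "K = I (\<lambda>r. (e r)\<^sup>2)"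

lemma e_sq: "bounded_borel (\<lambda>r. (e r)\<^sup>2)"
  unfolding power2_eq_square by (intro bounded_borel_intros bounded_borel_base)

text \<open>For every small \<open>\<epsilon>\<close> the frame directions \<open>e \<cdot> cis (\<epsilon> \<eta>)\<close> and the back speeds \<open>q \<bullet> e \<cdot> cis (\<epsilon> \<eta>)\<close>
  form a competitor; \<open>q\<close> is determined by the displacement of the back wheel, and is close to \<open>p\<close>.\<close>

lemma variation_inequality:
  assumes K: "norm K < T" and p: "(1 / 2) *\<^sub>R (T *\<^sub>R p + K * cnj p) = b T - b 0"
    and h: "bounded_borel h" and \<eta>: "bounded_borel \<eta>" "continuous_on UNIV \<eta>" "\<eta> 0 = 0" "\<eta> T = 0"
    and \<eta>_int: "\<And>s s'. \<lbrakk>0 \<le> s; s \<le> s'; s' \<le> T\<rbrakk> \<Longrightarrow> ((\<lambda>r. h r / l) has_integral \<eta> s' - \<eta> s) {s..s'}"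
  obtains C \<epsilon>0 where "\<epsilon>0 > 0" "\<forall>\<epsilon>. \<bar>\<epsilon>\<bar> \<le> \<epsilon>0 \<longrightarrow> T \<le> p \<bullet> (b T - b 0) + I (\<lambda>r. (w r)\<^sup>2)
      + 2 * \<epsilon> * (I (\<lambda>r. w r * h r) - I (\<lambda>r. \<eta> r * ((p \<bullet> e r) * (p \<bullet> (\<i> * e r))))) + C * \<epsilon>\<^sup>2"
proof -
  define D where "D = b T - b 0"
  obtain N where N: "N \<ge> 0" "\<forall>r. norm (\<eta> r) \<le> N" using \<eta>(1) by (rule bounded_borelE)
  \<comment> \<open>Half of the gap between \<open>norm K\<close> and \<open>T\<close>. For
    \<open>|\<epsilon>| \<le> \<epsilon>0\<close> the perturbed \<open>K'\<close> differs from
    \<open>K\<close> by at most \<kappa>, so the equation for \<open>q\<close> stays solvable with a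
    uniform bound.\<close>
  define \<kappa> where "\<kappa> = (T - norm K) / 2"
  have \<kappa>: "\<kappa> > 0" using K by (simp add: \<kappa>_def)
  define \<epsilon>0 where "\<epsilon>0 = \<kappa> / (2 * T * N + 1)"
  have TN: "2 * T * N + 1 > 0" using T_pos N by (intro add_nonneg_pos) auto
  have \<epsilon>0: "\<epsilon>0 > 0" using \<kappa> TN by (simp add: \<epsilon>0_def)
  note bb = bounded_borel_intros bounded_borel_base h \<eta>(1)
  define c where "c = 2 * T * N * norm p / \<kappa>"
  define C where "C = 5 * (norm p)\<^sup>2 * I (\<lambda>r. (\<eta> r)\<^sup>2) + I (\<lambda>r. (h r)\<^sup>2) + T * c\<^sup>2"
  show thesis
  proof (rule that[OF \<epsilon>0], intro allI impI)
    fix \<epsilon> :: real assume \<epsilon>: "\<bar>\<epsilon>\<bar> \<le> \<epsilon>0"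
    define e' where "e' r = e r * cis (\<epsilon> * \<eta> r)" for r
    have ne': "norm (e' r) = 1" for r by (simp add: e'_def norm_mult)
    have bb': "bounded_borel e'" unfolding e'_def by (intro bb)
    define K' where "K' = I (\<lambda>r. (e' r)\<^sup>2)"
    have e'_sq: "bounded_borel (\<lambda>r. (e' r)\<^sup>2)" unfolding power2_eq_square by (intro bb bb')
    have KK: "norm (K' - K) \<le> 2 * T * N * \<bar>\<epsilon>\<bar>"
    proof -
      have "((\<lambda>r. (e' r)\<^sup>2 - (e r)\<^sup>2) has_integral K' - K) {0..T}"
        unfolding K'_def K_def by (intro has_integral_diff integrable_integral bounded_borel_integrable e_sq e'_sq)
      then have "norm (K' - K) \<le> (2 * (\<bar>\<epsilon>\<bar> * N)) * measure lborel {0..T}"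
      proof (rule has_integral_bound[where a = 0 and b = T, unfolded box_real, rotated])
        show "0 \<le> 2 * (\<bar>\<epsilon>\<bar> * N)" using N by simp
        fix r
        have "(e' r)\<^sup>2 - (e r)\<^sup>2 = (e r)\<^sup>2 * (cis (2 * (\<epsilon> * \<eta> r)) - 1)"
          by (simp add: e'_def power_mult_distrib Complex.DeMoivre right_diff_distrib)
        then have "norm ((e' r)\<^sup>2 - (e r)\<^sup>2) \<le> \<bar>2 * (\<epsilon> * \<eta> r)\<bar>"
          using cis_diff_le[of "2 * (\<epsilon> * \<eta> r)"] by (simp add: norm_mult norm_power)
        also have "\<dots> \<le> 2 * (\<bar>\<epsilon>\<bar> * N)" using N(2) by (simp add: abs_mult mult_left_mono)
        finally show "norm ((e' r)\<^sup>2 - (e r)\<^sup>2) \<le> 2 * (\<bar>\<epsilon>\<bar> * N)" .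
      qed
      then show ?thesis using T_pos by (simp add: mult_ac)
    qed
    also have "\<dots> \<le> (2 * T * N + 1) * \<epsilon>0"
      using \<epsilon> N T_pos by (intro mult_mono) auto
    also have "\<dots> = \<kappa>" using TN by (simp add: \<epsilon>0_def)
    finally have "norm K' \<le> norm K + \<kappa>" using norm_triangle_ineq2[of K' K] by linarith
    then have K'\<kappa>: "norm K' \<le> T - \<kappa>" by (simp add: \<kappa>_def field_simps)
    then have "norm K' < T" using \<kappa> by simp
    then obtain q where q: "(1 / 2) *\<^sub>R (T *\<^sub>R q + K' * cnj q) = D" by (rule solve_projection)
    have "(1 / 2) *\<^sub>R (T *\<^sub>R q + K' * cnj q) = (1 / 2) *\<^sub>R (T *\<^sub>R p + K * cnj p)"
      using p q by (simp only: D_def)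
    then have "T *\<^sub>R q + K' * cnj q = T *\<^sub>R p + K * cnj p" by (simp only: scaleR_cancel_left) simp
    \<comment> \<open>Subtracting the equations of \<open>q\<close> and \<open>p\<close> isolates
      \<open>q - p\<close>. Since \<open>norm K' \<le> T - \<kappa>\<close>, the term with
      \<open>q - p\<close> on the right is absorbed, and
      \<open>norm (q - p) \<le> c * |\<epsilon>|\<close> remains.\<close>
    then have "T *\<^sub>R (q - p) = - (K' * cnj (q - p)) - (K' - K) * cnj p"
      by (simp add: scaleR_conv_of_real algebra_simps)
    then have "norm (T *\<^sub>R (q - p)) = norm (- (K' * cnj (q - p)) - (K' - K) * cnj p)" by simp
    also have "\<dots> \<le> norm K' * norm (q - p) + norm (K' - K) * norm p"
      by (rule order_trans[OF norm_triangle_ineq4]) (simp add: norm_mult del: complex_cnj_diff)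
    also have "\<dots> \<le> (T - \<kappa>) * norm (q - p) + (2 * T * N * \<bar>\<epsilon>\<bar>) * norm p"
      by (intro add_mono mult_right_mono K'\<kappa> KK) auto
    finally have "T * norm (q - p) \<le> (T - \<kappa>) * norm (q - p) + (2 * T * N * \<bar>\<epsilon>\<bar>) * norm p"
      using T_pos by (simp only: norm_scaleR abs_of_pos)
    then have "\<kappa> * norm (q - p) \<le> 2 * T * N * norm p * \<bar>\<epsilon>\<bar>"
      by (simp add: algebra_simps)
    then have qp: "norm (q - p) \<le> c * \<bar>\<epsilon>\<bar>" using \<kappa> by (simp add: c_def field_simps)
    have qD: "I (\<lambda>r. (q \<bullet> e' r) *\<^sub>R e' r) = D" using projection_integral[OF ne' bb', of q] q by (simp add: K'_def)
    have "T \<le> I (\<lambda>r. (q \<bullet> e' r)\<^sup>2) + I (\<lambda>r. (w r + \<epsilon> * h r)\<^sup>2)"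
    proof (rule T_le_energy[OF ne'])
      have cont: "continuous_on UNIV e'" unfolding e'_def cis_conv_exp
        by (intro continuous_intros \<eta>(2))
      then show "continuous_on {0..T} e'" by (rule continuous_on_subset) simp
      show "e' 0 = e 0" "e' T = e T" by (simp_all add: e'_def \<eta>)
      show "continuous_on {0..T} (\<lambda>r. q \<bullet> e' r)"
        by (intro continuous_intros continuous_on_subset[OF cont]) simp
      show "bounded_borel (\<lambda>r. q \<bullet> e' r)" "bounded_borel (\<lambda>r. w r + \<epsilon> * h r)" by (intro bb bb')+
      show "I (\<lambda>r. (q \<bullet> e' r) *\<^sub>R e' r) = b T - b 0" using qD by (simp add: D_def)
      fix s s' assume s: "0 \<le> s" "s \<le> s'" "s' \<le> T"
      have bbl: "bounded_borel (\<lambda>r. w r / l)" "bounded_borel (\<lambda>r. \<epsilon> * (h r / l))"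
        using bounded_borel_mult[OF bounded_borel_base(3) bounded_borel_const[of "1 / l"]]
          bounded_borel_mult[OF h bounded_borel_const[of "\<epsilon> / l"]] by (simp_all add: mult_ac)
      have "((\<lambda>r. ((w r / l) *\<^sub>R (\<i> * e r)) * cis (\<epsilon> * \<eta> r) + e r * ((\<epsilon> * (h r / l)) *\<^sub>R (\<i> * cis (\<epsilon> * \<eta> r))))
          has_integral e s' * cis (\<epsilon> * \<eta> s') - e s * cis (\<epsilon> * \<eta> s)) {s..s'}"
      proof (rule has_integral_product[OF _ _ _ _ _ _ s])
        fix s s' assume s: "0 \<le> s" "s \<le> s'" "s' \<le> T"
        show "((\<lambda>r. (w r / l) *\<^sub>R (\<i> * e r)) has_integral e s' - e s) {s..s'}" by (rule e_has_integral[OF s])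
        show "((\<lambda>r. (\<epsilon> * (h r / l)) *\<^sub>R (\<i> * cis (\<epsilon> * \<eta> r))) has_integral cis (\<epsilon> * \<eta> s') - cis (\<epsilon> * \<eta> s)) {s..s'}"
        proof (rule has_integral_cis[OF _ bbl(2) _ s])
          fix s s' assume s: "0 \<le> s" "s \<le> s'" "s' \<le> T"
          show "((\<lambda>r. \<epsilon> * (h r / l)) has_integral \<epsilon> * \<eta> s' - \<epsilon> * \<eta> s) {s..s'}"
            using has_integral_mult_right[OF \<eta>_int[OF s], of \<epsilon>] by (simp add: right_diff_distrib)
        qed (intro bb)
      qed (intro bb bbl)+
      moreover have "((w r / l) *\<^sub>R (\<i> * e r)) * cis (\<epsilon> * \<eta> r) + e r * ((\<epsilon> * (h r / l)) *\<^sub>R (\<i> * cis (\<epsilon> * \<eta> r)))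
          = ((w r + \<epsilon> * h r) / l) *\<^sub>R (\<i> * e' r)" for r
        by (simp add: e'_def scaleR_conv_of_real add_divide_distrib algebra_simps)
      ultimately show "((\<lambda>r. ((w r + \<epsilon> * h r) / l) *\<^sub>R (\<i> * e' r)) has_integral e' s' - e' s) {s..s'}"
        by (simp only: e'_def)
    qed
    \<comment> \<open>Expansion around \<open>p\<close>: the mixed term integrates to
      \<open>p \<bullet> D\<close> whatever \<open>q\<close> is, because the displacement is
      prescribed. Hence \<open>q\<close> enters only through the square of \<open>q - p\<close>,
      which is of second order.\<close>
    also have "I (\<lambda>r. (q \<bullet> e' r)\<^sup>2) = 2 * (p \<bullet> D) - I (\<lambda>r. (p \<bullet> e' r)\<^sup>2) + I (\<lambda>r. ((q - p) \<bullet> e' r)\<^sup>2)"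
    proof -
      have "I (\<lambda>r. (q \<bullet> e' r) * (p \<bullet> e' r)) = p \<bullet> D"
        using I_inner[of "\<lambda>r. (q \<bullet> e' r) *\<^sub>R e' r" p] qD by (simp add: bb bb')
      then have cross: "I (\<lambda>r. 2 * ((q \<bullet> e' r) * (p \<bullet> e' r))) = 2 * (p \<bullet> D)" by simp
      have "I (\<lambda>r. (q \<bullet> e' r)\<^sup>2) = I (\<lambda>r. (2 * ((q \<bullet> e' r) * (p \<bullet> e' r)) - (p \<bullet> e' r)\<^sup>2) + ((q - p) \<bullet> e' r)\<^sup>2)"
        by (simp add: inner_diff_left power2_eq_square algebra_simps)
      also have "\<dots> = I (\<lambda>r. 2 * ((q \<bullet> e' r) * (p \<bullet> e' r)) - (p \<bullet> e' r)\<^sup>2) + I (\<lambda>r. ((q - p) \<bullet> e' r)\<^sup>2)"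
        by (intro I_add bb bb')
      also have "I (\<lambda>r. 2 * ((q \<bullet> e' r) * (p \<bullet> e' r)) - (p \<bullet> e' r)\<^sup>2) =
         I (\<lambda>r. 2 * ((q \<bullet> e' r) * (p \<bullet> e' r))) - I (\<lambda>r. (p \<bullet> e' r)\<^sup>2)"
        by (intro I_diff bb bb')
      finally show ?thesis unfolding cross .
    qed
    also have "I (\<lambda>r. (w r + \<epsilon> * h r)\<^sup>2) = I (\<lambda>r. (w r)\<^sup>2) + 2 * \<epsilon> * I (\<lambda>r. w r * h r) + \<epsilon>\<^sup>2 * I (\<lambda>r. (h r)\<^sup>2)"
    proof -
      have "I (\<lambda>r. (w r + \<epsilon> * h r)\<^sup>2) = I (\<lambda>r. ((w r)\<^sup>2 + (2 * \<epsilon>) * (w r * h r)) + \<epsilon>\<^sup>2 * (h r)\<^sup>2)"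
        by (simp add: power2_eq_square algebra_simps)
      also have "\<dots> = I (\<lambda>r. (w r)\<^sup>2 + (2 * \<epsilon>) * (w r * h r)) + I (\<lambda>r. \<epsilon>\<^sup>2 * (h r)\<^sup>2)"
        by (intro I_add bb)
      also have "I (\<lambda>r. (w r)\<^sup>2 + (2 * \<epsilon>) * (w r * h r)) = I (\<lambda>r. (w r)\<^sup>2) + I (\<lambda>r. (2 * \<epsilon>) * (w r * h r))"
        by (intro I_add bb)
      finally show ?thesis by (simp only: integral_mult_right)
    qed
    finally have main: "T \<le> 2 * (p \<bullet> D) - I (\<lambda>r. (p \<bullet> e' r)\<^sup>2) + I (\<lambda>r. ((q - p) \<bullet> e' r)\<^sup>2) +
       (I (\<lambda>r. (w r)\<^sup>2) + 2 * \<epsilon> * I (\<lambda>r. w r * h r) + \<epsilon>\<^sup>2 * I (\<lambda>r. (h r)\<^sup>2))" .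
    have "I (\<lambda>r. ((q - p) \<bullet> e' r)\<^sup>2) \<le> I (\<lambda>r. (c * \<bar>\<epsilon>\<bar>)\<^sup>2)"
    proof (rule I_mono)
      fix r
      have "\<bar>(q - p) \<bullet> e' r\<bar> \<le> c * \<bar>\<epsilon>\<bar>" using Cauchy_Schwarz_ineq2[of "q - p" "e' r"] ne'[of r] qp by simp
      then show "((q - p) \<bullet> e' r)\<^sup>2 \<le> (c * \<bar>\<epsilon>\<bar>)\<^sup>2" by (rule abs_le_square_iff[THEN iffD1, OF order_trans]) simp
    qed (intro bb bb')+
    also have "\<dots> = \<epsilon>\<^sup>2 * (T * c\<^sup>2)" using T_pos by (simp add: power_mult_distrib)
    finally have X: "I (\<lambda>r. ((q - p) \<bullet> e' r)\<^sup>2) \<le> \<epsilon>\<^sup>2 * (T * c\<^sup>2)" .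
    define Z where "Z = I (\<lambda>r. \<eta> r * ((p \<bullet> e r) * (p \<bullet> (\<i> * e r))))"
    have "I (\<lambda>r. (p \<bullet> e r) *\<^sub>R e r) = D"
      using projection_integral[OF norm_e bounded_borel_base(1), of p] p by (simp only: K_def[symmetric] D_def)
    then have pe2: "I (\<lambda>r. (p \<bullet> e r)\<^sup>2) = p \<bullet> D"
      using I_inner[of "\<lambda>r. (p \<bullet> e r) *\<^sub>R e r" p] by (simp add: bb power2_eq_square)
    have "2 * \<epsilon> * Z - 5 * (norm p)\<^sup>2 * \<epsilon>\<^sup>2 * I (\<lambda>r. (\<eta> r)\<^sup>2) =
      I (\<lambda>r. (2 * \<epsilon>) * (\<eta> r * ((p \<bullet> e r) * (p \<bullet> (\<i> * e r)))) - (5 * (norm p)\<^sup>2 * \<epsilon>\<^sup>2) * (\<eta> r)\<^sup>2)"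
      unfolding Z_def by (subst I_diff) (intro bb | simp only: integral_mult_right)+
    also have "\<dots> \<le> I (\<lambda>r. (p \<bullet> e' r)\<^sup>2 - (p \<bullet> e r)\<^sup>2)"
    proof (rule I_mono)
      fix r
      show "(2 * \<epsilon>) * (\<eta> r * ((p \<bullet> e r) * (p \<bullet> (\<i> * e r)))) - (5 * (norm p)\<^sup>2 * \<epsilon>\<^sup>2) * (\<eta> r)\<^sup>2 \<le> (p \<bullet> e' r)\<^sup>2 - (p \<bullet> e r)\<^sup>2"
        using inner_square_rotation_ge[OF norm_e, of "\<epsilon> * \<eta> r" p r]
        by (simp add: e'_def power_mult_distrib mult_ac)
    qed (intro bb bb')+
    also have "\<dots> = I (\<lambda>r. (p \<bullet> e' r)\<^sup>2) - p \<bullet> D" unfolding pe2[symmetric] by (intro I_diff bb bb')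
    finally have Y: "2 * \<epsilon> * Z - 5 * (norm p)\<^sup>2 * \<epsilon>\<^sup>2 * I (\<lambda>r. (\<eta> r)\<^sup>2) \<le> I (\<lambda>r. (p \<bullet> e' r)\<^sup>2) - p \<bullet> D" .
    have Ceq: "C * \<epsilon>\<^sup>2 = 5 * (norm p)\<^sup>2 * \<epsilon>\<^sup>2 * I (\<lambda>r. (\<eta> r)\<^sup>2) + \<epsilon>\<^sup>2 * I (\<lambda>r. (h r)\<^sup>2) + \<epsilon>\<^sup>2 * (T * c\<^sup>2)"
      unfolding C_def by (simp add: algebra_simps)
    have "2 * \<epsilon> * (I (\<lambda>r. w r * h r) - Z) = 2 * \<epsilon> * I (\<lambda>r. w r * h r) - 2 * \<epsilon> * Z" by (rule right_diff_distrib)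
    then show "T \<le> p \<bullet> (b T - b 0) + I (\<lambda>r. (w r)\<^sup>2)
      + 2 * \<epsilon> * (I (\<lambda>r. w r * h r) - I (\<lambda>r. \<eta> r * ((p \<bullet> e r) * (p \<bullet> (\<i> * e r))))) + C * \<epsilon>\<^sup>2"
      unfolding Z_def[symmetric] D_def[symmetric] using main X Y Ceq by linarith
  qed
qed

end

section \<open>The geodesic equation\<close>

lemma nonincreasing_if_derivative_nonpos:
  fixes g :: "real \<Rightarrow> real"
  assumes "a \<le> b" and g: "\<And>x. x \<in> {a..b} \<Longrightarrow> (g has_real_derivative g' x) (at x within {a..b})"
    and "\<And>x. x \<in> {a..b} \<Longrightarrow> g' x \<le> 0"
  shows "g b \<le> g a"
proof (rule DERIV_nonpos_imp_decreasing_open[OF \<open>a \<le> b\<close>])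
  show "continuous_on {a..b} g" using g by (rule DERIV_continuous_on)
  fix x assume "a < x" "x < b"
  then show "\<exists>y. DERIV g x :> y \<and> y \<le> 0"
    using g[of x] assms(3)[of x] by (intro exI[of _ "g' x"]) (simp add: at_within_Icc_at)
qed

lemma has_real_derivative_power2:
  assumes "(y has_real_derivative Y) (at x within S)"
  shows "((\<lambda>r. (y r)\<^sup>2) has_real_derivative 2 * y x * Y) (at x within S)"
  using assms by (auto intro!: derivative_eq_intros)

lemma constant_if_derivative_zero:
  fixes g :: "real \<Rightarrow> real"
  assumes "x \<in> {a..b}" and g: "\<And>x. x \<in> {a..b} \<Longrightarrow> (g has_real_derivative 0) (at x within {a..b})"
  shows "g x = g a"
proof -
  have "\<exists>c. \<forall>x\<in>{a..b}. g x = c"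
    by (rule has_field_derivative_zero_constant) (use g in auto)
  then show ?thesis using assms(1) by force
qed

text \<open>The front track of a normal geodesic with momentum \<open>p\<close>, written as an equation for the unit
  tangent \<open>u\<close> and the curvature \<open>k\<close>.\<close>

definition geodesic_ode :: "real \<Rightarrow> complex \<Rightarrow> real set \<Rightarrow> (real \<Rightarrow> complex) \<Rightarrow> (real \<Rightarrow> real) \<Rightarrow> bool" where
  "geodesic_ode l p S u k \<longleftrightarrow> (\<forall>s\<in>S. norm (u s) = 1 \<and> (l * k s)\<^sup>2 = (norm (u s - p))\<^sup>2 \<and>
     (u has_vector_derivative k s *\<^sub>R (\<i> * u s)) (at s within S) \<and>
     (k has_real_derivative - (p \<bullet> (\<i> * u s)) / l\<^sup>2) (at s within S))"

lemma geodesic_ode_subset: "geodesic_ode l p S u k \<Longrightarrow> S' \<subseteq> S \<Longrightarrow> geodesic_ode l p S' u k"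
  unfolding geodesic_ode_def
  by (meson has_vector_derivative_within_subset has_field_derivative_subset subsetD)

text \<open>Gronwall's argument for the squared distance \<open>d\<close>: from
  \<open>d' \<le> C * d\<close> the function \<open>exp (- C * r) * d r\<close> is nonincreasing.
  The curvatures do not enter \<open>C\<close>, since the part of the difference that carries the
  factor \<open>k1\<close> is orthogonal to \<open>u1 - u2\<close>.\<close>

lemma geodesic_ode_unique:
  assumes 1: "geodesic_ode l p {0..T} u1 k1" and 2: "geodesic_ode l p {0..T} u2 k2"
    and init: "u1 0 = u2 0" "k1 0 = k2 0" and s: "s \<in> {0..T}" and l: "l > 0"
  shows "u1 s = u2 s \<and> k1 s = k2 s"
proof -
  define d where "d r = (u1 r - u2 r) \<bullet> (u1 r - u2 r) + (k1 r - k2 r)\<^sup>2" for r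
  define d' where "d' r = 2 * ((u1 r - u2 r) \<bullet> (k1 r *\<^sub>R (\<i> * u1 r) - k2 r *\<^sub>R (\<i> * u2 r)))
     + 2 * (k1 r - k2 r) * (- (p \<bullet> (\<i> * u1 r)) / l\<^sup>2 - - (p \<bullet> (\<i> * u2 r)) / l\<^sup>2)" for r
  define C where "C = 1 + norm p / l\<^sup>2"
  have C: "C \<ge> 0" by (simp add: C_def)
  have deriv: "(d has_real_derivative d' r) (at r within {0..T})" if r: "r \<in> {0..T}" for r
  proof -
    have u: "((\<lambda>r. u1 r - u2 r) has_vector_derivative (k1 r *\<^sub>R (\<i> * u1 r) - k2 r *\<^sub>R (\<i> * u2 r))) (at r within {0..T})"
      using 1 2 r unfolding geodesic_ode_def by (intro has_vector_derivative_diff) auto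
    have k: "((\<lambda>r. k1 r - k2 r) has_real_derivative (- (p \<bullet> (\<i> * u1 r)) / l\<^sup>2 - - (p \<bullet> (\<i> * u2 r)) / l\<^sup>2)) (at r within {0..T})"
      using 1 2 r unfolding geodesic_ode_def by (intro DERIV_diff) auto
    have "((\<lambda>r. (u1 r - u2 r) \<bullet> (u1 r - u2 r)) has_real_derivative
       2 * ((u1 r - u2 r) \<bullet> (k1 r *\<^sub>R (\<i> * u1 r) - k2 r *\<^sub>R (\<i> * u2 r)))) (at r within {0..T})"
      using bounded_bilinear.has_vector_derivative[OF bounded_bilinear_inner u u]
      by (simp add: has_real_derivative_iff_has_vector_derivative inner_commute)
    moreover have "((\<lambda>r. (k1 r - k2 r)\<^sup>2) has_real_derivative
       2 * (k1 r - k2 r) * (- (p \<bullet> (\<i> * u1 r)) / l\<^sup>2 - - (p \<bullet> (\<i> * u2 r)) / l\<^sup>2)) (at r within {0..T})"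
      by (rule has_real_derivative_power2[OF k])
    ultimately show ?thesis unfolding d_def[abs_def] d'_def by (rule DERIV_add)
  qed
  have d'_le: "d' r \<le> C * d r" if r: "r \<in> {0..T}" for r
  proof -
    define x where "x = u1 r - u2 r"
    define y where "y = k1 r - k2 r"
    have "x \<bullet> (k1 r *\<^sub>R (\<i> * u1 r) - k2 r *\<^sub>R (\<i> * u2 r)) = y * (x \<bullet> (\<i> * u2 r))"
      by (simp add: x_def y_def inner_complex_def algebra_simps)
    moreover have "- (p \<bullet> (\<i> * u1 r)) / l\<^sup>2 - - (p \<bullet> (\<i> * u2 r)) / l\<^sup>2 = - (p \<bullet> (\<i> * x)) / l\<^sup>2"
      by (simp add: x_def inner_diff_right right_diff_distrib diff_divide_distrib)
    ultimately have "d' r = 2 * (y * (x \<bullet> (\<i> * u2 r))) + 2 * y * (- (p \<bullet> (\<i> * x)) / l\<^sup>2)"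
      by (simp only: d'_def x_def[symmetric] y_def[symmetric])
    also have "\<dots> \<le> 2 * (\<bar>y\<bar> * norm x) + 2 * \<bar>y\<bar> * (norm p * norm x / l\<^sup>2)"
    proof (rule add_mono)
      have "norm (u2 r) = 1" using 2 r by (simp add: geodesic_ode_def)
      then have "\<bar>x \<bullet> (\<i> * u2 r)\<bar> \<le> norm x" using Cauchy_Schwarz_ineq2[of x "\<i> * u2 r"] by (simp add: norm_mult)
      then have "\<bar>y * (x \<bullet> (\<i> * u2 r))\<bar> \<le> \<bar>y\<bar> * norm x" by (simp add: abs_mult mult_left_mono)
      then show "2 * (y * (x \<bullet> (\<i> * u2 r))) \<le> 2 * (\<bar>y\<bar> * norm x)" by simp
      have "\<bar>p \<bullet> (\<i> * x)\<bar> \<le> norm p * norm x" using Cauchy_Schwarz_ineq2[of p "\<i> * x"] by (simp add: norm_mult)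
      then have "\<bar>2 * y * (- (p \<bullet> (\<i> * x)) / l\<^sup>2)\<bar> \<le> 2 * \<bar>y\<bar> * (norm p * norm x / l\<^sup>2)"
        by (simp add: abs_mult mult_left_mono divide_right_mono)
      then show "2 * y * (- (p \<bullet> (\<i> * x)) / l\<^sup>2) \<le> 2 * \<bar>y\<bar> * (norm p * norm x / l\<^sup>2)" by (rule abs_le_D1)
    qed
    also have "\<dots> = C * (2 * \<bar>y\<bar> * norm x)" by (simp add: C_def algebra_simps)
    also have "\<dots> \<le> C * d r"
    proof (rule mult_left_mono[OF _ C])
      have "0 \<le> (\<bar>y\<bar> - norm x)\<^sup>2" by simp
      then show "2 * \<bar>y\<bar> * norm x \<le> d r"
        unfolding d_def x_def[symmetric] y_def[symmetric] dot_square_norm by (simp add: power2_diff)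
    qed
    finally show ?thesis .
  qed
  have "exp (- C * s) * d s \<le> exp (- C * 0) * d 0"
  proof (rule nonincreasing_if_derivative_nonpos[where g = "\<lambda>r. exp (- C * r) * d r"
        and g' = "\<lambda>r. exp (- C * r) * (d' r - C * d r)"])
    fix r assume "r \<in> {0..s}"
    then have r: "r \<in> {0..T}" using s by auto
    have "((\<lambda>r. exp (- C * r) * d r) has_real_derivative exp (- C * r) * (d' r - C * d r)) (at r within {0..T})"
      by (rule derivative_eq_intros refl deriv[OF r] | simp add: algebra_simps)+
    then show "((\<lambda>r. exp (- C * r) * d r) has_real_derivative exp (- C * r) * (d' r - C * d r)) (at r within {0..s})"
      by (rule has_field_derivative_subset) (use s in auto)
    show "exp (- C * r) * (d' r - C * d r) \<le> 0" using d'_le[OF r] by (simp add: mult_nonneg_nonpos)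
  qed (use s in auto)
  moreover have "d 0 = 0" using init by (simp add: d_def)
  ultimately have "d s \<le> 0" by (simp add: mult_le_0_iff)
  moreover have "(norm (u1 s - u2 s))\<^sup>2 \<ge> 0" "(k1 s - k2 s)\<^sup>2 \<ge> 0" by simp_all
  ultimately have "(norm (u1 s - u2 s))\<^sup>2 = 0" "(k1 s - k2 s)\<^sup>2 = 0"
    unfolding d_def dot_square_norm by linarith+
  then show ?thesis by simp
qed

context minimizing_arc
begin

text \<open>As \<open>v\<close> and \<open>p \<bullet> e\<close> produce the same displacement, the
  integral of \<open>(v - p \<bullet> e)\<^sup>2\<close> is that of \<open>v\<^sup>2\<close> minus
  \<open>p \<bullet> D\<close>, which minimality makes nonpositive. For \<open>w\<close> the
  variation is tested with its own deviation from the expected primitive, as in the lemma of du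
  Bois-Reymond. The last identity serves to normalize the conserved energy to 1.\<close>

lemma euler_lagrange:
  assumes K: "norm K < T"
  obtains p W where "continuous_on UNIV W" "bounded_borel W"
    "\<And>s s'. \<lbrakk>0 \<le> s; s \<le> s'; s' \<le> T\<rbrakk> \<Longrightarrow> ((\<lambda>r. (p \<bullet> e r) *\<^sub>R e r) has_integral b s' - b s) {s..s'}"
    "\<And>s s'. \<lbrakk>0 \<le> s; s \<le> s'; s' \<le> T\<rbrakk> \<Longrightarrow> ((\<lambda>r. (W r / l) *\<^sub>R (\<i> * e r)) has_integral e s' - e s) {s..s'}"
    "\<And>s s'. \<lbrakk>0 \<le> s; s \<le> s'; s' \<le> T\<rbrakk> \<Longrightarrow> ((\<lambda>r. - ((p \<bullet> e r) * (p \<bullet> (\<i> * e r))) / l) has_integral W s' - W s) {s..s'}"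
    "T = I (\<lambda>r. (p \<bullet> e r)\<^sup>2) + I (\<lambda>r. (W r)\<^sup>2)"
proof -
  define D where "D = b T - b 0"
  have T0: "0 \<le> T" using T_pos by simp
  note bb = bounded_borel_intros bounded_borel_base
  obtain p where p: "(1 / 2) *\<^sub>R (T *\<^sub>R p + K * cnj p) = b T - b 0" using solve_projection[OF K] .
  have peD: "I (\<lambda>r. (p \<bullet> e r) *\<^sub>R e r) = D"
    using projection_integral[OF norm_e bounded_borel_base(1), of p] p by (simp only: K_def[symmetric] D_def)
  have pe2: "I (\<lambda>r. (p \<bullet> e r)\<^sup>2) = p \<bullet> D"
    using I_inner[of "\<lambda>r. (p \<bullet> e r) *\<^sub>R e r" p] peD by (simp add: bb power2_eq_square)
  have vD: "I (\<lambda>r. v r *\<^sub>R e r) = D" using b_has_integral[of 0 T] T0 by (simp add: integral_unique D_def)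
  have vpe: "I (\<lambda>r. v r * (p \<bullet> e r)) = p \<bullet> D"
    using I_inner[of "\<lambda>r. v r *\<^sub>R e r" p] vD by (simp add: bb)
  have E1: "T \<le> I (\<lambda>r. (p \<bullet> e r)\<^sup>2) + I (\<lambda>r. (w r)\<^sup>2)"
  proof (rule T_le_energy[where e' = e])
    show "I (\<lambda>r. (p \<bullet> e r) *\<^sub>R e r) = b T - b 0" using peD by (simp only: D_def)
    show "bounded_borel (\<lambda>r. p \<bullet> e r)" "bounded_borel w" by (intro bb)+
  qed (simp_all add: e_has_integral continuous_intros)
  have "I (\<lambda>r. (v r)\<^sup>2) + I (\<lambda>r. (w r)\<^sup>2) = I (\<lambda>r. (v r)\<^sup>2 + (w r)\<^sup>2)" by (intro I_add[symmetric] bb)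
  also have "\<dots> \<le> I (\<lambda>r. 1)" by (intro I_mono v2_w2 bb)
  finally have E2: "I (\<lambda>r. (v r)\<^sup>2) + I (\<lambda>r. (w r)\<^sup>2) \<le> T" using T0 by simp
  have sq: "I (\<lambda>r. (v r - p \<bullet> e r)\<^sup>2) = I (\<lambda>r. (v r)\<^sup>2) - p \<bullet> D"
  proof -
    have "I (\<lambda>r. (v r - p \<bullet> e r)\<^sup>2) = I (\<lambda>r. ((v r)\<^sup>2 - 2 * (v r * (p \<bullet> e r))) + (p \<bullet> e r)\<^sup>2)"
      by (simp add: power2_eq_square algebra_simps)
    also have "\<dots> = I (\<lambda>r. (v r)\<^sup>2 - 2 * (v r * (p \<bullet> e r))) + I (\<lambda>r. (p \<bullet> e r)\<^sup>2)" by (intro I_add bb)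
    also have "I (\<lambda>r. (v r)\<^sup>2 - 2 * (v r * (p \<bullet> e r))) = I (\<lambda>r. (v r)\<^sup>2) - I (\<lambda>r. 2 * (v r * (p \<bullet> e r)))"
      by (intro I_diff bb)
    finally show ?thesis using vpe pe2 by simp
  qed
  have "I (\<lambda>r. (v r - p \<bullet> e r)\<^sup>2) \<ge> 0"
    by (rule integral_nonneg[OF bounded_borel_integrable]) (intro bb | simp)+
  moreover have "I (\<lambda>r. (v r)\<^sup>2) \<le> p \<bullet> D" 
    using order_trans[OF E2 E1[unfolded pe2]] by (simp only: add_le_cancel_right)
  ultimately have vv: "I (\<lambda>r. (v r)\<^sup>2) = p \<bullet> D" unfolding sq by simp
  then have v0: "I (\<lambda>r. (v r - p \<bullet> e r)\<^sup>2) = 0" unfolding sq by simp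
  have Teq: "T = p \<bullet> D + I (\<lambda>r. (w r)\<^sup>2)"
    using E1 E2 unfolding pe2 vv by (rule antisym)
  have aev: "AE r in lborel. r \<in> {0..T} \<longrightarrow> v r = p \<bullet> e r"
  proof -
    have "((\<lambda>r. (v r - p \<bullet> e r)\<^sup>2) has_integral I (\<lambda>r. (v r - p \<bullet> e r)\<^sup>2)) {0..T}"
      by (intro integrable_integral bounded_borel_integrable bb)
    from this[unfolded v0] have "AE r in lborel. r \<in> {0..T} \<longrightarrow> (v r - p \<bullet> e r)\<^sup>2 = 0"
      by (intro AE_eq_0_if_integral_0) (auto intro!: bounded_borel_measurable bb)
    then show ?thesis by eventually_elim simp
  qed
  define g where "g r = - ((p \<bullet> e r) * (p \<bullet> (\<i> * e r))) / l" for r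
  have bg: "bounded_borel g"
  proof -
    have "g = (\<lambda>r. (- 1 / l) * ((p \<bullet> e r) * (p \<bullet> (\<i> * e r))))" by (simp add: g_def fun_eq_iff)
    then show ?thesis by (simp only:) (intro bb)
  qed
  define R where "R s = integral {0..max 0 (min T s)} g" for s
  have R: "continuous_on UNIV R" "bounded_borel R"
    "\<And>s s'. \<lbrakk>0 \<le> s; s \<le> s'; s' \<le> T\<rbrakk> \<Longrightarrow> (g has_integral R s' - R s) {s..s'}"
    unfolding R_def using clamped_integral[OF T0 bg] by auto
  \<comment> \<open>Subtracting the mean gives \<open>h\<close> integral zero, so \<eta> vanishes at
    both ends and the variation keeps the end points.\<close>
  define m where "m = I (\<lambda>r. w r - R r) / T"
  define h where "h r = w r - R r - m" for r
  have bh: "bounded_borel h" unfolding h_def by (intro bb R)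
  have "I h = I (\<lambda>r. w r - R r) - I (\<lambda>r. m)" unfolding h_def by (intro I_diff bb R)
  then have Ih: "I h = 0" using T_pos by (simp add: m_def)
  have bhl: "bounded_borel (\<lambda>r. h r / l)"
    using bounded_borel_mult[OF bh bounded_borel_const[of "1 / l"]] by simp
  define \<eta> where "\<eta> s = integral {0..max 0 (min T s)} (\<lambda>r. h r / l)" for s
  have \<eta>: "continuous_on UNIV \<eta>" "bounded_borel \<eta>"
    "\<And>s s'. \<lbrakk>0 \<le> s; s \<le> s'; s' \<le> T\<rbrakk> \<Longrightarrow> ((\<lambda>r. h r / l) has_integral \<eta> s' - \<eta> s) {s..s'}"
    unfolding \<eta>_def using clamped_integral[OF T0 bhl] by auto
  have \<eta>0: "\<eta> 0 = 0" by (simp add: \<eta>_def T0)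
  have \<eta>T: "\<eta> T = 0" using Ih T0 by (simp add: \<eta>_def)
  define Z where "Z = I (\<lambda>r. \<eta> r * ((p \<bullet> e r) * (p \<bullet> (\<i> * e r))))"
  define J where "J = I (\<lambda>r. (h r)\<^sup>2)"
  have Z: "Z = I (\<lambda>r. h r * R r)"
  proof -
    have "((\<lambda>r. h r / l * R r + \<eta> r * g r) has_integral \<eta> T * R T - \<eta> 0 * R 0) {0..T}"
      by (rule has_integral_product) (use \<eta> R bhl bg T0 in auto)
    then have "I (\<lambda>r. h r / l * R r + \<eta> r * g r) = 0" using \<eta>0 \<eta>T by (simp add: integral_unique)
    then have "I (\<lambda>r. l * (h r / l * R r + \<eta> r * g r)) = 0" by (simp only: integral_mult_right mult_zero_right)
    moreover have "(\<lambda>r. l * (h r / l * R r + \<eta> r * g r)) = (\<lambda>r. h r * R r - \<eta> r * ((p \<bullet> e r) * (p \<bullet> (\<i> * e r))))"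
      using l_pos by (simp add: fun_eq_iff g_def algebra_simps)
    ultimately have "I (\<lambda>r. h r * R r - \<eta> r * ((p \<bullet> e r) * (p \<bullet> (\<i> * e r)))) = 0" by (simp only:)
    moreover have "I (\<lambda>r. h r * R r - \<eta> r * ((p \<bullet> e r) * (p \<bullet> (\<i> * e r)))) = I (\<lambda>r. h r * R r) - Z"
      unfolding Z_def by (intro I_diff bb bh R \<eta>)
    ultimately show ?thesis by simp
  qed
  \<comment> \<open>After integration by parts the first variation in direction \<open>h\<close> is
    the integral of \<open>h\<^sup>2\<close>; the constant \<open>m\<close> drops out because
    \<open>h\<close> has mean zero.\<close>
  have slope: "I (\<lambda>r. w r * h r) - Z = J"
  proof -
    have "I (\<lambda>r. w r * h r) - Z = I (\<lambda>r. w r * h r - h r * R r)" unfolding Z by (intro I_diff[symmetric] bb bh R)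
    also have "(\<lambda>r. w r * h r - h r * R r) = (\<lambda>r. (h r)\<^sup>2 + m * h r)"
      by (simp add: h_def fun_eq_iff power2_eq_square algebra_simps)
    also have "I (\<lambda>r. (h r)\<^sup>2 + m * h r) = I (\<lambda>r. (h r)\<^sup>2) + I (\<lambda>r. m * h r)" by (intro I_add bb bh)
    finally show ?thesis using Ih by (simp add: J_def)
  qed
  obtain C \<epsilon>0 where \<epsilon>0: "\<epsilon>0 > 0" and ineq: "\<forall>\<epsilon>. \<bar>\<epsilon>\<bar> \<le> \<epsilon>0 \<longrightarrow> T \<le> p \<bullet> (b T - b 0) + I (\<lambda>r. (w r)\<^sup>2)
      + 2 * \<epsilon> * (I (\<lambda>r. w r * h r) - I (\<lambda>r. \<eta> r * ((p \<bullet> e r) * (p \<bullet> (\<i> * e r))))) + C * \<epsilon>\<^sup>2"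
    using variation_inequality[OF K p bh \<eta>(2,1) \<eta>0 \<eta>T \<eta>(3)] .
  \<comment> \<open>Testing with \<open>- \<delta>\<close>: to first order the right-hand side would
    fall below \<open>T\<close> if \<open>J\<close> were positive.\<close>
  have J_le: "2 * J \<le> C * \<delta>" if "0 < \<delta>" "\<delta> \<le> \<epsilon>0" for \<delta>
  proof -
    have "T \<le> p \<bullet> (b T - b 0) + I (\<lambda>r. (w r)\<^sup>2) + 2 * (- \<delta>) * J + C * (- \<delta>)\<^sup>2"
      using ineq[rule_format, of "- \<delta>"] that slope by (simp add: Z_def)
    then have "\<delta> * (2 * J) \<le> \<delta> * (C * \<delta>)" using Teq by (simp add: D_def power2_eq_square mult_ac)
    then show ?thesis using that by simp
  qed
  have J_neg: "J \<le> 0"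
  proof (rule ccontr)
    assume "\<not> J \<le> 0"
    then have J: "J > 0" by simp
    define \<delta> where "\<delta> = min \<epsilon>0 (J / (\<bar>C\<bar> + 1))"
    have \<delta>: "0 < \<delta>" "\<delta> \<le> \<epsilon>0" using \<epsilon>0 J by (auto simp: \<delta>_def)
    have "C * \<delta> \<le> (\<bar>C\<bar> + 1) * \<delta>" using \<delta> by (intro mult_right_mono) auto
    also have "\<dots> \<le> (\<bar>C\<bar> + 1) * (J / (\<bar>C\<bar> + 1))" unfolding \<delta>_def by (intro mult_left_mono) auto
    also have "\<dots> = J" by simp
    finally show False using J_le[OF \<delta>] J by simp
  qed
  have "J \<ge> 0" unfolding J_def
    by (rule integral_nonneg[OF bounded_borel_integrable]) (intro bb bh | simp)+
  with J_neg have J0: "J = 0" by simp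
  have aew: "AE r in lborel. r \<in> {0..T} \<longrightarrow> w r = R r + m"
  proof -
    have "((\<lambda>r. (h r)\<^sup>2) has_integral J) {0..T}"
      unfolding J_def by (intro integrable_integral bounded_borel_integrable bb bh)
    from this[unfolded J0] have "AE r in lborel. r \<in> {0..T} \<longrightarrow> (h r)\<^sup>2 = 0"
      by (intro AE_eq_0_if_integral_0) (auto intro!: bounded_borel_measurable bb bh)
    then show ?thesis by eventually_elim (simp add: h_def diff_eq_eq add.commute)
  qed
  show thesis
  proof (rule that[of "\<lambda>r. R r + m" p])
    show "continuous_on UNIV (\<lambda>r. R r + m)" by (intro continuous_intros R)
    show "bounded_borel (\<lambda>r. R r + m)" by (intro bb R)
    have "((\<lambda>r. (w r)\<^sup>2) has_integral I (\<lambda>r. (w r)\<^sup>2)) {0..T}"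
      by (intro integrable_integral bounded_borel_integrable bb)
    note wI = this
    have "AE r in lborel. r \<in> {0..T} \<longrightarrow> (w r)\<^sup>2 = (R r + m)\<^sup>2" using aew by eventually_elim simp
    then have "((\<lambda>r. (R r + m)\<^sup>2) has_integral I (\<lambda>r. (w r)\<^sup>2)) {0..T}" by (rule iffD1[OF has_integral_AE wI])
    then show "T = I (\<lambda>r. (p \<bullet> e r)\<^sup>2) + I (\<lambda>r. (R r + m)\<^sup>2)" using Teq pe2 by (simp add: integral_unique)
    fix s s' assume s: "0 \<le> s" "s \<le> s'" "s' \<le> T"
    have "AE r in lborel. r \<in> {s..s'} \<longrightarrow> v r *\<^sub>R e r = (p \<bullet> e r) *\<^sub>R e r"
      using aev by eventually_elim (use s in auto)
    then show "((\<lambda>r. (p \<bullet> e r) *\<^sub>R e r) has_integral b s' - b s) {s..s'}"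
      by (rule iffD1[OF has_integral_AE b_has_integral[OF s]])
    have "AE r in lborel. r \<in> {s..s'} \<longrightarrow> (w r / l) *\<^sub>R (\<i> * e r) = ((R r + m) / l) *\<^sub>R (\<i> * e r)"
      using aew by eventually_elim (use s in auto)
    then show "((\<lambda>r. ((R r + m) / l) *\<^sub>R (\<i> * e r)) has_integral e s' - e s) {s..s'}"
      by (rule iffD1[OF has_integral_AE e_has_integral[OF s]])
    show "((\<lambda>r. - ((p \<bullet> e r) * (p \<bullet> (\<i> * e r))) / l) has_integral (R s' + m) - (R s + m)) {s..s'}"
      using R(3)[OF s] by (simp add: g_def[abs_def])
  qed
qed

text \<open>The triangle inequality for the integral of \<open>e\<^sup>2\<close> is an equality
  here, so \<open>e\<^sup>2\<close> and by continuity \<open>e\<close> are constant, and the bicycle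
  moves along the line of its frame. Comparison with motion at constant velocity to the same end
  point excludes turning back.\<close>

lemma straight_if_degenerate:
  assumes deg: "\<not> norm K < T"
  obtains x where "norm x = 1" "\<forall>s\<in>{0..T}. f s = f 0 + s *\<^sub>R x"
proof -
  have T0: "0 \<le> T" using T_pos by simp
  have K0: "norm K > 0" using deg T_pos by linarith
  define \<kappa> where "\<kappa> = (1 / norm K) *\<^sub>R K"
  have n\<kappa>: "norm \<kappa> = 1" using K0 by (simp add: \<kappa>_def)
  have \<kappa>K: "\<kappa> \<bullet> K = norm K" using K0 by (simp add: \<kappa>_def dot_square_norm power2_eq_square)
  define z where "z r = 1 - \<kappa> \<bullet> (e r)\<^sup>2" for r
  have Iz: "I z = T - norm K"
  proof -
    have "I z = I (\<lambda>r. 1) - I (\<lambda>r. \<kappa> \<bullet> (e r)\<^sup>2)"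
      unfolding z_def by (intro I_diff bounded_borel_intros e_sq)
    also have "I (\<lambda>r. \<kappa> \<bullet> (e r)\<^sup>2) = norm K" by (simp only: I_inner[OF e_sq] K_def[symmetric] \<kappa>K)
    finally show ?thesis using T0 by simp
  qed
  have z_nonneg: "z r \<ge> 0" for r
    using Cauchy_Schwarz_ineq2[of \<kappa> "(e r)\<^sup>2"] n\<kappa> by (simp add: z_def norm_power abs_le_iff)
  have z_cont: "continuous_on {0..T} z" unfolding z_def by (intro continuous_intros)
  have "I z \<ge> 0" by (rule integral_nonneg[OF integrable_continuous_real[OF z_cont] z_nonneg])
  then have "I z = 0" using Iz deg by linarith
  then have z0: "z r = 0" if "r \<in> {0..T}" for r
    using integral_eq_0_iff[OF z_cont T_pos z_nonneg] that by blast
  have e2: "(e r)\<^sup>2 = \<kappa>" if "r \<in> {0..T}" for r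
  proof -
    have "(norm ((e r)\<^sup>2 - \<kappa>))\<^sup>2 = (norm ((e r)\<^sup>2))\<^sup>2 + (norm \<kappa>)\<^sup>2 - 2 * (\<kappa> \<bullet> (e r)\<^sup>2)"
      unfolding power2_norm_eq_inner by (simp add: inner_diff_left inner_diff_right inner_commute)
    then show ?thesis using z0[OF that] n\<kappa> by (simp add: z_def norm_power)
  qed
  have in0: "0 \<in> {0..T}" "T \<in> {0..T}" using T0 by auto
  define c where "c = e 0"
  have "e ` {0..T} \<subseteq> {c, - c}"
  proof
    fix y assume "y \<in> e ` {0..T}"
    then obtain r where "r \<in> {0..T}" "y = e r" by blast
    then have "y\<^sup>2 = c\<^sup>2" using e2 e2[OF in0(1)] by (simp add: c_def)
    then show "y \<in> {c, - c}" by (simp add: power2_eq_iff)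
  qed
  then have "finite (e ` {0..T})" using finite_subset by blast
  then have "e constant_on {0..T}"
    by (intro continuous_finite_range_constant continuous_intros) (auto simp: is_interval_connected)
  then have ec: "e r = c" if "r \<in> {0..T}" for r using that in0 unfolding c_def constant_on_def by metis
  have nc: "norm c = 1" by (simp add: c_def)
  define x where "x s = integral {0..s} v" for s
  have bx: "b s - b 0 = x s *\<^sub>R c" if "s \<in> {0..T}" for s
  proof -
    have "((\<lambda>r. v r *\<^sub>R e r) has_integral b s - b 0) {0..s}" using that by (intro b_has_integral) auto
    then have "((\<lambda>r. v r *\<^sub>R c) has_integral b s - b 0) {0..s}"
      by (rule has_integral_cong[THEN iffD1, rotated]) (use that ec in auto)
    moreover have "((\<lambda>r. v r *\<^sub>R c) has_integral x s *\<^sub>R c) {0..s}"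
      unfolding x_def by (intro has_integral_scaleR_left integrable_integral bounded_borel_integrable bounded_borel_base)
    ultimately show ?thesis by (rule has_integral_unique)
  qed
  have fx: "f s = f 0 + x s *\<^sub>R c" if "s \<in> {0..T}" for s
    using bx[OF that] f_eq[OF that] f_eq[OF in0(1)] ec[OF that] ec[OF in0(1)] by (simp add: diff_eq_eq)
  have x0: "x 0 = 0" by (simp add: x_def)
  have xle: "\<bar>x s' - x s\<bar> \<le> s' - s" if "0 \<le> s" "s \<le> s'" "s' \<le> T" for s s'
  proof -
    have "f s' - f s = (x s' - x s) *\<^sub>R c" using fx[of s] fx[of s'] that by (simp add: scaleR_diff_left)
    then show ?thesis using front_le[OF that] nc by simp
  qed
  have "T \<le> I (\<lambda>r. (x T / T)\<^sup>2) + I (\<lambda>r. 0\<^sup>2)"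
  proof (rule T_le_energy[where e' = e])
    have "I (\<lambda>r. (x T / T) *\<^sub>R e r) = I (\<lambda>r. (x T / T) *\<^sub>R c)" by (rule integral_cong) (simp add: ec)
    also have "\<dots> = x T *\<^sub>R c" unfolding I_const using T_pos by simp
    finally show "I (\<lambda>r. (x T / T) *\<^sub>R e r) = b T - b 0" using bx[OF in0(2)] by simp
    fix s s' assume "0 \<le> s" "s \<le> s'" "s' \<le> T"
    then have "e s' = c" "e s = c" by (auto intro: ec)
    then show "((\<lambda>r. (0 / l) *\<^sub>R (\<i> * e r)) has_integral e s' - e s) {s..s'}" by simp
  qed (auto intro!: continuous_intros bounded_borel_intros)
  then have "T * T \<le> x T * x T" using T_pos by (simp add: power2_eq_square field_simps)
  then have "\<bar>T\<bar> \<le> \<bar>x T\<bar>" using abs_le_square_iff[of T "x T"] by (simp add: power2_eq_square)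
  then have xT: "\<bar>x T\<bar> = T" using xle[of 0 T] x0 T0 by simp
  define \<tau> where "\<tau> = x T / T"
  have \<tau>: "\<bar>\<tau>\<bar> = 1" using xT T_pos by (simp add: \<tau>_def)
  have xs: "x s = s * \<tau>" if s: "s \<in> {0..T}" for s
  proof -
    have "\<bar>x s\<bar> \<le> s" "\<bar>x T - x s\<bar> \<le> T - s" using xle[of 0 s] xle[of s T] s x0 by auto
    note bounds = this
    show ?thesis
    proof (cases "x T = T")
      case True
      then have "\<tau> = 1" "x s = s" using bounds T_pos by (simp_all add: \<tau>_def)
      then show ?thesis by simp
    next
      case False
      then have "x T = - T" using xT by linarith
      then have "\<tau> = - 1" "x s = - s" using bounds T_pos by (simp_all add: \<tau>_def)
      then show ?thesis by simp
    qed
  qed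
  show thesis
  proof (rule that[of "\<tau> *\<^sub>R c"])
    show "norm (\<tau> *\<^sub>R c) = 1" using nc \<tau> by simp
    show "\<forall>s\<in>{0..T}. f s = f 0 + s *\<^sub>R \<tau> *\<^sub>R c"
    proof
      fix s assume s: "s \<in> {0..T}"
      show "f s = f 0 + s *\<^sub>R \<tau> *\<^sub>R c" using fx[OF s] by (simp only: xs[OF s] scaleR_scaleR)
    qed
  qed
qed

lemma has_vector_derivative_if_has_integral:
  fixes G H :: "real \<Rightarrow> 'a::banach"
  assumes G: "continuous_on UNIV G"
    and H: "\<And>s s'. \<lbrakk>0 \<le> s; s \<le> s'; s' \<le> T\<rbrakk> \<Longrightarrow> (G has_integral H s' - H s) {s..s'}"
    and s: "s \<in> {0..T}"
  shows "(H has_vector_derivative G s) (at s within {0..T})"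
proof -
  have "continuous_on {0..T} G" using G by (rule continuous_on_subset) simp
  then have "((\<lambda>r. H 0 + integral {0..r} G) has_vector_derivative 0 + G s) (at s within {0..T})"
    by (intro has_vector_derivative_add has_vector_derivative_const integral_has_vector_derivative s)
  then have "((\<lambda>r. H 0 + integral {0..r} G) has_vector_derivative G s) (at s within {0..T})" by simp
  then show ?thesis
  proof (rule has_vector_derivative_transform[OF s, rotated])
    fix r assume "r \<in> {0..T}"
    then show "H r = H 0 + integral {0..r} G" using H[of 0 r] by (simp add: integral_unique)
  qed
qed

text \<open>With \<open>A = p \<bullet> e\<close> and \<open>B = p \<bullet> \<i> e\<close> the
  system preserves \<open>A\<^sup>2 + W\<^sup>2\<close>, whose mean value is 1, so the tangent
  \<open>u = A e + W \<i> e\<close> is a unit vector. As \<open>p = A e + B \<i> e\<close>, the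
  vector \<open>u - p\<close> lies along \<open>\<i> e\<close>; this ties the curvature to
  \<open>norm (u - p)\<close>.\<close>

lemma geodesic_if_nondegenerate:
  assumes "norm K < T"
  obtains p u k where "geodesic_ode l p {0..T} u k"
    "\<forall>s\<in>{0..T}. (f has_vector_derivative u s) (at s within {0..T})"
proof -
  obtain p W where W: "continuous_on UNIV W" "bounded_borel W"
    and bi: "\<And>s s'. \<lbrakk>0 \<le> s; s \<le> s'; s' \<le> T\<rbrakk> \<Longrightarrow> ((\<lambda>r. (p \<bullet> e r) *\<^sub>R e r) has_integral b s' - b s) {s..s'}"
    and ei: "\<And>s s'. \<lbrakk>0 \<le> s; s \<le> s'; s' \<le> T\<rbrakk> \<Longrightarrow> ((\<lambda>r. (W r / l) *\<^sub>R (\<i> * e r)) has_integral e s' - e s) {s..s'}"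
    and Wi: "\<And>s s'. \<lbrakk>0 \<le> s; s \<le> s'; s' \<le> T\<rbrakk> \<Longrightarrow> ((\<lambda>r. - ((p \<bullet> e r) * (p \<bullet> (\<i> * e r))) / l) has_integral W s' - W s) {s..s'}"
    and TI: "T = I (\<lambda>r. (p \<bullet> e r)\<^sup>2) + I (\<lambda>r. (W r)\<^sup>2)"
    by (rule euler_lagrange[OF assms]) (rule that, assumption+)
  have l0: "l \<noteq> 0" using l_pos by simp
  note cont = continuous_intros W(1) l0
  define A where "A s = p \<bullet> e s" for s
  define B where "B s = p \<bullet> (\<i> * e s)" for s
  have db: "(b has_vector_derivative A s *\<^sub>R e s) (at s within {0..T})" if "s \<in> {0..T}" for s
    unfolding A_def by (rule has_vector_derivative_if_has_integral[OF _ bi that]) (intro cont)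
  have de: "(e has_vector_derivative (W s / l) *\<^sub>R (\<i> * e s)) (at s within {0..T})" if "s \<in> {0..T}" for s
    by (rule has_vector_derivative_if_has_integral[OF _ ei that]) (intro cont | simp add: l0)+
  have dW: "(W has_real_derivative - (A s * B s) / l) (at s within {0..T})" if "s \<in> {0..T}" for s
    unfolding has_real_derivative_iff_has_vector_derivative A_def B_def
    by (rule has_vector_derivative_if_has_integral[OF _ Wi that]) (intro cont | simp add: l0)+
  have die: "((\<lambda>s. \<i> * e s) has_vector_derivative - (W s / l) *\<^sub>R e s) (at s within {0..T})" if "s \<in> {0..T}" for s
  proof -
    have "((\<lambda>s. \<i> * e s) has_vector_derivative \<i> * ((W s / l) *\<^sub>R (\<i> * e s))) (at s within {0..T})"
      by (rule has_vector_derivative_mult_right[OF de[OF that]])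
    moreover have "\<i> * ((W s / l) *\<^sub>R (\<i> * e s)) = - (W s / l) *\<^sub>R e s" by (simp add: complex_eq_iff)
    ultimately show ?thesis by (simp only:)
  qed
  have dA: "(A has_real_derivative W s / l * B s) (at s within {0..T})" if "s \<in> {0..T}" for s
    using bounded_linear.has_vector_derivative[OF bounded_linear_inner_right de[OF that], of p]
    unfolding A_def B_def has_real_derivative_iff_has_vector_derivative by simp
  have dB: "(B has_real_derivative - (W s / l) * A s) (at s within {0..T})" if "s \<in> {0..T}" for s
    using bounded_linear.has_vector_derivative[OF bounded_linear_inner_right die[OF that], of p]
    unfolding A_def B_def has_real_derivative_iff_has_vector_derivative by simp
  define E where "E s = (A s)\<^sup>2 + (W s)\<^sup>2" for s
  have E: "E s = E 0" if "s \<in> {0..T}" for s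
  proof (rule constant_if_derivative_zero[OF that])
    fix s assume s: "s \<in> {0..T}"
    have "(E has_real_derivative 2 * A s * (W s / l * B s) + 2 * W s * (- (A s * B s) / l)) (at s within {0..T})"
      unfolding E_def[abs_def] by (intro DERIV_add has_real_derivative_power2 dA dW s)
    then show "(E has_real_derivative 0) (at s within {0..T})" by (simp add: field_simps)
  qed
  have "T = I E" unfolding E_def A_def using TI W(2)
    by (subst I_add) (intro bounded_borel_intros bounded_borel_base | assumption | simp)+
  also have "I E = I (\<lambda>_. E 0)" by (rule integral_cong) (rule E)
  also have "\<dots> = T * E 0" using T_pos by simp
  finally have "E 0 = 1" using T_pos by simp
  then have E1: "(A s)\<^sup>2 + (W s)\<^sup>2 = 1" if "s \<in> {0..T}" for s using E[OF that] by (simp add: E_def)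
  define u where "u s = A s *\<^sub>R e s + W s *\<^sub>R (\<i> * e s)" for s
  define k where "k s = (W s - B s) / l" for s
  have iu: "\<i> * u s = A s *\<^sub>R (\<i> * e s) - W s *\<^sub>R e s" for s
    by (simp add: u_def complex_eq_iff)
  show thesis
  proof (rule that[of p u k])
    show "\<forall>s\<in>{0..T}. (f has_vector_derivative u s) (at s within {0..T})"
    proof
      fix s assume s: "s \<in> {0..T}"
      have "((\<lambda>s. b s + l *\<^sub>R e s) has_vector_derivative A s *\<^sub>R e s + l *\<^sub>R ((W s / l) *\<^sub>R (\<i> * e s))) (at s within {0..T})"
        by (intro has_vector_derivative_add db de s bounded_linear.has_vector_derivative[OF bounded_linear_scaleR_right])
      moreover have "A s *\<^sub>R e s + l *\<^sub>R ((W s / l) *\<^sub>R (\<i> * e s)) = u s" using l0 by (simp add: u_def)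
      ultimately have "((\<lambda>s. b s + l *\<^sub>R e s) has_vector_derivative u s) (at s within {0..T})" by (simp only:)
      then show "(f has_vector_derivative u s) (at s within {0..T})"
        by (rule has_vector_derivative_transform[OF s f_eq, rotated]) 
    qed
    show "geodesic_ode l p {0..T} u k" unfolding geodesic_ode_def
    proof (intro ballI conjI)
      fix s assume s: "s \<in> {0..T}"
      have uC: "u s = Complex (A s) (W s) * e s" by (simp add: u_def complex_eq_iff)
      show "norm (u s) = 1" unfolding uC norm_mult using E1[OF s] by (simp add: complex_norm)
      have "p = A s *\<^sub>R e s + B s *\<^sub>R (\<i> * e s)" unfolding A_def B_def by (rule orthonormal_expansion) simp
      then have "u s - p = (l * k s) *\<^sub>R (\<i> * e s)"
        using l0 by (simp add: u_def k_def scaleR_diff_left)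
      then show "(l * k s)\<^sup>2 = (norm (u s - p))\<^sup>2" by (simp only: norm_scaleR norm_ie) simp
      have "(u has_vector_derivative (A s *\<^sub>R ((W s / l) *\<^sub>R (\<i> * e s)) + (W s / l * B s) *\<^sub>R e s)
          + (W s *\<^sub>R (- (W s / l) *\<^sub>R e s) + (- (A s * B s) / l) *\<^sub>R (\<i> * e s))) (at s within {0..T})"
        unfolding u_def[abs_def] by (intro has_vector_derivative_add has_vector_derivative_scaleR dA de dW die s)
      moreover have "(A s *\<^sub>R ((W s / l) *\<^sub>R (\<i> * e s)) + (W s / l * B s) *\<^sub>R e s)
          + (W s *\<^sub>R (- (W s / l) *\<^sub>R e s) + (- (A s * B s) / l) *\<^sub>R (\<i> * e s)) = k s *\<^sub>R (\<i> * u s)"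
        unfolding iu k_def using l0 by (simp add: complex_eq_iff field_simps)
      ultimately show "(u has_vector_derivative k s *\<^sub>R (\<i> * u s)) (at s within {0..T})" by (simp only:)
      have "(k has_real_derivative (- (A s * B s) / l - - (W s / l) * A s) / l) (at s within {0..T})"
        unfolding k_def[abs_def] by (intro DERIV_cdivide DERIV_diff dW dB s)
      moreover have "(- (A s * B s) / l - - (W s / l) * A s) / l = - (p \<bullet> (\<i> * u s)) / l\<^sup>2"
        unfolding iu using l0 by (simp add: inner_diff_right A_def[symmetric] B_def[symmetric] power2_eq_square field_simps)
      ultimately show "(k has_real_derivative - (p \<bullet> (\<i> * u s)) / l\<^sup>2) (at s within {0..T})" by (simp only:)
    qed
  qed
qed

end

section \<open>Global solutions of the geodesic equation\<close>

lemma nonvanishing_same_sign: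
  fixes k :: "real \<Rightarrow> real"
  assumes "connected S" "continuous_on S k" "\<And>s. s \<in> S \<Longrightarrow> k s \<noteq> 0" "x \<in> S" "y \<in> S"
  shows "sgn (k x) = sgn (k y)"
proof (rule ccontr)
  assume ne: "sgn (k x) \<noteq> sgn (k y)"
  have "is_interval (k ` S)" using connected_continuous_image[OF assms(2,1)] by (simp add: is_interval_connected_1)
  moreover have "k x \<in> k ` S" "k y \<in> k ` S" using assms(4,5) by auto
  moreover have "(k x \<le> 0 \<and> 0 \<le> k y) \<or> (k y \<le> 0 \<and> 0 \<le> k x)"
    using ne by (auto simp: sgn_if split: if_splits)
  ultimately have "0 \<in> k ` S" unfolding is_interval_1 by blast
  then show False using assms(3) by force
qed

lemma has_vector_derivative_cis:
  assumes "(\<phi> has_real_derivative D) (at s)"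
  shows "((\<lambda>s. cis (\<phi> s)) has_vector_derivative D *\<^sub>R (\<i> * cis (\<phi> s))) (at s)"
proof -
  have "((\<lambda>z. exp (\<i> * z)) has_field_derivative \<i> * exp (\<i> * of_real x)) (at (of_real x))" for x
    by (auto intro!: derivative_eq_intros)
  from has_vector_derivative_real_field[OF this]
  have "(cis has_vector_derivative \<i> * cis x) (at x)" for x by (simp add: cis_conv_exp[abs_def])
  from vector_diff_chain_at[OF assms[unfolded has_real_derivative_iff_has_vector_derivative] this]
  show ?thesis by (simp add: o_def)
qed

text \<open>Where \<open>u\<close> differs from \<open>p\<close>, the equation for \<open>k\<close>
  follows by differentiating \<open>l * |k| = norm (u - p)\<close>. Only the scalar first-order
  equation for the tangent angle is left to be solved.\<close>

lemma geodesic_ode_curvature_derivative: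
  assumes l: "l > 0" and \<sigma>: "\<bar>\<sigma>\<bar> = 1" and u: "(u has_vector_derivative k s *\<^sub>R (\<i> * u s)) (at s)"
    and k: "\<And>s. k s = \<sigma> * norm (u s - p) / l" and ne: "u s \<noteq> p"
  shows "(k has_real_derivative - (p \<bullet> (\<i> * u s)) / l\<^sup>2) (at s)"
proof -
  define N where "N r = (u r - p) \<bullet> (u r - p)" for r
  have d: "((\<lambda>r. u r - p) has_vector_derivative k s *\<^sub>R (\<i> * u s)) (at s)"
    using has_vector_derivative_diff[OF u has_vector_derivative_const[of p]] by simp
  have "(N has_real_derivative 2 * ((u s - p) \<bullet> (k s *\<^sub>R (\<i> * u s)))) (at s)"
    using bounded_bilinear.has_vector_derivative[OF bounded_bilinear_inner d d]
    unfolding N_def[abs_def] by (simp add: has_real_derivative_iff_has_vector_derivative inner_commute)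
  moreover have "2 * ((u s - p) \<bullet> (k s *\<^sub>R (\<i> * u s))) = - 2 * k s * (p \<bullet> (\<i> * u s))"
    by (simp add: inner_complex_def algebra_simps)
  ultimately have dN: "(N has_real_derivative - 2 * k s * (p \<bullet> (\<i> * u s))) (at s)" by (simp only:)
  have Npos: "N s > 0" using ne by (simp add: N_def)
  have "((\<lambda>r. sqrt (N r)) has_real_derivative inverse (sqrt (N s)) / 2 * (- 2 * k s * (p \<bullet> (\<i> * u s)))) (at s)"
    by (rule DERIV_chain2[OF DERIV_real_sqrt[OF Npos] dN])
  then have "((\<lambda>r. (\<sigma> / l) * sqrt (N r)) has_real_derivative (\<sigma> / l) * (inverse (sqrt (N s)) / 2 * (- 2 * k s * (p \<bullet> (\<i> * u s))))) (at s)"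
    by (rule DERIV_cmult)
  moreover have "(\<lambda>r. (\<sigma> / l) * sqrt (N r)) = k" by (simp add: fun_eq_iff k N_def norm_eq_sqrt_inner)
  moreover have "(\<sigma> / l) * (inverse (sqrt (N s)) / 2 * (- 2 * k s * (p \<bullet> (\<i> * u s)))) = - (p \<bullet> (\<i> * u s)) / l\<^sup>2"
  proof -
    have "\<sigma> * \<sigma> = 1" using \<sigma> by (metis abs_mult_self_eq mult_1)
    moreover have "k s = \<sigma> / l * sqrt (N s)" by (simp add: k N_def norm_eq_sqrt_inner)
    moreover have "sqrt (N s) > 0" using Npos by simp
    ultimately show ?thesis using l by (simp add: field_simps power2_eq_square)
  qed
  ultimately show ?thesis by simp
qed

text \<open>As \<open>norm p \<noteq> 1\<close>, no direction equals \<open>p\<close>, and the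
  tangent angle obeys \<open>\<phi>' = \<sigma> * G \<phi>\<close> with \<open>G\<close> positive.
  Separation of variables solves this: the primitive \<open>H\<close> of \<open>1 / G\<close> has
  slope at least \<open>C\<close>, so it is a bijection of the line and its inverse is defined for
  all times.\<close>

lemma global_geodesic_generic:
  assumes l: "l > 0" and p: "norm p \<noteq> 1" and u0: "norm u0 = 1"
    and k0: "k0 \<noteq> 0" "(l * k0)\<^sup>2 = (norm (u0 - p))\<^sup>2"
  obtains u k where "geodesic_ode l p UNIV u k" "u 0 = u0" "k 0 = k0" "\<forall>s. k s \<noteq> 0"
proof -
  obtain \<phi>0 where \<phi>0: "u0 = cis \<phi>0" using u0 by (metis cis_Arg norm_zero zero_neq_one sgn_div_norm div_by_1 of_real_1 scaleR_one inverse_1)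
  define G where "G \<phi> = norm (cis \<phi> - p) / l" for \<phi>
  have ne: "cis \<phi> \<noteq> p" for \<phi> using p by (metis norm_cis)
  have G0: "G \<phi> > 0" for \<phi> using ne l by (simp add: G_def)
  define C where "C = l / (1 + norm p)"
  have C: "C > 0" using l by (simp add: C_def add_pos_nonneg)
  have invG: "1 / G \<phi> \<ge> C" for \<phi>
  proof -
    have "norm (cis \<phi> - p) \<le> 1 + norm p" using norm_triangle_ineq4[of "cis \<phi>" p] by simp
    then have "l / (1 + norm p) \<le> l / norm (cis \<phi> - p)"
      using l ne[of \<phi>] by (intro divide_left_mono mult_pos_pos) (auto simp: add_pos_nonneg)
    then show ?thesis by (simp add: C_def G_def)
  qed
  have "continuous_on UNIV (\<lambda>\<phi>. 1 / G \<phi>)"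
    unfolding G_def cis_conv_exp using ne l by (intro continuous_intros) (auto simp: cis_conv_exp)
  then have cont: "isCont (\<lambda>\<phi>. 1 / G \<phi>) x" for x by (simp add: continuous_on_eq_continuous_at)
  obtain H where H: "\<forall>x::real. - \<infinity> < ereal x \<longrightarrow> ereal x < \<infinity> \<longrightarrow> (H has_vector_derivative 1 / G x) (at x)"
    using einterval_antiderivative[of "-\<infinity>" "\<infinity>" "\<lambda>\<phi>. 1 / G \<phi>"] cont by auto
  then have dH: "(H has_real_derivative 1 / G x) (at x)" for x
    by (simp add: has_real_derivative_iff_has_vector_derivative)
  have H_lower: "C * (y - x) \<le> H y - H x" if "x \<le> y" for x y
  proof -
    have "H x - C * x \<le> H y - C * y"
    proof (rule DERIV_nonneg_imp_nondecreasing[OF that])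
      fix z show "\<exists>D. ((\<lambda>x. H x - C * x) has_real_derivative D) (at z) \<and> 0 \<le> D"
        using invG[of z] by (intro exI[of _ "1 / G z - C"] conjI) (auto intro!: derivative_eq_intros dH)
    qed
    then show ?thesis by (simp add: algebra_simps)
  qed
  have contH: "isCont H x" for x using dH by (rule DERIV_isCont)
  have surj: "\<exists>x. H x = y" for y
  proof -
    define r where "r = \<bar>y - H 0\<bar> / C"
    have r: "r \<ge> 0" "C * r = \<bar>y - H 0\<bar>" using C by (auto simp: r_def)
    have "H (-r) \<le> y" "y \<le> H r" using H_lower[of "-r" 0] H_lower[of 0 r] r by auto
    then show ?thesis using IVT[of H "-r" y r] contH r by auto
  qed
  define \<Phi> where "\<Phi> = inv H"
  have H\<Phi>: "H (\<Phi> y) = y" for y using surj[of y] unfolding \<Phi>_def by (metis f_inv_into_f rangeI)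
  have strict: "H x < H y" if "x < y" for x y
    using H_lower[of x y] mult_pos_pos[OF C, of "y - x"] that by simp
  have inj: "x = y" if "H x = H y" for x y
  proof (cases x y rule: linorder_cases)
    case less then show ?thesis using strict[OF less] that by simp
  next
    case greater then show ?thesis using strict[OF greater] that by simp
  qed
  have \<Phi>H: "\<Phi> (H x) = x" for x by (rule inj) (rule H\<Phi>)
  have \<Phi>_lip: "\<bar>\<Phi> y - \<Phi> x\<bar> \<le> (1 / C) * \<bar>y - x\<bar>" for x y
  proof -
    have "C * \<bar>\<Phi> y - \<Phi> x\<bar> \<le> \<bar>y - x\<bar>"
      using H_lower[of "\<Phi> x" "\<Phi> y"] H_lower[of "\<Phi> y" "\<Phi> x"] by (cases "\<Phi> x \<le> \<Phi> y") (simp_all add: H\<Phi>)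
    then show ?thesis using C by (simp add: field_simps)
  qed
  have cont\<Phi>: "isCont \<Phi> y" for y
  proof -
    have "continuous_on UNIV \<Phi>"
      by (rule lipschitz_on_continuous_on[of "1 / C"])
        (use \<Phi>_lip C in \<open>auto intro!: lipschitz_onI simp: dist_real_def abs_minus_commute\<close>)
    then show ?thesis by (simp add: continuous_on_eq_continuous_at)
  qed
  have d\<Phi>: "(\<Phi> has_real_derivative G (\<Phi> y)) (at y)" for y
  proof -
    have "(\<Phi> has_real_derivative inverse (1 / G (\<Phi> y))) (at y)"
      by (rule DERIV_inverse_function[OF dH, where a = "y - 1" and b = "y + 1"])
        (use G0[of "\<Phi> y"] H\<Phi> cont\<Phi> in auto)
    then show ?thesis by simp
  qed
  define \<sigma> where "\<sigma> = sgn k0"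
  have \<sigma>: "\<bar>\<sigma>\<bar> = 1" "\<sigma> * \<bar>k0\<bar> = k0" using k0(1) by (auto simp: \<sigma>_def sgn_if)
  define \<phi> where "\<phi> s = \<Phi> (H \<phi>0 + \<sigma> * s)" for s
  define u where "u s = cis (\<phi> s)" for s
  define k where "k s = \<sigma> * norm (u s - p) / l" for s
  have d\<phi>: "(\<phi> has_real_derivative k s) (at s)" for s
  proof -
    have "(\<phi> has_real_derivative G (\<phi> s) * \<sigma>) (at s)"
      unfolding \<phi>_def[abs_def] by (rule DERIV_chain2[OF d\<Phi>]) (auto intro!: derivative_eq_intros)
    then show ?thesis by (simp add: k_def u_def G_def mult.commute)
  qed
  have du: "(u has_vector_derivative k s *\<^sub>R (\<i> * u s)) (at s)" for s
    unfolding u_def[abs_def] by (rule has_vector_derivative_cis[OF d\<phi>])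
  show thesis
  proof (rule that[of u k])
    show "geodesic_ode l p UNIV u k" unfolding geodesic_ode_def
    proof (intro ballI conjI)
      fix s
      show "norm (u s) = 1" by (simp add: u_def)
      have "\<sigma>\<^sup>2 = 1" using \<sigma>(1) by (simp add: abs_square_eq_1)
      then show "(l * k s)\<^sup>2 = (norm (u s - p))\<^sup>2" using l by (simp add: k_def power_mult_distrib)
      show "(u has_vector_derivative k s *\<^sub>R (\<i> * u s)) (at s)" by (rule du)
      show "(k has_real_derivative - (p \<bullet> (\<i> * u s)) / l\<^sup>2) (at s)"
        by (rule geodesic_ode_curvature_derivative[OF l \<sigma>(1) du k_def]) (use ne in \<open>simp add: u_def\<close>)
    qed
    show "u 0 = u0" by (simp add: u_def \<phi>_def \<Phi>H \<phi>0)
    then have "k 0 = \<sigma> * (norm (u0 - p) / l)" by (simp add: k_def)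
    also have "norm (u0 - p) = l * \<bar>k0\<bar>"
      using k0(2) l by (simp add: power2_eq_iff_nonneg abs_mult flip: power2_abs[of "l * k0"])
    finally show "k 0 = k0" using l \<sigma>(2) by simp
    show "\<forall>s. k s \<noteq> 0" using ne \<sigma>(1) l by (auto simp: k_def u_def)
  qed
qed

text \<open>For \<open>|p| = 1\<close> the geodesic is an Euler soliton, with tangent \<open>p ((1 + i\<tau>) / (1 - i\<tau>))\<^sup>2\<close> and
  \<open>\<tau>\<close> an exponential of arc length.\<close>

lemma global_geodesic_soliton:
  assumes l: "l > 0" and p: "norm p = 1" and u0: "norm u0 = 1"
    and k0: "k0 \<noteq> 0" "(l * k0)\<^sup>2 = (norm (u0 - p))\<^sup>2"
  obtains u k where "geodesic_ode l p UNIV u k" "u 0 = u0" "k 0 = k0" "\<forall>s. k s \<noteq> 0"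
proof -
  have p0: "p \<noteq> 0" using p by auto
  \<comment> \<open>\<open>y\<close> is to be the value of
    \<open>(1 + \<i>\<tau>) / (1 - \<i>\<tau>)\<close> at 0, a square root of \<open>u0 / p\<close>.
    Both roots satisfy \<open>norm (u0 - p) = 2 * |Im y|\<close>; the sign of \<open>k0\<close>
    selects one of them.\<close>
  obtain y where y2: "y\<^sup>2 = u0 / p" and y: "2 * Im y = l * k0"
  proof -
    define y where "y = csqrt (u0 / p)"
    have y2: "y\<^sup>2 = u0 / p" by (simp add: y_def)
    have "norm (y\<^sup>2) = 1" using y2 u0 p by (simp add: norm_divide)
    then have ny: "norm y = 1" by - (rule power2_eq_imp_eq, simp_all add: norm_power)
    have yy: "Re y * Re y + Im y * Im y = 1" using ny by (simp add: cmod_def real_sqrt_eq_1_iff power2_eq_square)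
    have "u0 - p = p * (y\<^sup>2 - 1)" using y2 p0 by (simp add: field_simps)
    also have "y\<^sup>2 - 1 = y * (y - cnj y)"
      using yy by (simp add: complex_eq_iff power2_eq_square algebra_simps)
    also have "y - cnj y = 2 * \<i> * of_real (Im y)" by (simp add: complex_eq_iff)
    finally have "norm (u0 - p) = 2 * \<bar>Im y\<bar>" using p ny by (simp add: norm_mult)
    then have "(l * k0)\<^sup>2 = (2 * Im y)\<^sup>2" using k0(2) by (simp add: power_mult_distrib)
    then have "l * k0 = 2 * Im y \<or> l * k0 = - (2 * Im y)" by (simp only: power2_eq_iff)
    then have "2 * Im y = l * k0 \<or> 2 * Im (- y) = l * k0" by auto
    then show thesis using that[of y] that[of "- y"] y2 by auto
  qed
  have ny: "norm y = 1"
  proof -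
    have "norm (y\<^sup>2) = 1" using y2 u0 p by (simp add: norm_divide)
    then show ?thesis by - (rule power2_eq_imp_eq, simp_all add: norm_power)
  qed
  have yy: "Re y * Re y + Im y * Im y = 1" using ny by (simp add: cmod_def real_sqrt_eq_1_iff power2_eq_square)
  have Imy: "Im y \<noteq> 0" using y k0 l by auto
  have Rey: "1 + Re y \<noteq> 0"
  proof
    assume "1 + Re y = 0"
    then have "Re y = - 1" by simp
    then show False using yy Imy by simp
  qed
  \<comment> \<open>The half-angle formula: this is the tangent of half the argument of
    \<open>y\<close>. The value \<open>y = - 1\<close> is excluded because
    \<open>k0 \<noteq> 0\<close> gives \<open>Im y \<noteq> 0\<close>.\<close>
  define \<tau>0 where "\<tau>0 = Im y / (1 + Re y)"
  have \<tau>0: "\<tau>0 \<noteq> 0" using Imy Rey by (simp add: \<tau>0_def)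
  define \<tau> where "\<tau> t = \<tau>0 * exp (t / l)" for t
  have \<tau>_ne: "\<tau> t \<noteq> 0" for t using \<tau>0 by (simp add: \<tau>_def)
  have d\<tau>: "(\<tau> has_real_derivative \<tau> t / l) (at t)" for t
    unfolding \<tau>_def[abs_def] using l by (auto intro!: derivative_eq_intros)
  define z where "z t = (Complex 1 (\<tau> t) / Complex 1 (- \<tau> t))\<^sup>2" for t
  define Q where "Q t = 1 + (\<tau> t)\<^sup>2" for t
  have Q: "Q t > 0" for t by (simp add: Q_def add_pos_nonneg)
  have z_alt: "z t = Complex (((1 - (\<tau> t)\<^sup>2)\<^sup>2 - 4 * (\<tau> t)\<^sup>2) / (Q t)\<^sup>2) (4 * \<tau> t * (1 - (\<tau> t)\<^sup>2) / (Q t)\<^sup>2)" for t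
  proof -
    have \<zeta>: "Complex 1 (\<tau> t) / Complex 1 (- \<tau> t) = Complex ((1 - (\<tau> t)\<^sup>2) / Q t) (2 * \<tau> t / Q t)"
      by (simp add: complex_eq_iff Re_divide Im_divide Q_def power2_eq_square)
    show ?thesis unfolding z_def \<zeta>
      using Q[of t] by (simp add: complex_eq_iff power2_eq_square field_simps)
  qed
  define k where "k t = 4 * \<tau> t / (l * Q t)" for t
  define u where "u t = p * z t" for t
  have dQ: "(Q has_real_derivative 2 * \<tau> t * (\<tau> t / l)) (at t)" for t
    unfolding Q_def[abs_def] by (auto intro!: derivative_eq_intros d\<tau>)
  \<comment> \<open>The tangent is differentiated as a rational function of a complex variable,
    taken at the real point \<tau>; there \<open>Q\<close> factors as
    \<open>(1 + \<i> * w) * (1 - \<i> * w)\<close>.\<close>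
  have du: "(u has_vector_derivative k t *\<^sub>R (\<i> * u t)) (at t)" for t
  proof -
    define w where "w = complex_of_real (\<tau> t)"
    have eq: "Complex 1 x = 1 + \<i> * of_real x" "Complex 1 (- x) = 1 - \<i> * of_real x" for x
      by (simp_all add: complex_eq_iff)
    have nz: "1 - \<i> * w \<noteq> 0" "1 + \<i> * w \<noteq> 0" by (simp_all add: w_def complex_eq_iff)
    have Qw: "complex_of_real (Q t) = (1 + \<i> * w) * (1 - \<i> * w)"
      by (simp add: Q_def w_def complex_eq_iff power2_eq_square)
    have "((\<lambda>x. p * ((1 + \<i> * x) / (1 - \<i> * x))\<^sup>2) has_field_derivative
       p * (2 * ((1 + \<i> * w) / (1 - \<i> * w)) * ((\<i> * (1 - \<i> * w) + (1 + \<i> * w) * \<i>) / ((1 - \<i> * w) * (1 - \<i> * w))))) (at w)"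
      using nz by (auto intro!: derivative_eq_intros) (simp add: algebra_simps)
    moreover have "p * (2 * ((1 + \<i> * w) / (1 - \<i> * w)) * ((\<i> * (1 - \<i> * w) + (1 + \<i> * w) * \<i>) / ((1 - \<i> * w) * (1 - \<i> * w))))
       = (4 * \<i> / complex_of_real (Q t)) * u t"
    proof -
      have "\<i> * (1 - \<i> * w) + (1 + \<i> * w) * \<i> = 2 * \<i>" by (simp add: algebra_simps)
      moreover have "u t = p * ((1 + \<i> * w) / (1 - \<i> * w))\<^sup>2" by (simp add: u_def z_def eq w_def)
      ultimately show ?thesis unfolding Qw using nz by (simp add: power2_eq_square)
    qed
    ultimately have "((\<lambda>x. p * ((1 + \<i> * x) / (1 - \<i> * x))\<^sup>2) has_field_derivative (4 * \<i> / complex_of_real (Q t)) * u t) (at (of_real (\<tau> t)))"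
      by (simp only: w_def)
    from vector_diff_chain_at[OF d\<tau>[unfolded has_real_derivative_iff_has_vector_derivative] has_vector_derivative_real_field[OF this]]
    have "(u has_vector_derivative (\<tau> t / l) *\<^sub>R ((4 * \<i> / complex_of_real (Q t)) * u t)) (at t)"
      by (simp add: o_def u_def[abs_def] z_def eq)
    moreover have "(\<tau> t / l) *\<^sub>R ((4 * \<i> / complex_of_real (Q t)) * u t) = k t *\<^sub>R (\<i> * u t)"
      by (simp add: k_def scaleR_conv_of_real)
    ultimately show ?thesis by (simp only:)
  qed
  have dk: "(k has_real_derivative (4 * \<tau> t * (1 - (\<tau> t)\<^sup>2) / (Q t)\<^sup>2) / l\<^sup>2) (at t)" for t
  proof -
    have "(k has_real_derivative (4 * (\<tau> t / l) * (l * Q t) - 4 * \<tau> t * (l * (2 * \<tau> t * (\<tau> t / l)))) / ((l * Q t) * (l * Q t))) (at t)"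
      unfolding k_def[abs_def] using Q[of t] l by (intro DERIV_divide DERIV_cmult d\<tau> dQ) simp
    moreover have "(4 * (\<tau> t / l) * (l * Q t) - 4 * \<tau> t * (l * (2 * \<tau> t * (\<tau> t / l)))) = 4 * \<tau> t * (1 - (\<tau> t)\<^sup>2)"
    proof -
      have "4 * (\<tau> t / l) * (l * Q t) = 4 * \<tau> t * Q t" "l * (2 * \<tau> t * (\<tau> t / l)) = 2 * \<tau> t * \<tau> t"
        using l by simp_all
      then show ?thesis by (simp only:) (simp add: Q_def power2_eq_square algebra_simps)
    qed
    ultimately show ?thesis by (simp add: power2_eq_square mult_ac)
  qed
  have nz1: "norm (z t) = 1" for t
  proof -
    have "norm (Complex 1 (\<tau> t)) = norm (Complex 1 (- \<tau> t))" by (simp add: complex_norm)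
    moreover have "norm (Complex 1 (- \<tau> t)) \<noteq> 0" by (simp add: complex_eq_iff)
    ultimately show ?thesis by (simp add: z_def norm_power norm_divide)
  qed
  have Imz: "p \<bullet> (\<i> * u t) = - Im (z t)" for t
  proof -
    have "Re p * Re p + Im p * Im p = 1" using p by (simp add: cmod_def real_sqrt_eq_1_iff power2_eq_square)
    then have "- Im (z t) * (Re p * Re p + Im p * Im p) = - Im (z t)" by simp
    then show ?thesis by (simp add: u_def inner_complex_def algebra_simps)
  qed
  show thesis
  proof (rule that[of u k])
    show "geodesic_ode l p UNIV u k" unfolding geodesic_ode_def
    proof (intro ballI conjI)
      fix t
      show "norm (u t) = 1" using p nz1 by (simp add: u_def norm_mult)
      have "u t - p = p * (z t - 1)" by (simp add: u_def algebra_simps)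
      then have "(norm (u t - p))\<^sup>2 = (norm (z t - 1))\<^sup>2" using p by (simp add: norm_mult)
      also have "\<dots> = (norm (z t))\<^sup>2 + 1 - 2 * Re (z t)"
        unfolding cmod_power2 by (simp add: power2_eq_square algebra_simps)
      also have "\<dots> = 2 - 2 * (((1 - (\<tau> t)\<^sup>2)\<^sup>2 - 4 * (\<tau> t)\<^sup>2) / (Q t)\<^sup>2)" using nz1 by (simp add: z_alt)
      also have "\<dots> = 2 * ((Q t)\<^sup>2 - ((1 - (\<tau> t)\<^sup>2)\<^sup>2 - 4 * (\<tau> t)\<^sup>2)) / (Q t)\<^sup>2"
        using Q[of t] by (simp add: field_simps)
      also have "(Q t)\<^sup>2 - ((1 - (\<tau> t)\<^sup>2)\<^sup>2 - 4 * (\<tau> t)\<^sup>2) = 8 * (\<tau> t)\<^sup>2"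
        by (simp add: Q_def power2_eq_square algebra_simps)
      also have "2 * (8 * (\<tau> t)\<^sup>2) / (Q t)\<^sup>2 = (l * k t)\<^sup>2"
        using l by (simp add: k_def power_divide power_mult_distrib)
      finally show "(l * k t)\<^sup>2 = (norm (u t - p))\<^sup>2" by simp
      show "(u has_vector_derivative k t *\<^sub>R (\<i> * u t)) (at t)" by (rule du)
      show "(k has_real_derivative - (p \<bullet> (\<i> * u t)) / l\<^sup>2) (at t)"
        using dk[of t] by (simp add: Imz z_alt)
    qed
    have \<tau>_0: "\<tau> 0 = Im y / (1 + Re y)" by (simp add: \<tau>_def \<tau>0_def)
    have "z 0 = y\<^sup>2"
    proof -
      define c where "c = complex_of_real (1 / (1 + Re y))"
      have c: "c \<noteq> 0" unfolding c_def of_real_eq_0_iff using Rey by simp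
      have num: "Complex 1 (\<tau> 0) = c * (1 + y)"
        unfolding c_def using Rey by (simp add: complex_eq_iff \<tau>_0 field_simps)
      have den: "Complex 1 (- \<tau> 0) = c * (1 + cnj y)"
        unfolding c_def using Rey by (simp add: complex_eq_iff \<tau>_0 field_simps)
      have "1 + y = y * (1 + cnj y)" using yy by (simp add: complex_eq_iff algebra_simps)
      moreover have "1 + cnj y \<noteq> 0" using Rey by (simp add: complex_eq_iff)
      ultimately have "(1 + y) / (1 + cnj y) = y" by simp
      then have "Complex 1 (\<tau> 0) / Complex 1 (- \<tau> 0) = y"
        unfolding num den mult_divide_mult_cancel_left[OF c] .
      then show ?thesis by (simp add: z_def)
    qed
    then show "u 0 = u0" using y2 p0 by (simp add: u_def)
    have "Q 0 = 2 / (1 + Re y)"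
    proof -
      define r where "r = 1 + Re y"
      have r: "r \<noteq> 0" "r * \<tau> 0 = Im y" using Rey \<tau>_0 by (simp_all add: r_def)
      have "Q 0 * (r * r) = r * r + (r * \<tau> 0) * (r * \<tau> 0)" by (simp add: Q_def power2_eq_square algebra_simps)
      also note r(2)
      also have "r * r + Im y * Im y = 2 * r" using yy by (simp add: r_def algebra_simps)
      finally have "Q 0 * r = 2" using r(1) by (simp flip: mult.assoc)
      then show ?thesis using r(1) by (simp add: r_def[symmetric] eq_divide_eq)
    qed
    then have "k 0 = 2 * Im y / l" using Rey by (simp add: k_def \<tau>_0)
    then show "k 0 = k0" using y l by simp
    show "\<forall>s. k s \<noteq> 0" using \<tau>_ne Q l by (simp add: k_def less_imp_neq[symmetric])
  qed
qed

lemma global_geodesic: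
  assumes "l > 0" "norm u0 = 1" "k0 \<noteq> 0" "(l * k0)\<^sup>2 = (norm (u0 - p))\<^sup>2"
  obtains u k where "geodesic_ode l p UNIV u k" "u 0 = u0" "k 0 = k0" "\<forall>s. k s \<noteq> 0"
proof (cases "norm p = 1")
  case True
  show thesis by (rule global_geodesic_soliton[OF assms(1) True assms(2-4)]) (rule that)
next
  case False
  show thesis by (rule global_geodesic_generic[OF assms(1) False assms(2-4)]) (rule that)
qed

lemma antiderivative_on_reals:
  fixes u :: "real \<Rightarrow> 'a::euclidean_space"
  assumes "\<And>t. isCont u t"
  obtains E where "E 0 = c" "\<And>t. (E has_vector_derivative u t) (at t)"
proof -
  obtain F where F: "\<forall>x::real. - \<infinity> < ereal x \<longrightarrow> ereal x < \<infinity> \<longrightarrow> (F has_vector_derivative u x) (at x)"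
    using einterval_antiderivative[of "-\<infinity>" "\<infinity>" u] assms by auto
  show thesis
  proof (rule that[of "\<lambda>t. F t + (c - F 0)"])
    fix t
    have "(F has_vector_derivative u t) (at t)" using F by simp
    from has_vector_derivative_add[OF this has_vector_derivative_const]
    show "((\<lambda>t. F t + (c - F 0)) has_vector_derivative u t) (at t)" by simp
  qed simp
qed

section \<open>Complete geodesics\<close>

locale complete_geodesic =
  fixes l :: real and p :: complex and u k and E :: "real \<Rightarrow> complex"
  assumes l_pos: "l > 0" and ode: "geodesic_ode l p UNIV u k" and k_ne: "\<And>s. k s \<noteq> 0"
    and E_deriv: "\<And>t. (E has_vector_derivative u t) (at t)"
begin

lemma norm_u: "norm (u s) = 1"
  and lk: "(l * k s)\<^sup>2 = (norm (u s - p))\<^sup>2"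
  and u_deriv: "(u has_vector_derivative k s *\<^sub>R (\<i> * u s)) (at s)"
  and k_deriv: "(k has_real_derivative - (p \<bullet> (\<i> * u s)) / l\<^sup>2) (at s)"
  using ode by (simp_all add: geodesic_ode_def)

lemma k_deriv2: "((\<lambda>s. - (p \<bullet> (\<i> * u s)) / l\<^sup>2) has_real_derivative k s * (p \<bullet> u s) / l\<^sup>2) (at s)"
proof -
  have "((\<lambda>s. p \<bullet> (\<i> * u s)) has_vector_derivative p \<bullet> (\<i> * (k s *\<^sub>R (\<i> * u s)))) (at s)"
    by (intro bounded_linear.has_vector_derivative[OF bounded_linear_inner_right] has_vector_derivative_mult_right u_deriv)
  moreover have "p \<bullet> (\<i> * (k s *\<^sub>R (\<i> * u s))) = - (k s * (p \<bullet> u s))"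
    by (simp add: inner_complex_def algebra_simps)
  ultimately have "((\<lambda>s. p \<bullet> (\<i> * u s)) has_real_derivative - (k s * (p \<bullet> u s))) (at s)"
    by (simp add: has_real_derivative_iff_has_vector_derivative)
  from DERIV_cdivide[OF DERIV_minus[OF this], of "l\<^sup>2"] show ?thesis by simp
qed

text \<open>Expanding \<open>(norm (u s - p))\<^sup>2\<close> expresses the second derivative of
  \<open>k\<close> through \<open>k\<close> alone, which gives the elastica equation with
  \<open>A = - (1 + (norm p)\<^sup>2) / (2 * l\<^sup>2)\<close>.\<close>

lemma p_inner_u: "p \<bullet> u s = (1 + (norm p)\<^sup>2 - l\<^sup>2 * (k s)\<^sup>2) / 2"
proof -
  have "(norm (u s - p))\<^sup>2 = (norm (u s))\<^sup>2 + (norm p)\<^sup>2 - 2 * (p \<bullet> u s)"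
    unfolding power2_norm_eq_inner by (simp add: inner_diff_left inner_diff_right inner_commute)
  then show ?thesis using lk[of s] norm_u[of s] by (simp add: power_mult_distrib)
qed

lemma velocity_eq: "velocity E = u"
  using E_deriv by (auto simp: velocity_def fun_eq_iff intro: vector_derivative_at)

lemma curvature_eq: "curvature E = k"
proof
  fix t
  have "vector_derivative u (at t) = k t *\<^sub>R (\<i> * u t)" by (rule vector_derivative_at[OF u_deriv])
  moreover have "Im (cnj (u t) * (k t *\<^sub>R (\<i> * u t))) = k t * ((Re (u t))\<^sup>2 + (Im (u t))\<^sup>2)"
    by (simp add: power2_eq_square algebra_simps)
  moreover have "(Re (u t))\<^sup>2 + (Im (u t))\<^sup>2 = 1" using norm_u[of t] by (simp add: cmod_def real_sqrt_eq_1_iff)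
  ultimately show "curvature E t = k t" by (simp add: curvature_def velocity_eq)
qed

lemma non_inflectional: "non_inflectional_elastic_curve E"
proof -
  have dk: "deriv k = (\<lambda>s. - (p \<bullet> (\<i> * u s)) / l\<^sup>2)" by (rule ext) (rule DERIV_imp_deriv[OF k_deriv])
  have ddk: "deriv (deriv k) s = k s * (p \<bullet> u s) / l\<^sup>2" for s
    unfolding dk by (rule DERIV_imp_deriv[OF k_deriv2])
  show ?thesis
    unfolding non_inflectional_elastic_curve_def elastic_curve_def arc_length_parametrized_def velocity_eq curvature_eq
  proof (intro conjI allI exI[of _ "- (1 + (norm p)\<^sup>2) / (2 * l\<^sup>2)"])
    fix t
    show "E differentiable at t" using E_deriv by (rule differentiableI_vector)
    show "norm (u t) = 1" by (rule norm_u)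
    show "u differentiable at t" using u_deriv by (rule differentiableI_vector)
    show "k differentiable at t" using k_deriv unfolding real_differentiable_def by blast
    show "deriv k differentiable at t" using k_deriv2 unfolding dk real_differentiable_def by blast
    show "k t \<noteq> 0" by (rule k_ne)
    show "deriv (deriv k) t + 1 / 2 * k t ^ 3 + - (1 + (norm p)\<^sup>2) / (2 * l\<^sup>2) * k t = 0"
      unfolding ddk p_inner_u using l_pos by (simp add: field_simps power2_eq_square power3_eq_cube)
  qed
qed

lemma plane_width_leI:
  assumes "norm n = 1" "\<And>t. c \<le> n \<bullet> E t \<and> n \<bullet> E t \<le> d" "d - c \<le> D"
  shows "plane_width (range E) \<le> ennreal D"
proof -
  have "c \<le> d" using assms(2)[of 0] by simp
  then have "plane_width (range E) \<le> ennreal (d - c)"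
    unfolding plane_width_def using assms by (intro INF_lower2[of "(n, c, d)"]) auto
  also have "\<dots> \<le> ennreal D" using assms by (intro ennreal_leI)
  finally show ?thesis .
qed

text \<open>In the direction orthogonal to \<open>p\<close> the position is, up to a constant, \<open>l\<^sup>2 k / |p|\<close>, and \<open>l |k|\<close>
  lies between \<open>|1 - |p||\<close> and \<open>1 + |p|\<close>. For \<open>p = 0\<close> the curve is a circle of radius \<open>l\<close>.\<close>

lemma width_le: "plane_width (range E) \<le> ennreal (2 * l)"
proof (cases "p = 0")
  case True
  have "(k has_real_derivative 0) (at s)" for s using k_deriv[of s] True by simp
  then have k_const: "k s = k 0" for s using DERIV_isconst_all[of k s 0] by blast
  \<comment> \<open>The centre of curvature, which does not move because \<open>k\<close> is
    constant.\<close>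
  define c where "c t = E t + (\<i> / of_real (k 0)) * u t" for t
  have "(c has_vector_derivative 0) (at t)" for t
  proof -
    have "(c has_vector_derivative u t + (\<i> / of_real (k 0)) * (k t *\<^sub>R (\<i> * u t))) (at t)"
      unfolding c_def[abs_def] by (intro has_vector_derivative_add has_vector_derivative_mult_right E_deriv u_deriv)
    moreover have "u t + (\<i> / of_real (k 0)) * (k t *\<^sub>R (\<i> * u t)) = 0"
      unfolding k_const[of t] using k_ne[of 0] by (simp add: scaleR_conv_of_real)
    ultimately show ?thesis by (simp only:)
  qed
  then have "(c has_derivative (\<lambda>_. 0)) (at t)" for t by (simp add: has_vector_derivative_def)
  then have c: "c t = c 0" for t
    using has_derivative_zero_unique[of UNIV c t 0] by simp
  have lk1: "l * \<bar>k 0\<bar> = 1"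
  proof -
    have "\<bar>l * k 0\<bar>\<^sup>2 = 1\<^sup>2" using lk[of 0] True norm_u[of 0] by simp
    then have "\<bar>l * k 0\<bar> = 1" by - (rule power2_eq_imp_eq, simp_all)
    then show ?thesis using l_pos by (simp add: abs_mult)
  qed
  have r: "norm (E t - c 0) = l" for t
  proof -
    have "E t - c 0 = - ((\<i> / of_real (k 0)) * u t)" using c[of t] by (simp add: c_def algebra_simps)
    then have "norm (E t - c 0) = 1 / \<bar>k 0\<bar>" using norm_u[of t] by (simp add: norm_mult norm_divide)
    moreover have "1 / \<bar>k 0\<bar> = l" using lk1 k_ne[of 0] by (simp add: divide_eq_eq)
    ultimately show ?thesis by (simp only:)
  qed
  show ?thesis
  proof (rule plane_width_leI[of 1 "1 \<bullet> c 0 - l" "1 \<bullet> c 0 + l"])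
    fix t
    have "\<bar>1 \<bullet> (E t - c 0)\<bar> \<le> l" using Cauchy_Schwarz_ineq2[of 1 "E t - c 0"] r[of t] by simp
    then show "1 \<bullet> c 0 - l \<le> 1 \<bullet> E t \<and> 1 \<bullet> E t \<le> 1 \<bullet> c 0 + l" by (simp add: inner_diff_right abs_le_iff)
  qed auto
next
  case False
  define P where "P = norm p"
  have P: "P > 0" using False by (simp add: P_def)
  \<comment> \<open>The sign of \<open>k\<close> is constant, so the normal \<open>n\<close> can be
    oriented such that the position along it increases with \<open>|k|\<close>.\<close>
  define \<sigma> where "\<sigma> = sgn (k 0)"
  have \<sigma>: "\<bar>\<sigma>\<bar> = 1" using k_ne[of 0] by (simp add: \<sigma>_def sgn_if)
  have contk: "continuous_on UNIV k" using k_deriv by (auto intro: DERIV_isCont continuous_at_imp_continuous_on)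
  have abs_k: "\<sigma> * k t = \<bar>k t\<bar>" for t
    using nonvanishing_same_sign[OF connected_UNIV contk k_ne, of 0 t] by (simp add: \<sigma>_def abs_sgn mult.commute)
  define n where "n = (\<sigma> / P) *\<^sub>R (\<i> * p)"
  have n: "norm n = 1" using P \<sigma> by (simp add: n_def norm_mult P_def abs_mult)
  define c where "c t = n \<bullet> E t - (l\<^sup>2 / P) * (\<sigma> * k t)" for t
  have "(c has_real_derivative 0) (at t)" for t
  proof -
    have "((\<lambda>t. n \<bullet> E t) has_real_derivative n \<bullet> u t) (at t)"
      using bounded_linear.has_vector_derivative[OF bounded_linear_inner_right E_deriv, of n t]
      by (simp add: has_real_derivative_iff_has_vector_derivative)
    then have "(c has_real_derivative n \<bullet> u t - (l\<^sup>2 / P) * (\<sigma> * (- (p \<bullet> (\<i> * u t)) / l\<^sup>2))) (at t)"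
      unfolding c_def[abs_def] by (intro DERIV_diff DERIV_cmult k_deriv)
    moreover have "n \<bullet> u t - (l\<^sup>2 / P) * (\<sigma> * (- (p \<bullet> (\<i> * u t)) / l\<^sup>2)) = 0"
      using l_pos P by (simp add: n_def inner_complex_def field_simps)
    ultimately show ?thesis by (simp only:)
  qed
  then have c: "c t = c 0" for t using DERIV_isconst_all[of c t 0] by blast
  have nE: "n \<bullet> E t = c 0 + (l / P) * (l * \<bar>k t\<bar>)" for t
    using c[of t] unfolding c_def[of t] abs_k by (simp add: power2_eq_square)
  have lkt: "l * \<bar>k t\<bar> = norm (u t - p)" for t
  proof -
    have "(l * \<bar>k t\<bar>)\<^sup>2 = (norm (u t - p))\<^sup>2" using lk[of t] by (simp add: power_mult_distrib)
    then show ?thesis by - (rule power2_eq_imp_eq, use l_pos in simp_all)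
  qed
  have upper: "l * \<bar>k t\<bar> \<le> 1 + P" for t
    using norm_triangle_ineq4[of "u t" p] norm_u[of t] by (simp add: lkt P_def)
  have lower: "\<bar>1 - P\<bar> \<le> l * \<bar>k t\<bar>" for t
    using norm_triangle_ineq3[of "u t" p] norm_u[of t] by (simp add: lkt P_def)
  have lP: "l / P \<ge> 0" using l_pos P by simp
  show ?thesis
  proof (rule plane_width_leI[OF n, of "c 0 + (l / P) * \<bar>1 - P\<bar>" "c 0 + (l / P) * (1 + P)"])
    fix t
    show "c 0 + (l / P) * \<bar>1 - P\<bar> \<le> n \<bullet> E t \<and> n \<bullet> E t \<le> c 0 + (l / P) * (1 + P)"
      unfolding nE using mult_left_mono[OF upper lP] mult_left_mono[OF lower lP] by simp
    have "(l / P) * (1 + P) - (l / P) * \<bar>1 - P\<bar> = (l / P) * ((1 + P) - \<bar>1 - P\<bar>)" by (simp only: right_diff_distrib)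
    \<comment> \<open>The difference in the bracket is \<open>2 * min 1 P\<close>.\<close>
    also have "\<dots> \<le> (l / P) * (2 * P)" using lP by (intro mult_left_mono) auto
    also have "\<dots> = 2 * l" using P by simp
    finally show "c 0 + (l / P) * (1 + P) - (c 0 + (l / P) * \<bar>1 - P\<bar>) \<le> 2 * l" by simp
  qed
qed

end

text \<open>Zero curvature at the start forces \<open>u 0 = p\<close>, and the constant tangent
  \<open>p\<close> with curvature 0 solves the same initial value problem, so uniqueness makes the
  geodesic straight.\<close>

lemma geodesic_ode_curvature_nonzero:
  assumes ode: "geodesic_ode l p {0..T} u k" and l: "l > 0" and k0: "k 0 = 0" and s: "s \<in> {0..T}"
  shows "u s = p"
proof -
  have "0 \<in> {0..T}" using s by auto
  then have "(norm (u 0 - p))\<^sup>2 = (l * k 0)\<^sup>2" "norm (u 0) = 1" using ode by (simp_all add: geodesic_ode_def)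
  then have u0: "u 0 = p" and p: "norm p = 1" using k0 by auto
  have "p \<bullet> (\<i> * p) = 0" by (simp add: inner_complex_def)
  then have "geodesic_ode l p {0..T} (\<lambda>_. p) (\<lambda>_. 0)" using p by (simp add: geodesic_ode_def)
  from geodesic_ode_unique[OF ode this _ _ s l] u0 k0 show ?thesis by simp
qed

lemma eq_if_same_vector_derivative:
  fixes f g :: "real \<Rightarrow> 'a::real_normed_vector"
  assumes f: "\<And>s. s \<in> {0..T} \<Longrightarrow> (f has_vector_derivative f' s) (at s within {0..T})"
    and g: "\<And>s. s \<in> {0..T} \<Longrightarrow> (g has_vector_derivative f' s) (at s within {0..T})"
    and init: "f 0 = g 0" and s: "s \<in> {0..T}"
  shows "f s = g s"
proof -
  have "((\<lambda>s. f s - g s) has_derivative (\<lambda>_. 0)) (at r within {0..T})" if "r \<in> {0..T}" for r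
    using has_vector_derivative_diff[OF f[OF that] g[OF that]] by (simp add: has_vector_derivative_def)
  then have "\<exists>c. \<forall>r\<in>{0..T}. f r - g r = c" by (intro has_derivative_zero_constant) auto
  then obtain c where c: "\<forall>r\<in>{0..T}. f r - g r = c" ..
  have "0 \<in> {0..T}" using s by auto
  then have "f s - g s = f 0 - g 0" using c s by simp
  then show ?thesis using init by simp
qed

text \<open>The width bound concerns a complete elastica, so the arc is prolonged by a global
  solution with the same tangent and curvature at 0; uniqueness identifies the two on
  \<open>{0..T}\<close>.\<close>

lemma geodesic_arc_of_complete_elastica:
  assumes l: "l > 0" and T: "T > 0" and ode: "geodesic_ode l p {0..T} u k" and k0: "k 0 \<noteq> 0"
    and f: "\<forall>s\<in>{0..T}. (f has_vector_derivative u s) (at s within {0..T})"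
  obtains E where "non_inflectional_elastic_curve E" "plane_width (range E) \<le> ennreal (2 * l)"
    "\<forall>s\<in>{0..T}. f s = E s"
proof -
  have "0 \<in> {0..T}" using T by simp
  then have init: "norm (u 0) = 1" "(l * k 0)\<^sup>2 = (norm (u 0 - p))\<^sup>2" using ode by (simp_all add: geodesic_ode_def)
  obtain u' k' where ode': "geodesic_ode l p UNIV u' k'" and init': "u' 0 = u 0" "k' 0 = k 0" and k': "\<forall>s. k' s \<noteq> 0"
    using global_geodesic[OF l init(1) k0 init(2)] .
  have ode'': "geodesic_ode l p {0..T} u' k'" by (rule geodesic_ode_subset[OF ode']) simp
  have uu: "u' s = u s" if "s \<in> {0..T}" for s
    using geodesic_ode_unique[OF ode'' ode init' that l] by simp
  have "isCont u' t" for t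
    using ode' unfolding geodesic_ode_def by (auto intro: has_vector_derivative_continuous)
  then obtain E where E: "E 0 = f 0" "\<And>t. (E has_vector_derivative u' t) (at t)"
    using antiderivative_on_reals[of u' "f 0"] by blast
  interpret complete_geodesic l p u' k' E
    using l ode' k' E(2) by unfold_locales auto
  have "f s = E s" if "s \<in> {0..T}" for s
  proof (rule eq_if_same_vector_derivative[OF _ _ _ that])
    fix r assume r: "r \<in> {0..T}"
    show "(f has_vector_derivative u r) (at r within {0..T})" using f r by blast
    show "(E has_vector_derivative u r) (at r within {0..T})"
      using has_vector_derivative_at_within[OF E(2)[of r]] uu[OF r] by simp
  qed (simp add: E)
  then show thesis using that[OF non_inflectional width_le] by blast
qed

theorem minimizer_front_track:
  assumes l: "l > 0" and min: "minimizing_bicycle_path l a b \<gamma>"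
  shows "(\<exists>L. straight_line L \<and> is_arc_of a b (front_track \<gamma>) L) \<or>
     (\<exists>E. non_inflectional_elastic_curve E \<and> plane_width (range E) \<le> ennreal (2 * l) \<and> is_arc_of a b (front_track \<gamma>) E)"
proof -
  have path: "bicycle_path l a b \<gamma>" and nc: "\<not> \<gamma> constant_on {a..b}"
    and le: "\<And>c d \<eta>. \<lbrakk>bicycle_path l c d \<eta>; \<eta> c = \<gamma> a; \<eta> d = \<gamma> b\<rbrakk> \<Longrightarrow>
      curve_length a b (front_track \<gamma>) \<le> curve_length c d (front_track \<eta>)"
    using min by (auto simp: minimizing_bicycle_path_def)
  have ab: "a \<le> b" using path by (simp add: bicycle_path_def)
  obtain T \<phi> \<beta> where T: "T > 0" and len: "curve_length a b (front_track \<gamma>) = ennreal T"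
    and \<phi>: "mono_on {a..b} \<phi>" "\<phi> ` {a..b} = {0..T}" and \<beta>: "\<And>t. t \<in> {a..b} \<Longrightarrow> \<gamma> t = \<beta> (\<phi> t)"
    and frame: "\<And>s. s \<in> {0..T} \<Longrightarrow> norm (snd (\<beta> s) - fst (\<beta> s)) = l"
    and front: "\<And>s s'. \<lbrakk>0 \<le> s; s \<le> s'; s' \<le> T\<rbrakk> \<Longrightarrow> norm (snd (\<beta> s') - snd (\<beta> s)) \<le> s' - s"
    and rear: "\<And>s s'. \<lbrakk>0 \<le> s; s \<le> s'; s' \<le> T\<rbrakk> \<Longrightarrow> norm (fst (\<beta> s') - fst (\<beta> s)) \<le> s' - s"
    and trans: "\<And>s s'. \<lbrakk>0 \<le> s; s \<le> s'; s' \<le> T\<rbrakk> \<Longrightarrow>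
        \<bar>(fst (\<beta> s') - fst (\<beta> s)) \<bullet> (\<i> * (snd (\<beta> s) - fst (\<beta> s)))\<bar> \<le> 2 * (s' - s)\<^sup>2"
    by (rule arc_length_reparametrization[OF l path nc]) (rule that, assumption+)
  have ends: "\<phi> a = 0" "\<phi> b = T"
  proof -
    have range: "\<phi> t \<in> {0..T}" if "t \<in> {a..b}" for t using \<phi>(2) that by blast
    have "0 \<in> \<phi> ` {a..b}" "T \<in> \<phi> ` {a..b}" using \<phi>(2) T by simp_all
    then obtain x y where xy: "x \<in> {a..b}" "\<phi> x = 0" "y \<in> {a..b}" "\<phi> y = T" by (elim imageE) simp
    have "\<phi> a \<le> \<phi> x" "\<phi> y \<le> \<phi> b" using mono_onD[OF \<phi>(1), of a x] mono_onD[OF \<phi>(1), of y b] xy(1,3) ab by simp_all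
    then show "\<phi> a = 0" "\<phi> b = T" using range[of a] range[of b] ab xy by simp_all
  qed
  define f where "f s = snd (\<beta> s)" for s
  define g where "g s = fst (\<beta> s)" for s
  obtain \<zeta> :: "real \<Rightarrow> complex" where \<zeta>: "\<zeta> \<in> borel_measurable borel" "\<And>s. norm (\<zeta> s) \<le> 1"
    "\<And>s s'. \<lbrakk>0 \<le> s; s \<le> s'; s' \<le> T\<rbrakk> \<Longrightarrow> (\<zeta> has_integral f s' - f s) {s..s'}"
    by (rule lipschitz_density[of T f]) (use T front in \<open>auto simp: f_def\<close>)
  interpret minimizing_arc l T g f \<zeta>
  proof
    show "l > 0" "T > 0" by fact+
    show "\<And>s. s \<in> {0..T} \<Longrightarrow> norm (f s - g s) = l" using frame by (simp add: f_def g_def)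
    show "\<And>s s'. \<lbrakk>0 \<le> s; s \<le> s'; s' \<le> T\<rbrakk> \<Longrightarrow> norm (f s' - f s) \<le> s' - s" using front by (simp add: f_def)
    show "\<And>s s'. \<lbrakk>0 \<le> s; s \<le> s'; s' \<le> T\<rbrakk> \<Longrightarrow> norm (g s' - g s) \<le> s' - s" using rear by (simp add: g_def)
    show "\<And>s s'. \<lbrakk>0 \<le> s; s \<le> s'; s' \<le> T\<rbrakk> \<Longrightarrow> \<bar>(g s' - g s) \<bullet> (\<i> * (f s - g s))\<bar> \<le> 2 * (s' - s)\<^sup>2"
      using trans by (simp add: f_def g_def)
    show "\<zeta> \<in> borel_measurable borel" "\<And>s. norm (\<zeta> s) \<le> 1" by fact+
    show "\<And>s s'. \<lbrakk>0 \<le> s; s \<le> s'; s' \<le> T\<rbrakk> \<Longrightarrow> (\<zeta> has_integral f s' - f s) {s..s'}" by fact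
    fix \<eta> assume \<eta>: "bicycle_path l 0 T \<eta>" "\<eta> 0 = (g 0, f 0)" "\<eta> T = (g T, f T)"
    then have "\<eta> 0 = \<gamma> a" "\<eta> T = \<gamma> b" using \<beta>[of a] \<beta>[of b] ends ab by (simp_all add: f_def g_def)
    then show "ennreal T \<le> curve_length 0 T (front_track \<eta>)" using le[OF \<eta>(1)] len by simp
  qed
  have arc: "is_arc_of a b (front_track \<gamma>) X" if "\<forall>s\<in>{0..T}. f s = X s" for X
    unfolding is_arc_of_def
  proof (rule exI[of _ 0], rule exI[of _ T], rule exI[of _ \<phi>], intro conjI T \<phi> ballI)
    fix t assume t: "t \<in> {a..b}"
    then have "\<phi> t \<in> {0..T}" using \<phi>(2) by blast
    then show "front_track \<gamma> t = X (\<phi> t)" using that \<beta>[OF t] by (simp add: front_track_def f_def)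
  qed
  have line: "\<exists>L. straight_line L \<and> is_arc_of a b (front_track \<gamma>) L" if "norm x = 1" "\<forall>s\<in>{0..T}. f s = f 0 + s *\<^sub>R x" for x
  proof (intro exI[of _ "\<lambda>t. f 0 + t *\<^sub>R x"] conjI arc that(2))
    show "straight_line (\<lambda>t. f 0 + t *\<^sub>R x)" using that(1) by (auto simp: straight_line_def)
  qed
  show ?thesis
  \<comment> \<open>Straight tracks arise in two ways: from a constant frame direction, where the
    momentum is not determined, and from a geodesic with vanishing curvature, for which
    \<open>u = p\<close>.\<close>
  proof (cases "norm K < T")
    case False
    then obtain x where "norm x = 1" "\<forall>s\<in>{0..T}. f s = f 0 + s *\<^sub>R x" by (rule straight_if_degenerate)
    then show ?thesis using line by blast
  next
    case True
    then obtain p u k where ode: "geodesic_ode l p {0..T} u k"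
      and f: "\<forall>s\<in>{0..T}. (f has_vector_derivative u s) (at s within {0..T})" by (rule geodesic_if_nondegenerate)
    show ?thesis
    proof (cases "k 0 = 0")
      case True
      have up: "u s = p" if "s \<in> {0..T}" for s by (rule geodesic_ode_curvature_nonzero[OF ode l True that])
      have "norm p = 1" using ode up[of 0] T by (auto simp: geodesic_ode_def)
      moreover have "f s = f 0 + s *\<^sub>R p" if "s \<in> {0..T}" for s
      proof (rule eq_if_same_vector_derivative[OF _ _ _ that])
        fix r assume r: "r \<in> {0..T}"
        show "(f has_vector_derivative p) (at r within {0..T})" using f r up[OF r] by auto
        show "((\<lambda>s. f 0 + s *\<^sub>R p) has_vector_derivative p) (at r within {0..T})"
          by (auto intro!: derivative_eq_intros)
      qed simp
      ultimately show ?thesis using line by blast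
    next
      case False
      obtain E where "non_inflectional_elastic_curve E" "plane_width (range E) \<le> ennreal (2 * l)"
        "\<forall>s\<in>{0..T}. f s = E s"
        using geodesic_arc_of_complete_elastica[OF l T ode False f] .
      then show ?thesis using arc by blast
    qed
  qed
qed

section \<open>Non-inflectional elasticae are geodesics\<close>

text \<open>With \<open>h = \<kappa>' / \<kappa>\<close> and positive energy, \<open>h' \<le> - c < 0\<close> and \<open>h' \<le> - h\<^sup>2 - A\<close>, so \<open>h\<close> blows up in finite time.\<close>

lemma elastica_energy_nonpos:
  fixes \<kappa> \<kappa>1 :: "real \<Rightarrow> real"
  assumes d\<kappa>: "\<And>t. (\<kappa> has_real_derivative \<kappa>1 t) (at t)"
    and d\<kappa>1: "\<And>t. (\<kappa>1 has_real_derivative - (\<kappa> t ^ 3 / 2) - A * \<kappa> t) (at t)"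
    and ne: "\<And>t. \<kappa> t \<noteq> 0" and energy: "\<And>t. (\<kappa>1 t)\<^sup>2 + (\<kappa> t)\<^sup>2 * ((\<kappa> t)\<^sup>2 / 4 + A) = B"
  shows "B \<le> 0"
proof (rule ccontr)
  assume "\<not> B \<le> 0"
  then have B: "B > 0" by simp
  define h where "h t = \<kappa>1 t / \<kappa> t" for t
  define h' where "h' t = - ((h t)\<^sup>2 + A) - (\<kappa> t)\<^sup>2 / 2" for t
  have dh: "(h has_real_derivative h' t) (at t)" for t
  proof -
    have "(h has_real_derivative ((- (\<kappa> t ^ 3 / 2) - A * \<kappa> t) * \<kappa> t - \<kappa>1 t * \<kappa>1 t) / (\<kappa> t * \<kappa> t)) (at t)"
      unfolding h_def[abs_def] by (rule DERIV_divide[OF d\<kappa>1 d\<kappa> ne])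
    moreover have "((- (\<kappa> t ^ 3 / 2) - A * \<kappa> t) * \<kappa> t - \<kappa>1 t * \<kappa>1 t) / (\<kappa> t * \<kappa> t) = h' t"
      using ne[of t] by (simp add: h'_def h_def field_simps power2_eq_square power3_eq_cube)
    ultimately show ?thesis by simp
  qed
  \<comment> \<open>Two forms of the same derivative: the energy makes this one bounded away from 0,
    while \<open>h'_def\<close> gives the quadratic growth that causes the blow-up.\<close>
  have h'_alt: "h' t = - ((\<kappa> t)\<^sup>2 / 4) - B / (\<kappa> t)\<^sup>2" for t
    unfolding energy[of t, symmetric] h'_def h_def using ne[of t] by (simp add: field_simps power2_eq_square)
  \<comment> \<open>If \<open>\<kappa>\<^sup>2 \<ge> 1\<close> the first term of
    \<open>h'_alt\<close> is at most \<open>- 1 / 4\<close>, otherwise the second is at most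
    \<open>- B\<close>.\<close>
  define c where "c = min (1 / 4) B"
  have c: "c > 0" using B by (simp add: c_def)
  have h'_le: "h' t \<le> - c" for t
  proof (cases "(\<kappa> t)\<^sup>2 \<ge> 1")
    case True
    have "B / (\<kappa> t)\<^sup>2 \<ge> 0" using B by simp
    then show ?thesis unfolding h'_alt c_def using True by simp
  next
    case False
    have "(\<kappa> t)\<^sup>2 > 0" using ne[of t] by simp
    then have "B / 1 \<le> B / (\<kappa> t)\<^sup>2" using False B by (intro divide_left_mono) auto
    then have "B \<le> B / (\<kappa> t)\<^sup>2" by simp
    then have "h' t \<le> - B" unfolding h'_alt using zero_le_power2[of "\<kappa> t"] by linarith
    then show ?thesis by (simp add: c_def min_le_iff_disj)
  qed
  have within: "(h has_real_derivative h' t) (at t within S)" for t S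
    using dh by (rule has_field_derivative_at_within)
  have h_lin: "h t \<le> h 0 - c * t" if "t \<ge> 0" for t
  proof -
    have "h t + c * t \<le> h 0 + c * 0"
    proof (rule nonincreasing_if_derivative_nonpos[OF that, where g = "\<lambda>t. h t + c * t" and g' = "\<lambda>t. h' t + c"])
      fix x show "((\<lambda>t. h t + c * t) has_real_derivative h' x + c) (at x within {0..t})"
        by (auto intro!: derivative_eq_intros within)
      show "h' x + c \<le> 0" using h'_le[of x] by simp
    qed
    then show ?thesis by simp
  qed
  \<comment> \<open>Large enough that \<open>h \<le> - R\<close> gives
    \<open>|A| \<le> h\<^sup>2 / 2\<close> and hence
    \<open>h' \<le> - h\<^sup>2 / 2\<close>.\<close>
  define R where "R = 2 * \<bar>A\<bar> + 2"
  define t0 where "t0 = (\<bar>h 0\<bar> + R) / c"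
  have t0: "t0 \<ge> 0" "c * t0 = \<bar>h 0\<bar> + R" using c by (auto simp: t0_def R_def)
  have ht0: "h t0 \<le> - R" using h_lin[OF t0(1)] t0(2) by linarith
  have R: "R \<ge> 2" by (simp add: R_def)
  have h_le: "h t \<le> - R" if "t \<ge> t0" for t
  proof -
    have "h t \<le> h t0"
    proof (rule nonincreasing_if_derivative_nonpos[OF that within])
      show "h' x \<le> 0" for x using h'_le[of x] c by linarith
    qed
    then show ?thesis using ht0 by simp
  qed
  \<comment> \<open>From \<open>h' \<le> - h\<^sup>2 / 2\<close> the function
    \<open>t / 2 - 1 / h t\<close> is nonincreasing; \<open>t1\<close> is the time at which this
    forces \<open>1 / h t1 \<ge> 0\<close>, although \<open>h\<close> is still negative.\<close>
  define t1 where "t1 = t0 - 2 / h t0"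
  have neg: "h t < 0" if "t \<ge> t0" for t using h_le[OF that] R by linarith
  have "t1 \<ge> t0" using neg[of t0] by (simp add: t1_def divide_nonneg_neg)
  have "t1 / 2 - 1 / h t1 \<le> t0 / 2 - 1 / h t0"
  proof (rule nonincreasing_if_derivative_nonpos[OF \<open>t1 \<ge> t0\<close>, where g = "\<lambda>t. t / 2 - 1 / h t"
        and g' = "\<lambda>t. 1 / 2 + h' t / (h t)\<^sup>2"])
    fix x assume "x \<in> {t0..t1}"
    then have x: "x \<ge> t0" by simp
    have hx: "h x \<noteq> 0" using neg[OF x] by simp
    show "((\<lambda>t. t / 2 - 1 / h t) has_real_derivative 1 / 2 + h' x / (h x)\<^sup>2) (at x within {t0..t1})"
      using hx by (auto intro!: derivative_eq_intros within simp: power2_eq_square)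
    have "R \<le> - h x" using h_le[OF x] by simp
    then have "R * R \<le> (- h x) * (- h x)" using R by (intro mult_mono) auto
    moreover have "R * 1 \<le> R * R" using R by (intro mult_left_mono) auto
    ultimately have "R \<le> (h x)\<^sup>2" by (simp add: power2_eq_square)
    then have "\<bar>A\<bar> \<le> (h x)\<^sup>2 / 2" by (simp add: R_def)
    then have "h' x \<le> - ((h x)\<^sup>2 / 2)" unfolding h'_def using zero_le_power2[of "\<kappa> x"] by linarith
    then show "1 / 2 + h' x / (h x)\<^sup>2 \<le> 0" using hx by (simp add: field_simps)
  qed
  moreover have "1 / h t1 < 0" using neg[OF \<open>t1 \<ge> t0\<close>] by simp
  moreover have "t1 / 2 = t0 / 2 - 1 / h t0" by (simp add: t1_def field_simps)
  ultimately show False by linarith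
qed

text \<open>Differentiating \<open>u \<bullet> u = 1\<close> shows that the derivative of the
  tangent is orthogonal to it, so the signed curvature is its only component.\<close>

lemma elastica_frenet:
  assumes E: "arc_length_parametrized E"
  shows "(E has_vector_derivative velocity E t) (at t)"
    and "(velocity E has_vector_derivative curvature E t *\<^sub>R (\<i> * velocity E t)) (at t)"
proof -
  define u where "u = velocity E"
  have n: "norm (u t) = 1" for t using E by (simp add: arc_length_parametrized_def u_def)
  show "(E has_vector_derivative velocity E t) (at t)"
    using E unfolding arc_length_parametrized_def velocity_def by (simp add: vector_derivative_works)
  define D where "D = vector_derivative u (at t)"
  have D: "(u has_vector_derivative D) (at t)"
    using E unfolding arc_length_parametrized_def D_def u_def by (simp add: vector_derivative_works)
  have "((\<lambda>s. u s \<bullet> u s) has_vector_derivative u t \<bullet> D + D \<bullet> u t) (at t)"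
    by (rule bounded_bilinear.has_vector_derivative[OF bounded_bilinear_inner D D])
  moreover have "(\<lambda>s. u s \<bullet> u s) = (\<lambda>_. 1)" by (simp add: fun_eq_iff dot_square_norm n)
  ultimately have "((\<lambda>_. 1) has_vector_derivative u t \<bullet> D + D \<bullet> u t) (at t)" by simp
  from vector_derivative_unique_at[OF this has_vector_derivative_const]
  have orth: "D \<bullet> u t = 0" by (simp add: inner_commute)
  have "curvature E t = D \<bullet> (\<i> * u t)"
    by (simp add: curvature_def u_def[symmetric] D_def[symmetric] inner_complex_def algebra_simps)
  then have "D = curvature E t *\<^sub>R (\<i> * u t)"
    using orthonormal_expansion[OF n, of D t] orth by simp
  then show "(velocity E has_vector_derivative curvature E t *\<^sub>R (\<i> * velocity E t)) (at t)"
    using D by (simp add: u_def)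
qed

text \<open>\<open>(\<kappa>\<^sup>2 / 2 + A) u + \<kappa>' i u\<close> is the conserved force vector of an elastica.\<close>

lemma elastica_force:
  assumes E: "non_inflectional_elastic_curve E"
  obtains A F where "A < 0" "norm F \<le> - A"
    "\<forall>t. F = ((curvature E t)\<^sup>2 / 2 + A) *\<^sub>R velocity E t + deriv (curvature E) t *\<^sub>R (\<i> * velocity E t)"
    "\<forall>t. (curvature E has_real_derivative deriv (curvature E) t) (at t)"
proof -
  have alp: "arc_length_parametrized E" and ne: "\<And>t. curvature E t \<noteq> 0"
    using E by (auto simp: non_inflectional_elastic_curve_def elastic_curve_def)
  obtain A where A: "\<forall>t. deriv (deriv (curvature E)) t + 1/2 * curvature E t ^ 3 + A * curvature E t = 0"
    using E by (auto simp: non_inflectional_elastic_curve_def elastic_curve_def)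
  define u where "u = velocity E"
  define \<kappa> where "\<kappa> = curvature E"
  define \<kappa>1 where "\<kappa>1 = deriv \<kappa>"
  have n: "norm (u t) = 1" for t using alp by (simp add: arc_length_parametrized_def u_def)
  have d\<kappa>: "(\<kappa> has_real_derivative \<kappa>1 t) (at t)" for t
    using E by (simp add: non_inflectional_elastic_curve_def elastic_curve_def \<kappa>_def \<kappa>1_def DERIV_deriv_iff_real_differentiable)
  have d\<kappa>1: "(\<kappa>1 has_real_derivative - (\<kappa> t ^ 3 / 2) - A * \<kappa> t) (at t)" for t
  proof -
    have "(\<kappa>1 has_real_derivative deriv \<kappa>1 t) (at t)"
      using E by (simp add: non_inflectional_elastic_curve_def elastic_curve_def \<kappa>_def \<kappa>1_def DERIV_deriv_iff_real_differentiable)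
    moreover have "deriv \<kappa>1 t = - (\<kappa> t ^ 3 / 2) - A * \<kappa> t"
      using A[rule_format, of t] unfolding \<kappa>_def[symmetric] \<kappa>1_def[symmetric] by linarith
    ultimately show ?thesis by simp
  qed
  have du: "(u has_vector_derivative \<kappa> t *\<^sub>R (\<i> * u t)) (at t)" for t
    unfolding u_def \<kappa>_def by (rule elastica_frenet(2)[OF alp])
  define F where "F t = ((\<kappa> t)\<^sup>2 / 2 + A) *\<^sub>R u t + \<kappa>1 t *\<^sub>R (\<i> * u t)" for t
  have "(F has_vector_derivative 0) (at t)" for t
  proof -
    have 1: "((\<lambda>t. (\<kappa> t)\<^sup>2 / 2 + A) has_real_derivative \<kappa> t * \<kappa>1 t) (at t)"
      by (auto intro!: derivative_eq_intros d\<kappa>)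
    have "(F has_vector_derivative
       ((((\<kappa> t)\<^sup>2 / 2 + A) *\<^sub>R (\<kappa> t *\<^sub>R (\<i> * u t)) + (\<kappa> t * \<kappa>1 t) *\<^sub>R u t) +
       (\<kappa>1 t *\<^sub>R (\<i> * (\<kappa> t *\<^sub>R (\<i> * u t))) + (- (\<kappa> t ^ 3 / 2) - A * \<kappa> t) *\<^sub>R (\<i> * u t)))) (at t)"
      unfolding F_def[abs_def]
      by (intro has_vector_derivative_add has_vector_derivative_scaleR has_vector_derivative_mult_right 1 du d\<kappa>1)
    moreover have "((((\<kappa> t)\<^sup>2 / 2 + A) *\<^sub>R (\<kappa> t *\<^sub>R (\<i> * u t)) + (\<kappa> t * \<kappa>1 t) *\<^sub>R u t) +
       (\<kappa>1 t *\<^sub>R (\<i> * (\<kappa> t *\<^sub>R (\<i> * u t))) + (- (\<kappa> t ^ 3 / 2) - A * \<kappa> t) *\<^sub>R (\<i> * u t))) = 0"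
      by (simp add: complex_eq_iff algebra_simps power2_eq_square power3_eq_cube)
    ultimately show ?thesis by (simp only:)
  qed
  then have "(F has_derivative (\<lambda>_. 0)) (at t)" for t by (simp add: has_vector_derivative_def)
  then have F: "F t = F 0" for t
    using has_derivative_zero_unique[of UNIV F t 0] by simp
  have nF: "(norm (F t))\<^sup>2 = ((\<kappa> t)\<^sup>2 / 2 + A)\<^sup>2 + (\<kappa>1 t)\<^sup>2" for t
  proof -
    have eq: "F t = Complex ((\<kappa> t)\<^sup>2 / 2 + A) (\<kappa>1 t) * u t" by (simp add: F_def complex_eq_iff)
    show ?thesis unfolding eq norm_mult n by (simp add: cmod_power2)
  qed
  \<comment> \<open>This is twice the usual energy constant of the elastica, and for negative
    \<open>A\<close> the bound \<open>B \<le> 0\<close> says the same as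
    \<open>norm F \<le> - A\<close>.\<close>
  define B where "B = (norm (F 0))\<^sup>2 - A\<^sup>2"
  have energy: "(\<kappa>1 t)\<^sup>2 + (\<kappa> t)\<^sup>2 * ((\<kappa> t)\<^sup>2 / 4 + A) = B" for t
    using nF[of t] unfolding F[of t] B_def by (simp add: power2_eq_square field_simps)
  have B: "B \<le> 0"
    by (rule elastica_energy_nonpos[OF d\<kappa> d\<kappa>1 _ energy]) (use ne in \<open>simp add: \<kappa>_def\<close>)
  \<comment> \<open>With \<open>A \<ge> 0\<close> the energy would be the sum of a square and a
    positive term, against \<open>B \<le> 0\<close>.\<close>
  have "A < 0"
  proof (rule ccontr)
    assume "\<not> A < 0"
    moreover have "(\<kappa> 0)\<^sup>2 > 0" using ne[of 0] by (simp add: \<kappa>_def)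
    ultimately have "(\<kappa> 0)\<^sup>2 * ((\<kappa> 0)\<^sup>2 / 4 + A) > 0" by (intro mult_pos_pos add_pos_nonneg) linarith+
    then show False using energy[of 0] B zero_le_power2[of "\<kappa>1 0"] by linarith
  qed
  moreover have "norm (F 0) \<le> - A"
  proof (rule power2_le_imp_le)
    show "(norm (F 0))\<^sup>2 \<le> (- A)\<^sup>2" using B by (simp add: B_def)
  qed (use \<open>A < 0\<close> in simp)
  moreover have "F 0 = ((\<kappa> t)\<^sup>2 / 2 + A) *\<^sub>R u t + \<kappa>1 t *\<^sub>R (\<i> * u t)" for t
    using F[of t] by (simp add: F_def)
  ultimately show thesis using d\<kappa> by (intro that[of A "F 0"]) (simp_all add: \<kappa>_def \<kappa>1_def u_def)
qed

text \<open>Matching the elastica equations after scaling by \<open>r\<close> requires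
  \<open>A / r\<^sup>2 = - (1 + P\<^sup>2) / (2 * l\<^sup>2)\<close> with \<open>P = norm p\<close>,
  and matching the force requires \<open>p = - (l\<^sup>2 / r\<^sup>2) F\<close>. Eliminating
  \<open>r\<close> leaves an equation for \<open>P\<close> alone.\<close>

lemma rescaled_elastica:
  assumes l: "l > 0" and E: "non_inflectional_elastic_curve E"
  obtains p u k E' where "complete_geodesic l p u k E'" "norm p \<le> 1" "same_shape E E'"
proof -
  obtain A F where A: "A < 0" and F_le: "norm F \<le> - A"
    and F: "\<forall>t. F = ((curvature E t)\<^sup>2 / 2 + A) *\<^sub>R velocity E t + deriv (curvature E) t *\<^sub>R (\<i> * velocity E t)"
    and d\<kappa>: "\<forall>t. (curvature E has_real_derivative deriv (curvature E) t) (at t)"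
    using elastica_force[OF E] .
  define u where "u = velocity E"
  define \<kappa> where "\<kappa> = curvature E"
  define \<kappa>1 where "\<kappa>1 = deriv \<kappa>"
  have alp: "arc_length_parametrized E" and ne: "\<And>t. \<kappa> t \<noteq> 0"
    using E by (auto simp: non_inflectional_elastic_curve_def elastic_curve_def \<kappa>_def)
  have n: "norm (u t) = 1" for t using alp by (simp add: arc_length_parametrized_def u_def)
  have F': "F = ((\<kappa> t)\<^sup>2 / 2 + A) *\<^sub>R u t + \<kappa>1 t *\<^sub>R (\<i> * u t)" for t
    using F by (simp add: u_def \<kappa>_def \<kappa>1_def)
  have uu: "u t \<bullet> u t = 1" "(\<i> * u t) \<bullet> (\<i> * u t) = 1" "u t \<bullet> (\<i> * u t) = 0" for t
    by (simp_all add: dot_square_norm n norm_mult) (simp add: inner_complex_def)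
  have Fu: "F \<bullet> u t = (\<kappa> t)\<^sup>2 / 2 + A" for t
    unfolding F'[of t] by (simp add: inner_add_left uu inner_commute[of "\<i> * u t" "u t"])
  have Fiu: "F \<bullet> (\<i> * u t) = \<kappa>1 t" for t
    unfolding F'[of t] by (simp add: inner_add_left uu)
  \<comment> \<open>\<open>P / (1 + P\<^sup>2)\<close> takes the same value at \<open>P\<close> and
    \<open>1 / P\<close>; the root in \<open>{0..1}\<close> is taken because minimality will need
    \<open>norm p \<le> 1\<close>. On this interval the function reaches \<open>1 / 2\<close>, and
    \<open>norm F \<le> - A\<close> says that no larger value is required.\<close>
  have "\<exists>P. 0 \<le> P \<and> P \<le> 1 \<and> P / (1 + P\<^sup>2) = norm F / (- 2 * A)"
  proof (rule IVT')
    show "0 / (1 + 0\<^sup>2) \<le> norm F / (- 2 * A)" using A by (simp add: divide_nonneg_neg)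
    show "norm F / (- 2 * A) \<le> 1 / (1 + 1\<^sup>2)" using A F_le by (simp add: field_simps)
    have "1 + x\<^sup>2 \<noteq> 0" for x :: real using zero_le_power2[of x] by linarith
    then show "continuous_on {0..1} (\<lambda>P::real. P / (1 + P\<^sup>2))" by (intro continuous_intros) auto
  qed simp
  then obtain P where P: "0 \<le> P" "P \<le> 1" "P / (1 + P\<^sup>2) = norm F / (- 2 * A)" by blast
  have P1: "1 + P\<^sup>2 > 0" by (simp add: add_pos_nonneg)
  define r where "r = l * sqrt (- 2 * A / (1 + P\<^sup>2))"
  have r: "r > 0" using l A P1 by (simp add: r_def divide_neg_pos)
  have "0 \<le> - 2 * A / (1 + P\<^sup>2)" using A P1 by (intro divide_nonneg_pos) auto
  then have r2: "r\<^sup>2 = l\<^sup>2 * (- 2 * A) / (1 + P\<^sup>2)"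
    unfolding r_def power_mult_distrib by (simp only: real_sqrt_pow2 times_divide_eq_right)
  have lr: "l\<^sup>2 / r\<^sup>2 = (1 + P\<^sup>2) / (- 2 * A)" unfolding r2 using l A P1 by (simp add: field_simps)
  define p where "p = (- (l\<^sup>2 / r\<^sup>2)) *\<^sub>R F"
  have np: "norm p = P"
  proof -
    have "norm p = (l\<^sup>2 / r\<^sup>2) * norm F" by (simp add: p_def)
    also have "\<dots> = (1 + P\<^sup>2) * (norm F / (- 2 * A))" unfolding lr by simp
    also have "\<dots> = P" unfolding P(3)[symmetric] using P1 by simp
    finally show ?thesis .
  qed
  define E' where "E' s = r *\<^sub>R E (s / r)" for s
  define v where "v s = u (s / r)" for s
  define k where "k s = \<kappa> (s / r) / r" for s
  have inner_r: "((\<lambda>s. s / r) has_real_derivative 1 / r) (at s)" for s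
    using r by (auto intro!: derivative_eq_intros)
  note inner_v = inner_r[unfolded has_real_derivative_iff_has_vector_derivative]
  have "complete_geodesic l p v k E'"
  proof
    show "l > 0" by fact
    show "k s \<noteq> 0" for s using ne r by (simp add: k_def)
    have "((\<lambda>s. E (s / r)) has_vector_derivative (1 / r) *\<^sub>R u (s / r)) (at s)" for s
      using vector_diff_chain_at[OF inner_v elastica_frenet(1)[OF alp]] by (simp add: o_def u_def)
    from bounded_linear.has_vector_derivative[OF bounded_linear_scaleR_right this, of r]
    show "(E' has_vector_derivative v s) (at s)" for s
      using r by (simp add: E'_def[abs_def] v_def)
    show "geodesic_ode l p UNIV v k" unfolding geodesic_ode_def
    proof (intro ballI conjI)
      fix s
      show "norm (v s) = 1" by (simp add: v_def n)
      have "(norm (v s - p))\<^sup>2 = 1 + P\<^sup>2 - 2 * (p \<bullet> v s)"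
        unfolding np[symmetric] power2_norm_eq_inner
        using uu(1)[of "s / r"] by (simp add: v_def inner_diff_left inner_diff_right inner_commute)
      also have "p \<bullet> v s = - (l\<^sup>2 / r\<^sup>2) * ((\<kappa> (s / r))\<^sup>2 / 2) - (l\<^sup>2 / r\<^sup>2) * A"
        by (simp add: p_def v_def Fu algebra_simps)
      also have "(l\<^sup>2 / r\<^sup>2) * A = - (1 + P\<^sup>2) / 2" unfolding lr using A by (simp add: field_simps)
      also have "1 + P\<^sup>2 - 2 * (- (l\<^sup>2 / r\<^sup>2) * ((\<kappa> (s / r))\<^sup>2 / 2) - - (1 + P\<^sup>2) / 2) = (l\<^sup>2 / r\<^sup>2) * (\<kappa> (s / r))\<^sup>2"
        by (simp add: field_simps)
      also have "\<dots> = (l * k s)\<^sup>2" by (simp add: k_def power_mult_distrib power_divide)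
      finally show "(l * k s)\<^sup>2 = (norm (v s - p))\<^sup>2" by simp
      have "(v has_vector_derivative (1 / r) *\<^sub>R (\<kappa> (s / r) *\<^sub>R (\<i> * u (s / r)))) (at s)"
        using vector_diff_chain_at[OF inner_v elastica_frenet(2)[OF alp]] by (simp add: o_def u_def \<kappa>_def v_def[abs_def])
      then show "(v has_vector_derivative k s *\<^sub>R (\<i> * v s)) (at s)" by (simp add: k_def v_def)
      have "(curvature E has_real_derivative \<kappa>1 (s / r)) (at (s / r))" using d\<kappa> by (simp add: \<kappa>1_def \<kappa>_def)
      then have "((\<lambda>s. \<kappa> (s / r)) has_real_derivative \<kappa>1 (s / r) * (1 / r)) (at s)"
        unfolding \<kappa>_def by (rule DERIV_chain2[OF _ inner_r])
      from DERIV_cdivide[OF this, of r]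
      have "(k has_real_derivative \<kappa>1 (s / r) * (1 / r) / r) (at s)" by (simp add: k_def[abs_def])
      moreover have "\<kappa>1 (s / r) * (1 / r) / r = - (p \<bullet> (\<i> * v s)) / l\<^sup>2"
        using l r by (simp add: p_def v_def Fiu power2_eq_square)
      ultimately show "(k has_real_derivative - (p \<bullet> (\<i> * v s)) / l\<^sup>2) (at s)" by simp
    qed
  qed
  moreover have "same_shape E E'" unfolding same_shape_def
  proof (intro exI conjI allI)
    show "plane_homothety (id \<circ> (\<lambda>x. 0 + r *\<^sub>R (x - 0)))" unfolding plane_homothety_def
      using r by (intro exI[of _ id] exI[of _ 0] exI[of _ r]) (simp add: plane_isometry_def)
    show "homeomorphism UNIV UNIV (\<lambda>t. r * t) (\<lambda>t. t / r)"
      using r unfolding homeomorphism_def by (auto intro!: continuous_intros image_eqI[of _ _ "_ / r"] image_eqI[of _ _ "r * _"])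
    show "(id \<circ> (\<lambda>x. 0 + r *\<^sub>R (x - 0))) (E t) = E' (r * t)" for t using r by (simp add: E'_def)
  qed
  ultimately show thesis using that np P by blast
qed

section \<open>Short geodesics minimize\<close>

context bicycle_track
begin

text \<open>A calibration argument: the function \<open>p \<bullet> f + W \<theta>\<close> of the configuration has horizontal
  gradient of norm at most one, hence grows along a bicycle path at most as fast as the length.\<close>

lemma calibration:
  fixes p z0 :: complex and \<theta> W W' :: "real \<Rightarrow> real"
  assumes z0: "norm z0 = 1" and \<theta>: "\<And>t. t \<in> {a..b} \<Longrightarrow> frame t = l *\<^sub>R (z0 * cis (\<theta> t))"
    and \<theta>_lip: "\<And>x y. \<lbrakk>x \<in> {a..b}; y \<in> {a..b}\<rbrakk> \<Longrightarrow> \<bar>\<theta> x - \<theta> y\<bar> \<le> C * norm (frame x - frame y)"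
    and W: "\<And>x. (W has_real_derivative W' x) (at x)" and W'_le: "\<And>x. \<bar>W' x\<bar> \<le> L"
    and unit: "\<And>x. norm (p + (W' x / l) *\<^sub>R (\<i> * (z0 * cis x))) \<le> 1"
  shows "\<bar>(p \<bullet> front b + W (\<theta> b)) - (p \<bullet> front a + W (\<theta> a))\<bar> \<le> M b - M a"
proof -
  obtain N where N: "negligible N"
    "\<And>t. t \<in> {a..b} - N \<Longrightarrow> \<exists>c::real. (back has_vector_derivative c *\<^sub>R frame t) (at t within {a..b})"
    using noskid_ae by blast
  define g where "g t = p \<bullet> front t + W (\<theta> t)" for t
  have L: "L \<ge> 0" using W'_le[of 0] by linarith
  have W_lip: "\<bar>W x - W y\<bar> \<le> L * \<bar>x - y\<bar>" for x y
    using field_differentiable_bound[of UNIV W W' L x y] W W'_le by simp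
  define C' where "C' = \<bar>C\<bar>"
  have C': "C' \<ge> 0" by (simp add: C'_def)
  have \<theta>_lip': "\<bar>\<theta> x - \<theta> y\<bar> \<le> C' * norm (frame x - frame y)" if "x \<in> {a..b}" "y \<in> {a..b}" for x y
    by (rule order_trans[OF \<theta>_lip[OF that]]) (simp add: C'_def mult_right_mono)
  have "dist (g a) (g b) \<le> M b - M a"
  proof (rule abs_continuous_dist_le[OF a_le_b _ M_mono N(1)])
    show "abs_continuous_on_interval a b g"
    proof (rule abs_continuous_compose_lipschitz[OF abs_continuous_path, where C = "norm p + L * (C' * 2)"])
      fix x y assume xy: "x \<in> {a..b}" "y \<in> {a..b}"
      have "norm (frame x - frame y) \<le> norm (front x - front y) + norm (back x - back y)"
        using norm_triangle_ineq4[of "front x - front y" "back x - back y"] by (simp add: frame_def algebra_simps)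
      also have "\<dots> \<le> 2 * dist (\<gamma> x) (\<gamma> y)"
        using dist_fst_le[of "\<gamma> x" "\<gamma> y"] dist_snd_le[of "\<gamma> x" "\<gamma> y"] by (simp add: dist_norm)
      finally have "C' * norm (frame x - frame y) \<le> C' * (2 * dist (\<gamma> x) (\<gamma> y))" using C' by (rule mult_left_mono)
      with \<theta>_lip'[OF xy] have th: "\<bar>\<theta> x - \<theta> y\<bar> \<le> C' * 2 * dist (\<gamma> x) (\<gamma> y)" by simp
      have "\<bar>W (\<theta> x) - W (\<theta> y)\<bar> \<le> L * (C' * 2 * dist (\<gamma> x) (\<gamma> y))"
        by (rule order_trans[OF W_lip mult_left_mono[OF th L]])
      moreover have "\<bar>p \<bullet> (front x - front y)\<bar> \<le> norm p * dist (\<gamma> x) (\<gamma> y)"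
        using order_trans[OF Cauchy_Schwarz_ineq2[of p "front x - front y"] mult_left_mono[OF dist_snd_le[of "\<gamma> x" "\<gamma> y", unfolded dist_norm] norm_ge_zero[of p]]]
        by (simp add: dist_norm)
      moreover have "dist (g x) (g y) \<le> \<bar>p \<bullet> (front x - front y)\<bar> + \<bar>W (\<theta> x) - W (\<theta> y)\<bar>"
        by (simp add: g_def dist_real_def inner_diff_right)
      ultimately show "dist (g x) (g y) \<le> (norm p + L * (C' * 2)) * dist (\<gamma> x) (\<gamma> y)" by (simp add: algebra_simps)
    qed
    fix t \<epsilon> :: real assume t': "t \<in> {a..b} - N" and \<epsilon>: "\<epsilon> > 0"
    then have t: "t \<in> {a..b}" by simp
    obtain c where c: "(back has_vector_derivative c *\<^sub>R frame t) (at t within {a..b})" using N(2)[OF t'] by blast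
    define et where "et = z0 * cis (\<theta> t)"
    have net: "norm (\<i> * et) = 1" by (simp add: et_def norm_mult z0)
    define D where "D = W' (\<theta> t)"
    define q where "q = p + (D / l) *\<^sub>R (\<i> * et)"
    have q: "norm q \<le> 1" unfolding q_def D_def et_def by (rule unit)
    \<comment> \<open>\<open>sin (\<theta> r - \<theta> t)\<close> is a linear function of the
      frame, so its increments are known exactly from those of front and back. What remains of
      \<open>W\<close> is \<Psi>, whose derivative at \<open>\<theta> t\<close> is 0.\<close>
    define \<Psi> where "\<Psi> x = W x - D * sin (x - \<theta> t)" for x
    have "(\<Psi> has_vector_derivative 0) (at (\<theta> t) within UNIV)"
      unfolding \<Psi>_def[abs_def] has_real_derivative_iff_has_vector_derivative[symmetric]
      by (auto intro!: derivative_eq_intros W simp: D_def)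
    define \<epsilon>1 where "\<epsilon>1 = \<epsilon> / (2 * C' + 1)"
    have \<epsilon>1: "\<epsilon>1 > 0" "\<epsilon>1 * (2 * C') \<le> \<epsilon>" using \<epsilon> C' by (auto simp: \<epsilon>1_def field_simps)
    obtain \<delta>1 where \<delta>1: "\<delta>1 > 0" and \<Psi>: "\<forall>y. \<bar>y - \<theta> t\<bar> < \<delta>1 \<longrightarrow> \<bar>\<Psi> y - \<Psi> (\<theta> t)\<bar> \<le> \<epsilon>1 * \<bar>y - \<theta> t\<bar>"
      using \<open>(\<Psi> has_vector_derivative 0) (at (\<theta> t) within UNIV)\<close> \<epsilon>1(1)
      unfolding has_vector_derivative_def has_derivative_within_alt by auto
    \<comment> \<open>The no-skid error gets multiplied by \<open>|D / l| \<le> L / l\<close>; the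
      denominator \<open>L + 1\<close> is positive also when \<open>L\<close> is 0.\<close>
    define \<epsilon>2 where "\<epsilon>2 = \<epsilon> * l / (L + 1)"
    have \<epsilon>2: "\<epsilon>2 > 0" "L / l * \<epsilon>2 \<le> \<epsilon>"
      using \<epsilon> l_pos L by (auto simp: \<epsilon>2_def field_simps)
    obtain \<delta>2 where \<delta>2: "\<delta>2 > 0" "\<And>x y. \<lbrakk>x \<in> {a..b}; y \<in> {a..b}; x \<le> t; t \<le> y; t - x < \<delta>2; y - t < \<delta>2\<rbrakk> \<Longrightarrow>
       norm (back y - back x - (y - x) *\<^sub>R (c *\<^sub>R frame t)) \<le> \<epsilon>2 * (y - x)"
      using vector_derivative_straddle[OF c \<epsilon>2(1)] by blast
    have \<delta>1C: "\<delta>1 / (C' + 1) > 0" using \<delta>1 C' by (intro divide_pos_pos) auto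
    obtain \<delta>3 where \<delta>3: "\<delta>3 > 0" "\<forall>y\<in>{a..b}. dist y t < \<delta>3 \<longrightarrow> dist (frame y) (frame t) < \<delta>1 / (C' + 1)"
      using continuous_on_frame[unfolded continuous_on_iff, THEN bspec, OF t, rule_format, OF \<delta>1C]
      by (elim exE conjE) (rule that)
    have near: "\<bar>\<theta> y - \<theta> t\<bar> < \<delta>1" if y: "y \<in> {a..b}" "\<bar>y - t\<bar> < \<delta>3" for y
    proof -
      have "norm (frame y - frame t) < \<delta>1 / (C' + 1)"
        using \<delta>3(2)[rule_format, OF y(1)] y(2) by (simp add: dist_norm)
      then have "(C' + 1) * norm (frame y - frame t) < \<delta>1" using C' by (simp add: field_simps)
      moreover have "C' * norm (frame y - frame t) \<le> (C' + 1) * norm (frame y - frame t)" by (intro mult_right_mono) auto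
      ultimately show ?thesis using \<theta>_lip'[OF y(1) t] by linarith
    qed
    show "\<exists>\<delta>>0. \<forall>x y. x \<in> {a..b} \<and> y \<in> {a..b} \<and> x \<le> t \<and> t \<le> y \<and> t - x < \<delta> \<and> y - t < \<delta> \<longrightarrow>
         dist (g x) (g y) \<le> (1 + \<epsilon>) * (M y - M x) + \<epsilon> * (y - x)"
    proof (intro exI[of _ "min \<delta>2 \<delta>3"] conjI allI impI)
      show "min \<delta>2 \<delta>3 > 0" using \<delta>2 \<delta>3 by simp
      fix x y assume A: "x \<in> {a..b} \<and> y \<in> {a..b} \<and> x \<le> t \<and> t \<le> y \<and> t - x < min \<delta>2 \<delta>3 \<and> y - t < min \<delta>2 \<delta>3"
      then have xy: "x \<in> {a..b}" "y \<in> {a..b}" "x \<le> t" "t \<le> y" by auto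
      have Mxt: "M x \<le> M t" "M t \<le> M y" using mono_onD[OF M_mono] xy t by auto
      define R where "R = back y - back x - (y - x) *\<^sub>R (c *\<^sub>R frame t)"
      have R: "norm R \<le> \<epsilon>2 * (y - x)" unfolding R_def using A xy by (intro \<delta>2) auto
      have sin_eq: "sin (\<theta> r - \<theta> t) = (1 / l) * (frame r \<bullet> (\<i> * et))" if "r \<in> {a..b}" for r
      proof -
        have "Re z0 * Re z0 + Im z0 * Im z0 = 1"
          using z0 by (simp add: cmod_def real_sqrt_eq_1_iff power2_eq_square)
        then have "sin (\<theta> r - \<theta> t) * (Re z0 * Re z0 + Im z0 * Im z0) = sin (\<theta> r - \<theta> t)" by simp
        moreover have "(z0 * cis (\<theta> r)) \<bullet> (\<i> * et) = sin (\<theta> r - \<theta> t) * (Re z0 * Re z0 + Im z0 * Im z0)"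
          by (simp add: et_def inner_complex_def sin_diff algebra_simps)
        ultimately show ?thesis using l_pos \<theta>[OF that] by simp
      qed
      have frame_t: "frame t \<bullet> (\<i> * et) = 0"
        unfolding \<theta>[OF t] et_def[symmetric] by (simp add: inner_complex_def)
      have back_eq: "back y - back x = R + ((y - x) * c) *\<^sub>R frame t" by (simp add: R_def)
      have "(back y - back x) \<bullet> (\<i> * et) = R \<bullet> (\<i> * et)"
        unfolding back_eq inner_add_left inner_scaleR_left frame_t by simp
      moreover have "frame y - frame x = (front y - front x) - (back y - back x)" by (simp add: frame_def)
      ultimately have fr: "(frame y - frame x) \<bullet> (\<i> * et) = (front y - front x) \<bullet> (\<i> * et) - R \<bullet> (\<i> * et)"
        by (simp only: inner_diff_left)
      have "W (\<theta> y) - W (\<theta> x) = D * (sin (\<theta> y - \<theta> t) - sin (\<theta> x - \<theta> t)) + (\<Psi> (\<theta> y) - \<Psi> (\<theta> x))"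
        by (simp add: \<Psi>_def algebra_simps)
      also have "sin (\<theta> y - \<theta> t) - sin (\<theta> x - \<theta> t) = (1 / l) * ((front y - front x) \<bullet> (\<i> * et) - R \<bullet> (\<i> * et))"
        unfolding sin_eq[OF xy(1)] sin_eq[OF xy(2)] fr[symmetric] by (simp add: inner_diff_left right_diff_distrib diff_divide_distrib)
      \<comment> \<open>The back wheel moves along the frame and drops out to first order, so the
        increment of \<open>g\<close> is the front increment paired with the horizontal gradient
        \<open>q\<close>, up to the two error terms.\<close>
      finally have gq: "g y - g x = (front y - front x) \<bullet> q - (D / l) * (R \<bullet> (\<i> * et)) + (\<Psi> (\<theta> y) - \<Psi> (\<theta> x))"
        by (simp add: g_def q_def inner_add_right inner_diff_left inner_diff_right inner_commute[of p] algebra_simps diff_divide_distrib)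
      have 1: "\<bar>(front y - front x) \<bullet> q\<bar> \<le> M y - M x"
      proof -
        have "\<bar>(front y - front x) \<bullet> q\<bar> \<le> norm (front y - front x) * 1"
          by (rule order_trans[OF Cauchy_Schwarz_ineq2 mult_left_mono[OF q norm_ge_zero]])
        then show ?thesis using front_le[of x y] xy by simp
      qed
      have 2: "\<bar>(D / l) * (R \<bullet> (\<i> * et))\<bar> \<le> \<epsilon> * (y - x)"
      proof -
        have "\<bar>R \<bullet> (\<i> * et)\<bar> \<le> \<epsilon>2 * (y - x)"
          using order_trans[OF Cauchy_Schwarz_ineq2[of R "\<i> * et", unfolded net mult_1_right] R] .
        moreover have "\<bar>D / l\<bar> \<le> L / l" using W'_le[of "\<theta> t"] l_pos by (simp add: D_def divide_right_mono)
        ultimately have "\<bar>D / l\<bar> * \<bar>R \<bullet> (\<i> * et)\<bar> \<le> (L / l) * (\<epsilon>2 * (y - x))" using L l_pos by (intro mult_mono) auto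
        also have "\<dots> = (L / l * \<epsilon>2) * (y - x)" by (simp only: mult.assoc)
        also have "\<dots> \<le> \<epsilon> * (y - x)" using xy \<epsilon>2(2) by (intro mult_right_mono) auto
        finally show ?thesis by (simp only: abs_mult)
      qed
      have th: "\<bar>\<theta> y - \<theta> t\<bar> \<le> C' * (2 * (M y - M t))" "\<bar>\<theta> x - \<theta> t\<bar> \<le> C' * (2 * (M t - M x))"
      proof -
        have "norm (frame y - frame t) \<le> 2 * (M y - M t)" using xy t by (intro frame_le) auto
        then show "\<bar>\<theta> y - \<theta> t\<bar> \<le> C' * (2 * (M y - M t))"
          using order_trans[OF \<theta>_lip'[OF xy(2) t] mult_left_mono[OF _ C']] by blast
        have "norm (frame t - frame x) \<le> 2 * (M t - M x)" using xy t by (intro frame_le) auto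
        then show "\<bar>\<theta> x - \<theta> t\<bar> \<le> C' * (2 * (M t - M x))"
          using order_trans[OF \<theta>_lip'[OF xy(1) t] mult_left_mono[OF _ C']] by (simp add: norm_minus_commute)
      qed
      have \<Psi>y: "\<bar>\<Psi> (\<theta> y) - \<Psi> (\<theta> t)\<bar> \<le> \<epsilon>1 * \<bar>\<theta> y - \<theta> t\<bar>"
        and \<Psi>x: "\<bar>\<Psi> (\<theta> x) - \<Psi> (\<theta> t)\<bar> \<le> \<epsilon>1 * \<bar>\<theta> x - \<theta> t\<bar>"
        using \<Psi> near[of y] near[of x] A xy by auto
      have "\<bar>\<Psi> (\<theta> y) - \<Psi> (\<theta> x)\<bar> \<le> \<bar>\<Psi> (\<theta> y) - \<Psi> (\<theta> t)\<bar> + \<bar>\<Psi> (\<theta> x) - \<Psi> (\<theta> t)\<bar>" by linarith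
      also have "\<dots> \<le> \<epsilon>1 * (C' * (2 * (M y - M t))) + \<epsilon>1 * (C' * (2 * (M t - M x)))"
        using \<epsilon>1(1) by (intro add_mono order_trans[OF \<Psi>y mult_left_mono[OF th(1)]] order_trans[OF \<Psi>x mult_left_mono[OF th(2)]]) simp_all
      also have "\<dots> = (\<epsilon>1 * (2 * C')) * (M y - M x)" by (simp add: algebra_simps)
      also have "\<dots> \<le> \<epsilon> * (M y - M x)" using \<epsilon>1(2) Mxt by (intro mult_right_mono) auto
      finally have 3: "\<bar>\<Psi> (\<theta> y) - \<Psi> (\<theta> x)\<bar> \<le> \<epsilon> * (M y - M x)" .
      have "\<bar>g y - g x\<bar> \<le> (M y - M x) + \<epsilon> * (y - x) + \<epsilon> * (M y - M x)"
        unfolding gq using 1 2 3 by linarith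
      then show "dist (g x) (g y) \<le> (1 + \<epsilon>) * (M y - M x) + \<epsilon> * (y - x)"
        by (simp add: dist_real_def abs_minus_commute algebra_simps)
    qed
  qed
  then show ?thesis by (simp add: g_def dist_real_def abs_minus_commute)
qed

end

lemma lipschitz_if_derivative_bounded:
  fixes g :: "real \<Rightarrow> complex"
  assumes "\<And>t. (g has_vector_derivative g' t) (at t)" "\<And>t. norm (g' t) \<le> C"
  shows "norm (g x - g y) \<le> C * \<bar>x - y\<bar>"
proof -
  have "norm (g x - g y) \<le> C * norm (x - y)"
  proof (rule differentiable_bound[of UNIV g "\<lambda>t h. h *\<^sub>R g' t" C])
    show "(g has_derivative (\<lambda>h. h *\<^sub>R g' t)) (at t within UNIV)" for t
      using assms(1) by (simp add: has_vector_derivative_def)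
    show "onorm (\<lambda>h. h *\<^sub>R g' t) \<le> C" for t
      by (rule onorm_le) (use mult_left_mono[OF assms(2), of "\<bar>h\<bar>" t for h] in \<open>simp add: mult.commute\<close>)
  qed auto
  then show ?thesis by simp
qed

text \<open>Points of this ball have norm above \<open>1 / 2\<close>, which bounds the derivative of
  \<open>Ln\<close> by 2. So near a reference direction the angle of a frame is a Lipschitz function
  of the frame.\<close>

lemma abs_Im_Ln_diff_le:
  assumes "z \<in> ball 1 (1/2)" "w \<in> ball 1 (1/2)"
  shows "\<bar>Im (Ln z) - Im (Ln w)\<bar> \<le> 2 * norm (z - w)"
proof -
  have *: "x \<notin> \<real>\<^sub>\<le>\<^sub>0 \<and> norm (inverse x) \<le> 2" if "x \<in> ball 1 (1/2)" for x :: complex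
  proof -
    have "norm (1 - x) < 1/2" using that by (simp add: dist_norm)
    then have "norm x > 1/2" "Re x > 0"
      using norm_triangle_ineq2[of 1 x] complex_Re_le_cmod[of "1 - x"] by (simp_all add: norm_minus_commute)
    moreover have "inverse (norm x) \<le> inverse (1/2)" using \<open>norm x > 1/2\<close> by (intro le_imp_inverse_le) auto
    ultimately show ?thesis by (simp add: complex_nonpos_Reals_iff norm_inverse)
  qed
  have "norm (Ln z - Ln w) \<le> 2 * norm (z - w)"
  proof (rule field_differentiable_bound[OF convex_ball, where f' = inverse])
    fix x assume x: "x \<in> ball (1::complex) (1/2)"
    show "(Ln has_field_derivative inverse x) (at x within ball 1 (1/2))"
      by (rule has_field_derivative_at_within[OF has_field_derivative_Ln]) (rule *[OF x, THEN conjunct1])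
    show "norm (inverse x) \<le> 2" by (rule *[OF x, THEN conjunct2])
  qed (use assms in auto)
  then show ?thesis using abs_Im_le_cmod[of "Ln z - Ln w"] by simp
qed

lemma cis_Im_Ln: "norm z = 1 \<Longrightarrow> cis (Im (Ln z)) = z"
proof -
  assume z: "norm z = 1"
  then have "z \<noteq> 0" by auto
  then have "Ln z = \<i> * of_real (Im (Ln z))" using z Re_Ln[of z] by (simp add: complex_eq_iff)
  then have "exp (Ln z) = exp (\<i> * of_real (Im (Ln z)))" by (rule arg_cong)
  moreover have "exp (Ln z) = z" using z by (intro exp_Ln) auto
  ultimately show ?thesis by (simp only: cis_conv_exp)
qed

context complete_geodesic
begin

text \<open>Solves the relation \<open>u s - p = (l * k s) \<i> e s\<close> of a geodesic for the
  frame direction, which is possible because \<open>k\<close> does not vanish.\<close>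

definition e where "e s = (1 / (l * k s)) *\<^sub>R (- (\<i> * (u s - p)))"
definition v where "v s = u s \<bullet> e s"
definition w where "w s = u s \<bullet> (\<i> * e s)"

lemma norm_e: "norm (e s) = 1"
proof -
  have "norm (u s - p) = \<bar>l * k s\<bar>"
    using lk[of s] by - (rule power2_eq_imp_eq, simp_all)
  then show ?thesis using k_ne[of s] l_pos by (simp add: e_def norm_mult)
qed

lemma u_expand: "u s = v s *\<^sub>R e s + w s *\<^sub>R (\<i> * e s)"
  unfolding v_def w_def by (rule orthonormal_expansion[OF norm_e])

lemma u_minus_p: "u s - p = (l * k s) *\<^sub>R (\<i> * e s)"
  using k_ne[of s] l_pos by (simp add: e_def complex_eq_iff)

lemma ortho: "e s \<bullet> (\<i> * e s) = 0" "(\<i> * e s) \<bullet> e s = 0"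
  by (simp_all add: inner_complex_def)

lemma p_e: "p \<bullet> e s = v s"
proof -
  have "(u s - p) \<bullet> e s = 0" unfolding u_minus_p by (simp add: ortho)
  then show ?thesis by (simp add: v_def inner_diff_left)
qed

lemma w_minus: "w s - p \<bullet> (\<i> * e s) = l * k s"
proof -
  have "(u s - p) \<bullet> (\<i> * e s) = l * k s"
    unfolding u_minus_p using norm_e[of s] by (simp add: dot_square_norm norm_mult)
  then show ?thesis by (simp add: w_def inner_diff_left)
qed

lemma v2_w2: "(v s)\<^sup>2 + (w s)\<^sup>2 = 1"
proof -
  have eq: "u s = Complex (v s) (w s) * e s" using u_expand[of s] by (simp add: complex_eq_iff)
  have "(norm (Complex (v s) (w s) * e s))\<^sup>2 = 1" using norm_u[of s] unfolding eq by simp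
  then show ?thesis unfolding norm_mult norm_e by (simp add: cmod_power2)
qed

text \<open>Differentiation gives \<open>u / l\<close> minus \<open>k' / k\<close> times
  \<open>e\<close>. The curvature equation says \<open>k' / k = v / l\<close>, so the components
  along \<open>e\<close> cancel and the frame direction only turns.\<close>

lemma e_deriv: "(e has_vector_derivative (w s / l) *\<^sub>R (\<i> * e s)) (at s)"
proof -
  define k' where "k' = - (p \<bullet> (\<i> * u s)) / l\<^sup>2"
  have lks: "l * k s \<noteq> 0" using k_ne l_pos by simp
  have kd: "((\<lambda>s. 1 / (l * k s)) has_real_derivative - (l * k') / (l * k s)\<^sup>2) (at s)"
    using lks k_deriv[of s] unfolding k'_def[symmetric]
    by (auto intro!: derivative_eq_intros simp: power2_eq_square)
  have ud: "((\<lambda>s. - (\<i> * (u s - p))) has_vector_derivative - (\<i> * (k s *\<^sub>R (\<i> * u s) - 0))) (at s)"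
    by (intro has_vector_derivative_minus has_vector_derivative_mult_right has_vector_derivative_diff u_deriv has_vector_derivative_const)
  have "(e has_vector_derivative (1 / (l * k s)) *\<^sub>R (- (\<i> * (k s *\<^sub>R (\<i> * u s) - 0)))
     + (- (l * k') / (l * k s)\<^sup>2) *\<^sub>R (- (\<i> * (u s - p)))) (at s)"
    unfolding e_def[abs_def] by (rule has_vector_derivative_scaleR[OF kd ud])
  moreover have "(1 / (l * k s)) *\<^sub>R (- (\<i> * (k s *\<^sub>R (\<i> * u s) - 0))) = (1 / l) *\<^sub>R u s"
    using k_ne[of s] l_pos by (simp add: complex_eq_iff)
  moreover have "(- (l * k') / (l * k s)\<^sup>2) *\<^sub>R (- (\<i> * (u s - p))) = - (k' / k s) *\<^sub>R e s"
    using k_ne[of s] l_pos by (simp add: e_def power2_eq_square)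
  moreover have "k' / k s = v s / l"
  proof -
    have "v s * (l * k s) = - (p \<bullet> (\<i> * u s))"
      using k_ne[of s] l_pos by (simp add: v_def e_def inner_complex_def algebra_simps)
    then show ?thesis using k_ne[of s] l_pos by (simp add: k'_def power2_eq_square field_simps)
  qed
  ultimately have "(e has_vector_derivative (1 / l) *\<^sub>R u s + - (v s / l) *\<^sub>R e s) (at s)" by (simp only:)
  moreover have "(1 / l) *\<^sub>R u s + - (v s / l) *\<^sub>R e s = (w s / l) *\<^sub>R (\<i> * e s)"
    unfolding u_expand[of s] by (simp add: algebra_simps)
  ultimately show ?thesis by (simp only:)
qed

lemma abs_v_le: "\<bar>v s\<bar> \<le> 1" and abs_w_le: "\<bar>w s\<bar> \<le> 1"
proof -
  have "(v s)\<^sup>2 \<le> 1" "(w s)\<^sup>2 \<le> 1"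
    using v2_w2[of s] zero_le_power2[of "v s"] zero_le_power2[of "w s"] by linarith+
  then show "\<bar>v s\<bar> \<le> 1" "\<bar>w s\<bar> \<le> 1" by (simp_all only: abs_square_le_1)
qed

definition b where "b s = E s - l *\<^sub>R e s"

lemma b_deriv: "(b has_vector_derivative v s *\<^sub>R e s) (at s)"
proof -
  have "(b has_vector_derivative u s - l *\<^sub>R ((w s / l) *\<^sub>R (\<i> * e s))) (at s)"
    unfolding b_def[abs_def]
    by (intro has_vector_derivative_diff E_deriv bounded_linear.has_vector_derivative[OF bounded_linear_scaleR_right] e_deriv)
  moreover have "u s - l *\<^sub>R ((w s / l) *\<^sub>R (\<i> * e s)) = v s *\<^sub>R e s"
    using u_expand[of s] l_pos by simp
  ultimately show ?thesis by (simp only:)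
qed

lemma E_lip: "norm (E x - E y) \<le> \<bar>x - y\<bar>"
  using lipschitz_if_derivative_bounded[OF E_deriv, of 1] norm_u by simp

lemma b_lip: "norm (b x - b y) \<le> \<bar>x - y\<bar>"
  using lipschitz_if_derivative_bounded[OF b_deriv, of 1] norm_e abs_v_le by simp

lemma e_lip: "norm (e x - e y) \<le> (1 / l) * \<bar>x - y\<bar>"
proof (rule lipschitz_if_derivative_bounded[OF e_deriv])
  show "norm ((w t / l) *\<^sub>R (\<i> * e t)) \<le> 1 / l" for t
    using norm_e abs_w_le[of t] l_pos by (simp add: norm_mult divide_right_mono)
qed

lemma geodesic_bicycle_path: "\<tau> \<ge> 0 \<Longrightarrow> bicycle_path l 0 \<tau> (\<lambda>s. (b s, E s))"
  unfolding bicycle_path_def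
proof (intro conjI ballI)
  show "abs_continuous_on_interval 0 \<tau> (\<lambda>s. (b s, E s))"
  proof (rule lipschitz_imp_abs_continuous)
    fix x y
    have "dist (b x, E x) (b y, E y) \<le> dist (b x) (b y) + dist (E x) (E y)"
      by (simp add: dist_Pair_Pair sqrt_sum_squares_le_sum)
    also have "\<dots> \<le> 2 * \<bar>x - y\<bar>" using b_lip[of x y] E_lip[of x y] by (simp add: dist_norm)
    finally show "dist (b x, E x) (b y, E y) \<le> 2 * \<bar>x - y\<bar>" .
  qed
  show "(b s, E s) \<in> bicycle_space l" for s using norm_e l_pos by (simp add: bicycle_space_def b_def)
  have "\<exists>c. (b has_vector_derivative c *\<^sub>R (E s - b s)) (at s within {0..\<tau>})" for s
  proof (intro exI[of _ "v s / l"])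
    have "(v s / l) *\<^sub>R (E s - b s) = v s *\<^sub>R e s" using l_pos by (simp add: b_def)
    then show "(b has_vector_derivative (v s / l) *\<^sub>R (E s - b s)) (at s within {0..\<tau>})"
      using has_vector_derivative_at_within[OF b_deriv] by simp
  qed
  then show "AE t in lebesgue_on {0..\<tau>}. \<exists>c. ((\<lambda>s. fst (b s, E s)) has_vector_derivative c *\<^sub>R (snd (b t, E t) - fst (b t, E t))) (at t within {0..\<tau>})"
    by (auto intro!: AE_I2)
qed

lemma length_le:
  assumes "\<tau> \<ge> 0"
  shows "curve_length 0 \<tau> E \<le> ennreal \<tau>"
  unfolding curve_length_def
proof (rule SUP_least, clarify)
  fix D assume D: "D division_of {0..\<tau>}"
  have dv: "D division_of \<Union>D" and U: "\<Union>D = {0..\<tau>}" using D by (auto simp: division_of_def)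
  have "(\<Sum>k\<in>D. dist (E (Inf k)) (E (Sup k))) \<le> (\<Sum>k\<in>D. Sup k - Inf k)"
  proof (rule sum_mono)
    fix k assume k: "k \<in> D"
    obtain x y where "k = {x..y}" "x \<le> y" "Inf k = x" "Sup k = y" using division_nonempty_interval[OF D k] .
    then show "dist (E (Inf k)) (E (Sup k)) \<le> Sup k - Inf k" using E_lip[of x y] by (simp add: dist_norm)
  qed
  also have "\<dots> \<le> measure lebesgue {0..\<tau>}" by (rule sum_length_division_le_measure[OF dv]) (auto simp: U)
  also have "\<dots> = \<tau>" using assms by simp
  finally show "(\<Sum>k\<in>D. ennreal (dist (E (Inf k)) (E (Sup k)))) \<le> ennreal \<tau>"
    by (subst sum_ennreal) (auto intro: ennreal_leI)
qed

text \<open>If \<open>w s = 0\<close>, then \<open>p \<bullet> e s = v s\<close> is 1 or -1 and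
  already exhausts \<open>norm p \<le> 1\<close>; so \<open>p \<bullet> \<i> e s = 0\<close>, and
  the curvature would vanish. Hence the frame turns in one direction only, and one sign of the root
  in the calibration fits the whole geodesic.\<close>

lemma w_nonzero: "norm p \<le> 1 \<Longrightarrow> w s \<noteq> 0"
proof
  assume p: "norm p \<le> 1" and w: "w s = 0"
  have eq: "p = Complex (p \<bullet> e s) (p \<bullet> (\<i> * e s)) * e s"
    using orthonormal_expansion[OF norm_e, of p s] by (simp add: complex_eq_iff)
  have "(norm p)\<^sup>2 = (p \<bullet> e s)\<^sup>2 + (p \<bullet> (\<i> * e s))\<^sup>2"
    using arg_cong[OF eq, of "\<lambda>z. (norm z)\<^sup>2"] unfolding norm_mult norm_e by (simp add: cmod_power2)
  moreover have "(norm p)\<^sup>2 \<le> 1" using p by (simp add: power_le_one)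
  moreover have "(p \<bullet> e s)\<^sup>2 = 1" using v2_w2[of s] w by (simp add: p_e)
  ultimately have "(p \<bullet> (\<i> * e s))\<^sup>2 \<le> 0" by linarith
  then have "p \<bullet> (\<i> * e s) = 0" by simp
  then show False using w_minus[of s] w k_ne[of s] l_pos by simp
qed

lemma isCont_e: "isCont e s" and isCont_u: "isCont u s"
  using has_vector_derivative_continuous[OF e_deriv] has_vector_derivative_continuous[OF u_deriv] by simp_all

lemma sgn_w_abs_w: "norm p \<le> 1 \<Longrightarrow> sgn (w 0) * \<bar>w s\<bar> = w s"
proof -
  assume p: "norm p \<le> 1"
  have "continuous_on UNIV w" unfolding w_def[abs_def]
    by (intro continuous_intros continuous_at_imp_continuous_on ballI isCont_e isCont_u)
  then have "sgn (w 0) = sgn (w s)" using nonvanishing_same_sign[of UNIV w 0 s] w_nonzero[OF p] by simp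
  then show ?thesis by (simp add: sgn_mult_abs)
qed

lemma e_ratio_near_1:
  assumes "0 \<le> s" "s \<le> l / 8"
  shows "e s / e 0 \<in> ball 1 (1/2)"
proof -
  have e0: "e 0 \<noteq> 0" using norm_e[of 0] by auto
  have "norm (e 0 - e s) \<le> (1 / l) * \<bar>0 - s\<bar>" by (rule e_lip)
  also have "\<dots> \<le> 1 / 8" using assms l_pos by (simp add: field_simps)
  finally have "norm (e 0 - e s) \<le> 1 / 8" .
  moreover have "1 - e s / e 0 = (e 0 - e s) / e 0" using e0 by (simp add: diff_divide_distrib)
  then have "norm (1 - e s / e 0) = norm (e 0 - e s)" by (simp add: norm_divide norm_e)
  ultimately show ?thesis by (simp add: dist_norm)
qed

lemma angle_deriv:
  assumes "0 \<le> s" "s \<le> l / 8"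
  shows "((\<lambda>s. Im (Ln (e s / e 0))) has_real_derivative w s / l) (at s)"
proof -
  define r where "r s = e s / e 0" for s
  have e_ne: "e s \<noteq> 0" for s using norm_e[of s] by auto
  have r: "(r has_vector_derivative ((w s / l) *\<^sub>R (\<i> * e s)) / e 0) (at s)"
    unfolding r_def[abs_def] by (rule has_vector_derivative_divide[OF e_deriv])
  have "norm (1 - r s) < 1/2" using e_ratio_near_1[OF assms] by (simp add: r_def dist_norm)
  then have "Re (r s) > 0" using complex_Re_le_cmod[of "1 - r s"] by simp
  then have "(Ln has_field_derivative inverse (r s)) (at (r s))"
    by (intro has_field_derivative_Ln) (simp add: complex_nonpos_Reals_iff)
  from field_vector_diff_chain_at[OF r this]
  have "((\<lambda>s. Ln (r s)) has_vector_derivative ((w s / l) *\<^sub>R (\<i> * e s)) / e 0 * inverse (r s)) (at s)"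
    by (simp add: o_def)
  moreover have "((w s / l) *\<^sub>R (\<i> * e s)) / e 0 * inverse (r s) = (w s / l) *\<^sub>R \<i>"
    using e_ne[of s] e_ne[of 0] by (simp add: r_def scaleR_conv_of_real)
  ultimately have "((\<lambda>s. Ln (r s)) has_vector_derivative (w s / l) *\<^sub>R \<i>) (at s)" by (simp only:)
  from bounded_linear.has_vector_derivative[OF bounded_linear_Im this]
  show ?thesis by (simp add: has_real_derivative_iff_has_vector_derivative r_def)
qed

text \<open>A competitor shorter than \<tau> cannot turn its frame far, so the principal logarithm
  gives its angle and the calibration applies. The calibrating function grows by exactly \<tau>
  along the geodesic and by at most the length along the competitor, between the same end
  values.\<close>

lemma competitor_length:
  fixes M :: "real \<Rightarrow> real"
  assumes p: "norm p \<le> 1" and \<tau>: "0 < \<tau>" "\<tau> \<le> l / 8" and track: "bicycle_track l c d \<eta> M"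
    and ends: "\<eta> c = (b 0, E 0)" "\<eta> d = (b \<tau>, E \<tau>)"
  shows "\<tau> \<le> M d - M c"
proof (rule ccontr)
  assume "\<not> \<tau> \<le> M d - M c"
  then have short: "M d - M c < \<tau>" by simp
  interpret T: bicycle_track l c d \<eta> M by (rule track)
  define z0 where "z0 = e 0"
  have z0: "norm z0 = 1" "z0 \<noteq> 0" using norm_e[of 0] by (auto simp: z0_def)
  have frame_ends: "T.frame c = l *\<^sub>R e 0" "T.frame d = l *\<^sub>R e \<tau>"
    using ends by (simp_all add: T.frame_def b_def)
  define r where "r t = T.frame t / (of_real l * z0)" for t
  have frame_r: "T.frame t = l *\<^sub>R (z0 * r t)" for t
    using l_pos z0 by (simp add: r_def scaleR_conv_of_real)
  have r_diff: "norm (r x - r y) = norm (T.frame x - T.frame y) / l" for x y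
    using l_pos z0 by (simp add: r_def diff_divide_distrib[symmetric] norm_divide norm_mult)
  have norm_r: "norm (r t) = 1" if "t \<in> {c..d}" for t
    using T.norm_frame[OF that] l_pos z0 by (simp add: r_def norm_divide norm_mult)
  have r_ends: "r c = e 0 / e 0" "r d = e \<tau> / e 0"
    unfolding r_def frame_ends using l_pos by (simp_all add: z0_def scaleR_conv_of_real)
  \<comment> \<open>By \<open>short\<close> the frame moves by less than
    \<open>2 * \<tau> \<le> l / 4\<close>, so its direction stays near the initial one.\<close>
  have r_near: "r t \<in> ball 1 (1/2)" if "t \<in> {c..d}" for t
  proof -
    have "M t \<le> M d" using mono_onD[OF T.M_mono, of t d] that by auto
    then have "2 * (M t - M c) \<le> 2 * (M d - M c)" by simp
    also have "\<dots> < 2 * \<tau>" using short by simp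
    also have "\<dots> < l / 2" using \<tau> l_pos by simp
    finally have *: "2 * (M t - M c) < l / 2" .
    have "norm (T.frame t - T.frame c) \<le> 2 * (M t - M c)" using that by (intro T.frame_le) auto
    from order_le_less_trans[OF this *] have "norm (T.frame t - T.frame c) < l / 2" .
    then have "norm (r t - r c) < 1 / 2" unfolding r_diff using l_pos by (simp add: field_simps)
    then show ?thesis using r_ends(1) z0 by (simp add: z0_def dist_norm norm_minus_commute)
  qed
  define \<sigma> where "\<sigma> = sgn (w 0)"
  have \<sigma>: "\<sigma> * \<sigma> = 1" "\<bar>\<sigma>\<bar> = 1" using w_nonzero[OF p, of 0] by (auto simp: \<sigma>_def sgn_if)
  define z where "z x = z0 * cis x" for x
  have nz: "norm (z x) = 1" for x using z0 by (simp add: z_def norm_mult)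
  have pz: "\<bar>p \<bullet> y\<bar> \<le> 1" if "norm y = 1" for y
    using Cauchy_Schwarz_ineq2[of p y] that p by simp
  \<comment> \<open>Chosen so that \<open>p + (W' x / l) \<i> z x\<close> has components
    \<open>p \<bullet> z x\<close> and
    \<open>\<sigma> * sqrt (1 - (p \<bullet> z x)\<^sup>2)\<close> in the basis \<open>z x\<close>,
    \<open>\<i> * z x\<close>, hence norm 1. The root is real because \<open>norm p \<le> 1\<close>;
    with \<sigma> the sign of \<open>w\<close>, the vector is the tangent \<open>u\<close> along the
    geodesic.\<close>
  define W' where "W' x = l * (\<sigma> * sqrt (1 - (p \<bullet> z x)\<^sup>2) - p \<bullet> (\<i> * z x))" for x
  have "isCont W' x" for x
    unfolding W'_def[abs_def] z_def[abs_def] cis_conv_exp by (intro continuous_intros)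
  then obtain W where W: "\<And>x. (W has_vector_derivative W' x) (at x)"
    using antiderivative_on_reals[of W' 0] by metis
  have W_deriv: "(W has_real_derivative W' x) (at x)" for x
    using W by (simp add: has_real_derivative_iff_has_vector_derivative)
  have "\<bar>(p \<bullet> T.front d + W (Im (Ln (r d)))) - (p \<bullet> T.front c + W (Im (Ln (r c))))\<bar> \<le> M d - M c"
  proof (rule T.calibration[OF z0(1) _ _ W_deriv, where C = "2 / l" and L = "2 * l"])
    fix t assume t: "t \<in> {c..d}"
    show "T.frame t = l *\<^sub>R (z0 * cis (Im (Ln (r t))))"
      unfolding cis_Im_Ln[OF norm_r[OF t]] by (rule frame_r)
  next
    fix x y assume "x \<in> {c..d}" "y \<in> {c..d}"
    then have "\<bar>Im (Ln (r x)) - Im (Ln (r y))\<bar> \<le> 2 * norm (r x - r y)"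
      by (intro abs_Im_Ln_diff_le r_near)
    then show "\<bar>Im (Ln (r x)) - Im (Ln (r y))\<bar> \<le> 2 / l * norm (T.frame x - T.frame y)"
      by (simp add: r_diff)
  next
    fix x
    have "\<bar>\<sigma> * sqrt (1 - (p \<bullet> z x)\<^sup>2) - p \<bullet> (\<i> * z x)\<bar> \<le> 2"
    proof -
      have "(p \<bullet> z x)\<^sup>2 \<le> 1" using pz[OF nz, of x] by (simp add: abs_square_le_1)
      then have "\<bar>\<sigma> * sqrt (1 - (p \<bullet> z x)\<^sup>2)\<bar> \<le> 1" unfolding abs_mult \<sigma> by simp
      moreover have "\<bar>p \<bullet> (\<i> * z x)\<bar> \<le> 1" by (rule pz) (simp add: norm_mult nz)
      ultimately show ?thesis by linarith
    qed
    then have "l * \<bar>\<sigma> * sqrt (1 - (p \<bullet> z x)\<^sup>2) - p \<bullet> (\<i> * z x)\<bar> \<le> l * 2" using l_pos by (intro mult_left_mono) auto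
    then show "\<bar>W' x\<bar> \<le> 2 * l" unfolding W'_def abs_mult using l_pos by simp
  next
    fix x
    define s where "s = \<sigma> * sqrt (1 - (p \<bullet> z x)\<^sup>2)"
    have "(p \<bullet> z x)\<^sup>2 \<le> 1" using pz[OF nz, of x] by (simp add: abs_square_le_1)
    then have s2: "s\<^sup>2 = 1 - (p \<bullet> z x)\<^sup>2" using \<sigma> by (simp add: s_def power_mult_distrib power2_eq_square[of \<sigma>])
    have "p + (W' x / l) *\<^sub>R (\<i> * z x) = Complex (p \<bullet> z x) s * z x"
    proof -
      have "p + (W' x / l) *\<^sub>R (\<i> * z x) = ((p \<bullet> z x) *\<^sub>R z x + (p \<bullet> (\<i> * z x)) *\<^sub>R (\<i> * z x)) + (s - p \<bullet> (\<i> * z x)) *\<^sub>R (\<i> * z x)"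
        using orthonormal_expansion[OF nz, of p x] l_pos by (simp add: W'_def s_def)
      also have "\<dots> = Complex (p \<bullet> z x) s * z x"
        by (simp add: complex_eq_iff left_diff_distrib)
      finally show ?thesis .
    qed
    then have "norm (p + (W' x / l) *\<^sub>R (\<i> * z x)) = sqrt ((p \<bullet> z x)\<^sup>2 + s\<^sup>2)"
      by (simp add: norm_mult nz complex_norm)
    then show "norm (p + (W' x / l) *\<^sub>R (\<i> * (z0 * cis x))) \<le> 1" unfolding s2 z_def by simp
  qed
  \<comment> \<open>The mean value theorem with the constant derivative 1: along the geodesic the
    gradient is the tangent itself, and \<open>v\<^sup>2 + w\<^sup>2 = 1\<close>.\<close>
  moreover have "\<exists>x>0. x < \<tau> \<and> (p \<bullet> E \<tau> + W (Im (Ln (e \<tau> / e 0)))) - (p \<bullet> E 0 + W (Im (Ln (e 0 / e 0)))) = (\<tau> - 0) * 1"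
  proof (rule MVT2[OF \<tau>(1)])
    fix s assume s: "0 \<le> s" "s \<le> \<tau>"
    define \<theta> where "\<theta> s = Im (Ln (e s / e 0))" for s
    have \<theta>: "(\<theta> has_real_derivative w s / l) (at s)"
      unfolding \<theta>_def[abs_def] using s \<tau> by (intro angle_deriv) auto
    have "z (\<theta> s) = e s"
      using cis_Im_Ln[of "e s / e 0"] z0 by (simp add: z_def \<theta>_def norm_divide norm_e z0_def)
    moreover have "sqrt (1 - (v s)\<^sup>2) = \<bar>w s\<bar>" using v2_w2[of s] by (simp add: algebra_simps flip: real_sqrt_abs)
    ultimately have W'_eq: "W' (\<theta> s) = l * (w s - p \<bullet> (\<i> * e s))"
      using sgn_w_abs_w[OF p, of s] by (simp add: W'_def p_e \<sigma>_def)
    have "((\<lambda>s. W (\<theta> s)) has_real_derivative W' (\<theta> s) * (w s / l)) (at s)"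
      by (rule DERIV_chain2[OF W_deriv \<theta>])
    moreover have "((\<lambda>s. p \<bullet> E s) has_real_derivative p \<bullet> u s) (at s)"
      unfolding has_real_derivative_iff_has_vector_derivative
      by (rule bounded_linear.has_vector_derivative[OF bounded_linear_inner_right E_deriv])
    ultimately have "((\<lambda>s. p \<bullet> E s + W (\<theta> s)) has_real_derivative p \<bullet> u s + W' (\<theta> s) * (w s / l)) (at s)"
      by (intro DERIV_add)
    moreover have "p \<bullet> u s + W' (\<theta> s) * (w s / l) = 1"
    proof -
      have "p \<bullet> u s = p \<bullet> (v s *\<^sub>R e s + w s *\<^sub>R (\<i> * e s))" using u_expand[of s] by (rule arg_cong)
      also have "\<dots> = v s * v s + w s * (p \<bullet> (\<i> * e s))" unfolding inner_add_right inner_scaleR_right p_e ..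
      finally have "p \<bullet> u s + W' (\<theta> s) * (w s / l) = v s * v s + w s * w s"
        unfolding W'_eq using l_pos by (simp add: algebra_simps)
      then show ?thesis using v2_w2[of s] by (simp add: power2_eq_square)
    qed
    ultimately show "((\<lambda>s. p \<bullet> E s + W (Im (Ln (e s / e 0)))) has_real_derivative 1) (at s)"
      by (simp only: \<theta>_def)
  qed
  ultimately show False using short ends by (auto simp: r_ends)
qed

text \<open>On the length \<open>l / 8\<close> both the geodesic and every shorter competitor keep
  their frame directions, relative to the initial one, in the ball of radius \<open>1 / 2\<close>
  around 1, where the angle is well behaved.\<close>

lemma short_arc_minimizing:
  assumes p: "norm p \<le> 1"
  shows "minimizing_bicycle_path l 0 (l / 8) (\<lambda>s. (b s, E s))"
  unfolding minimizing_bicycle_path_def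
proof (intro conjI allI impI notI)
  have pos: "0 < l / 8" using l_pos by simp
  show "bicycle_path l 0 (l / 8) (\<lambda>s. (b s, E s))" using l_pos by (intro geodesic_bicycle_path) simp
  show False if const: "(\<lambda>s. (b s, E s)) constant_on {0..l / 8}"
  proof -
    obtain q where q: "\<forall>s\<in>{0..l / 8}. (b s, E s) = q" by (rule exE[OF const[unfolded constant_on_def]]) (rule that)
    have "(E has_vector_derivative u 0) (at 0 within {0..l / 8})" using E_deriv by (rule has_vector_derivative_at_within)
    moreover have "(E has_vector_derivative 0) (at 0 within {0..l / 8})"
      by (rule has_vector_derivative_transform[OF _ _ has_vector_derivative_const[of "snd q"]]) (use q l_pos in force)+
    ultimately have "u 0 = 0"
      using vector_derivative_unique_within_closed_interval[of 0 "l / 8" 0 E] l_pos by auto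
    then show False using norm_u[of 0] by simp
  qed
  fix c d \<eta> assume "bicycle_path l c d \<eta> \<and> \<eta> c = (b 0, E 0) \<and> \<eta> d = (b (l / 8), E (l / 8))"
  then have \<eta>: "bicycle_path l c d \<eta>" "\<eta> c = (b 0, E 0)" "\<eta> d = (b (l / 8), E (l / 8))" by auto
  define len where "len t = curve_length c t (front_track \<eta>)" for t
  have "l / 8 \<le> enn2real (len d) - enn2real (len c)" unfolding len_def
    by (rule competitor_length[OF p pos order_refl bicycle_track_curve_length[OF l_pos \<eta>(1)] \<eta>(2,3)])
  then have "l / 8 \<le> enn2real (len d)" using enn2real_nonneg[of "len c"] by linarith
  then have "ennreal (l / 8) \<le> ennreal (enn2real (len d))" by (rule ennreal_leI)
  also have "\<dots> \<le> len d" by (cases "len d") auto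
  finally have "ennreal (l / 8) \<le> len d" .
  then have "curve_length 0 (l / 8) E \<le> len d" using order_trans[OF length_le] pos by auto
  then show "curve_length 0 (l / 8) (front_track (\<lambda>s. (b s, E s))) \<le> curve_length c d (front_track \<eta>)"
    by (simp add: front_track_def len_def)
qed

lemma short_arc: "is_arc_of 0 (l / 8) (front_track (\<lambda>s. (b s, E s))) E"
  unfolding is_arc_of_def
  by (rule exI[of _ 0], rule exI[of _ "l / 8"], rule exI[of _ "\<lambda>t. t"])
    (use l_pos in \<open>auto simp: front_track_def intro: mono_onI\<close>)

end

theorem theorem1p1:
  fixes l :: real
  assumes "l > 0"
  shows "(\<forall>a b \<gamma>. minimizing_bicycle_path l a b \<gamma> \<longrightarrow>
            (\<exists>L. straight_line L \<and> is_arc_of a b (front_track \<gamma>) L) \<or>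
            (\<exists>E. non_inflectional_elastic_curve E \<and> plane_width (range E) \<le> ennreal (2 * l) \<and>
                 is_arc_of a b (front_track \<gamma>) E)) \<and>
         (\<forall>E. non_inflectional_elastic_curve E \<longrightarrow>
            (\<exists>E'. non_inflectional_elastic_curve E' \<and> same_shape E E' \<and>
                  plane_width (range E') \<le> ennreal (2 * l) \<and>
                  (\<exists>a b \<gamma>. minimizing_bicycle_path l a b \<gamma> \<and> is_arc_of a b (front_track \<gamma>) E')))"
proof (intro conjI allI impI)
  fix a b \<gamma> assume "minimizing_bicycle_path l a b \<gamma>"
  with assms show "(\<exists>L. straight_line L \<and> is_arc_of a b (front_track \<gamma>) L) \<or>
      (\<exists>E. non_inflectional_elastic_curve E \<and> plane_width (range E) \<le> ennreal (2 * l) \<and>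
           is_arc_of a b (front_track \<gamma>) E)"
    by (rule minimizer_front_track)
next
  fix E assume "non_inflectional_elastic_curve E"
  from rescaled_elastica[OF assms this]
  obtain p u k E' where geo: "complete_geodesic l p u k E'" and p: "norm p \<le> 1" and shape: "same_shape E E'" .
  interpret complete_geodesic l p u k E' by (rule geo)
  show "\<exists>E'. non_inflectional_elastic_curve E' \<and> same_shape E E' \<and>
      plane_width (range E') \<le> ennreal (2 * l) \<and>
      (\<exists>a b \<gamma>. minimizing_bicycle_path l a b \<gamma> \<and> is_arc_of a b (front_track \<gamma>) E')"
    using non_inflectional shape width_le short_arc_minimizing[OF p] short_arc by blast
qed

end
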